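(* Let $K$ be a commutative ring with unit, $E$ a directed graph and $X$ a set of regular vertices of $E$. Then there is an isomorphism of $K$-algebras $C_K^X(E)\cong K\mathscr G_{E,X}$ between the Cohn path algebra of $E$ relative to $X$ and the algebra of the ample groupoid $\mathscr G_{E,X}$.
   Context: $E=(E^{(0)},E^{(1)})$ is a directed graph (loops and multiple edges allowed); $\boldsymbol d(e),\boldsymbol r(e)$ are the initial and terminal vertices of an edge or path; paths are composed left to right, and the empty path at $v$ is written $v$. A vertex is regular if it emits at least one and only finitely many edges. The graph inverse semigroup $P_E$ is the $\ast$-semigroup with zero generated by $E^{(0)}\cup E^{(1)}$ subject to: $E^{(0)}$ is a set of pairwise orthogonal (self-adjoint) idempotents; $\boldsymbol d(e)e=e=e\boldsymbol r(e)$ and $e^\ast e=\boldsymbol r(e)$ for $e\in E^{(1)}$; $f^\ast e=0$ for distinct $e,f\in E^{(1)}$. It is an inverse semigroup whose nonzero elements are uniquely of the form $pq^\ast$ with $p,q$ finite paths ending at the same vertex, and whose nonzero idempotents are the $pp^\ast$ with $p$ a finite path. $C_K^X(E)=KP_E/I_X$, where $KP_E$ is the semigroup algebra and $I_X$ is the ideal generated by the zero element of $P_E$ and the elements $v-\sum_{\boldsymbol d(e)=v}ee^\ast$ with $v\in X$. For an inverse semigroup $S$ with semilattice of idempotents $E(S)$ (ordered by $e\leq f$ iff $ef=e$; and $u\leq s$ in $S$ iff $u=se$ for some $e\in E(S)$), $\widehat{E(S)}$ is the space of nonzero semigroup homomorphisms $\theta\colon E(S)\to\{0,1\}$ (multiplicative),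 topologized as a subspace of $\{0,1\}^{E(S)}$; put $D(e)=\{\theta\mid\theta(e)=1\}$. $S$ acts by $\beta_s\colon D(s^\ast s)\to D(ss^\ast)$, $\beta_s(\theta)(e)=\theta(s^\ast es)$. The universal groupoid $\mathscr G(S)$ is the groupoid of germs $[s,\theta]$ with $\theta\in D(s^\ast s)$, where $[s,\theta]=[t,\theta']$ iff $\theta=\theta'$ and there is $u\leq s,t$ with $\theta\in D(u^\ast u)$; the product $[s,\theta][t,\theta']$ is defined iff $\theta=\beta_t(\theta')$ and equals $[st,\theta']$. A basis for the topology is given by the sets $\{[s,\theta]\mid\theta\in U\}$ with $s\in S$ and $U\subseteq D(s^\ast s)$ open. The unit space is identified with $\widehat{E(S)}$. For $e\in E(S)$ the principal character $\theta_e$ is given by $\theta_e(f)=1$ iff $f\geq e$. For a finite path $p$ write $\theta_p=\theta_{pp^\ast}$; $\theta_0$ is the principal character of the zero of $P_E$ (identically $1$). Put $Y=\widehat{E(P_E)}\setminus(\{\theta_p\mid p\text{ a finite path with }\boldsymbol r(p)\in X\}\cup\{\theta_0\})$, which is a closed invariant subset, and let $\mathscr G_{E,X}=\mathscr G(P_E)|_Y$ be the subgroupoid of all arrows of $\mathscr G(P_E)$ beginning (hence ending) in $Y$. An ample groupoid is an étale topological groupoid $\mathscr G$ whose unit space is Hausdorff with a basis of compact open sets. $K\mathscr G$ is the $K$-span, inside the functions $\mathscr G\to K$, of indicator functions $1_U$ of compact open bisections $U$ (open subsets on which domain and range maps are injective), with convolution product $(f\ast g)(\gamma)=\sum_{\alpha\beta=\gamma}f(\alpha)g(\beta)$.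 *)

theory Defs
  imports
    "HOL-Analysis.Function_Topology"
    "HOL-Library.Poly_Mapping"
    "Graph_Theory.Arc_Walk"
begin

section \<open>Inverse semigroups and their spectra\<close>

text \<open>Semigroups with involution; in an inverse semigroup \<open>sstar\<close> is the inverse operation.\<close>

record 's star_semigroup =
  scarrier :: "'s set"
  smult :: "'s \<Rightarrow> 's \<Rightarrow> 's"
  sstar :: "'s \<Rightarrow> 's"

definition idempotents :: "('s, 'm) star_semigroup_scheme \<Rightarrow> 's set" where
  "idempotents S = {e \<in> scarrier S. smult S e e = e}"

definition idem_le :: "('s, 'm) star_semigroup_scheme \<Rightarrow> 's \<Rightarrow> 's \<Rightarrow> bool" where
  "idem_le S e f \<longleftrightarrow> smult S e f = e"

definition natural_le :: "('s, 'm) star_semigroup_scheme \<Rightarrow> 's \<Rightarrow> 's \<Rightarrow> bool" where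
  "natural_le S u s \<longleftrightarrow> (\<exists>e \<in> idempotents S. u = smult S s e)"

text \<open>Characters are extensional functions on the idempotents, so that the product topology
  of the library applies.\<close>

definition characters :: "('s, 'm) star_semigroup_scheme \<Rightarrow> ('s \<Rightarrow> nat) set" where
  "characters S = {\<theta> \<in> idempotents S \<rightarrow>\<^sub>E {0, 1}.
     (\<forall>e \<in> idempotents S. \<forall>f \<in> idempotents S. \<theta> (smult S e f) = \<theta> e * \<theta> f) \<and>
     (\<exists>e \<in> idempotents S. \<theta> e \<noteq> 0)}"

definition character_topology :: "('s, 'm) star_semigroup_scheme \<Rightarrow> ('s \<Rightarrow> nat) topology" where
  "character_topology S = subtopology
     (product_topology (\<lambda>_. discrete_topology {0, 1}) (idempotents S)) (characters S)"

definition char_dom :: "('s, 'm) star_semigroup_scheme \<Rightarrow> 's \<Rightarrow> ('s \<Rightarrow> nat) set" where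
  "char_dom S e = {\<theta> \<in> characters S. \<theta> e = 1}"

definition char_act ::
  "('s, 'm) star_semigroup_scheme \<Rightarrow> 's \<Rightarrow> ('s \<Rightarrow> nat) \<Rightarrow> ('s \<Rightarrow> nat)" where
  "char_act S s \<theta> = (\<lambda>e \<in> idempotents S. \<theta> (smult S (smult S (sstar S s) e) s))"

definition principal_char :: "('s, 'm) star_semigroup_scheme \<Rightarrow> 's \<Rightarrow> ('s \<Rightarrow> nat)" where
  "principal_char S e = (\<lambda>f \<in> idempotents S. if idem_le S e f then 1 else 0)"


section \<open>The universal groupoid\<close>

text \<open>A groupoid with arrows in \<open>'g\<close> and objects in \<open>'u\<close>, together with a topology on its arrows.
  The product \<open>gmult \<alpha> \<beta>\<close> is meaningful only if \<open>gdom \<alpha> = gran \<beta>\<close>.\<close>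

record ('g, 'u) top_groupoid =
  arrows :: "'g set"
  gdom :: "'g \<Rightarrow> 'u"
  gran :: "'g \<Rightarrow> 'u"
  gmult :: "'g \<Rightarrow> 'g \<Rightarrow> 'g"
  gtop :: "'g topology"

type_synonym 's germ = "('s \<times> ('s \<Rightarrow> nat)) set"

definition germ_rel ::
  "('s, 'm) star_semigroup_scheme \<Rightarrow> (('s \<times> ('s \<Rightarrow> nat)) \<times> ('s \<times> ('s \<Rightarrow> nat))) set" where
  "germ_rel S = {((s, \<theta>), (t, \<theta>')).
     s \<in> scarrier S \<and> \<theta> \<in> char_dom S (smult S (sstar S s) s) \<and>
     t \<in> scarrier S \<and> \<theta>' \<in> char_dom S (smult S (sstar S t) t) \<and>
     \<theta> = \<theta>' \<and>
     (\<exists>u \<in> scarrier S. natural_le S u s \<and> natural_le S u t \<and>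
        \<theta> \<in> char_dom S (smult S (sstar S u) u))}"

definition germ_of :: "('s, 'm) star_semigroup_scheme \<Rightarrow> 's \<Rightarrow> ('s \<Rightarrow> nat) \<Rightarrow> 's germ" where
  "germ_of S s \<theta> = germ_rel S `` {(s, \<theta>)}"

definition germs :: "('s, 'm) star_semigroup_scheme \<Rightarrow> 's germ set" where
  "germs S = {germ_of S s \<theta> | s \<theta>.
     s \<in> scarrier S \<and> \<theta> \<in> char_dom S (smult S (sstar S s) s)}"

text \<open>Domain, range and product are read off from arbitrary representatives
  (domain and range of \<open>[s, \<theta>]\<close> are \<open>\<theta>\<close> and \<open>\<beta>\<^sub>s(\<theta>)\<close>).\<close>

definition germ_dom :: "'s germ \<Rightarrow> ('s \<Rightarrow> nat)" where
  "germ_dom \<gamma> = (THE \<theta>. \<exists>s. (s, \<theta>) \<in> \<gamma>)"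

definition germ_ran :: "('s, 'm) star_semigroup_scheme \<Rightarrow> 's germ \<Rightarrow> ('s \<Rightarrow> nat)" where
  "germ_ran S \<gamma> = (THE \<eta>. \<exists>s \<theta>. (s, \<theta>) \<in> \<gamma> \<and> \<eta> = char_act S s \<theta>)"

definition germ_mult :: "('s, 'm) star_semigroup_scheme \<Rightarrow> 's germ \<Rightarrow> 's germ \<Rightarrow> 's germ" where
  "germ_mult S \<alpha> \<beta> = (\<Union>(s, \<theta>) \<in> \<alpha>. \<Union>(t, \<theta>') \<in> \<beta>. germ_of S (smult S s t) \<theta>')"

definition germ_topology :: "('s, 'm) star_semigroup_scheme \<Rightarrow> 's germ topology" where
  "germ_topology S = topology_generated_by
     {germ_of S s ` U | s U. s \<in> scarrier S \<and> openin (character_topology S) U \<and>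
        U \<subseteq> char_dom S (smult S (sstar S s) s)}"

definition universal_groupoid ::
  "('s, 'm) star_semigroup_scheme \<Rightarrow> ('s germ, 's \<Rightarrow> nat) top_groupoid" where
  "universal_groupoid S =
     \<lparr>arrows = germs S, gdom = germ_dom, gran = germ_ran S, gmult = germ_mult S,
      gtop = germ_topology S\<rparr>"

definition restrict_groupoid :: "('g, 'u) top_groupoid \<Rightarrow> 'u set \<Rightarrow> ('g, 'u) top_groupoid" where
  "restrict_groupoid G Y =
     (let A = {\<gamma> \<in> arrows G. gdom G \<gamma> \<in> Y}
      in G\<lparr>arrows := A, gtop := subtopology (gtop G) A\<rparr>)"


section \<open>Algebras\<close>

text \<open>\<open>K\<close>-algebras that need not have a unit. The sort \<open>{comm_ring, comm_monoid_mult}\<close> is used for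
  \<open>K\<close> rather than \<open>comm_ring_1\<close>: it describes commutative rings with unit, including the zero
  ring.\<close>

record ('k, 'a) kalgebra =
  acarrier :: "'a set"
  azero :: 'a
  aadd :: "'a \<Rightarrow> 'a \<Rightarrow> 'a"
  amult :: "'a \<Rightarrow> 'a \<Rightarrow> 'a"
  ascale :: "'k \<Rightarrow> 'a \<Rightarrow> 'a"

definition algebra_iso :: "('k, 'a) kalgebra \<Rightarrow> ('k, 'b) kalgebra \<Rightarrow> ('a \<Rightarrow> 'b) set" where
  "algebra_iso A B = {\<phi>. bij_betw \<phi> (acarrier A) (acarrier B) \<and>
     (\<forall>x \<in> acarrier A. \<forall>y \<in> acarrier A. \<phi> (aadd A x y) = aadd B (\<phi> x) (\<phi> y)) \<and>
     (\<forall>x \<in> acarrier A. \<forall>y \<in> acarrier A. \<phi> (amult A x y) = amult B (\<phi> x) (\<phi> y)) \<and>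
     (\<forall>k. \<forall>x \<in> acarrier A. \<phi> (ascale A k x) = ascale B k (\<phi> x))}"

definition algebra_ideal :: "'a set \<Rightarrow> ('k, 'a) kalgebra \<Rightarrow> bool" where
  "algebra_ideal I A \<longleftrightarrow> I \<subseteq> acarrier A \<and> azero A \<in> I \<and>
     (\<forall>x \<in> I. \<forall>y \<in> I. aadd A x y \<in> I) \<and>
     (\<forall>k. \<forall>x \<in> I. ascale A k x \<in> I) \<and>
     (\<forall>x \<in> I. \<forall>a \<in> acarrier A. amult A a x \<in> I \<and> amult A x a \<in> I)"

definition ideal_generated :: "('k, 'a) kalgebra \<Rightarrow> 'a set \<Rightarrow> 'a set" where
  "ideal_generated A G = \<Inter>{I. algebra_ideal I A \<and> G \<subseteq> I}"

definition algebra_coset :: "('k, 'a) kalgebra \<Rightarrow> 'a set \<Rightarrow> 'a \<Rightarrow> 'a set" where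
  "algebra_coset A I x = aadd A x ` I"

definition quotient_algebra :: "('k, 'a) kalgebra \<Rightarrow> 'a set \<Rightarrow> ('k, 'a set) kalgebra" where
  "quotient_algebra A I =
     \<lparr>acarrier = algebra_coset A I ` acarrier A,
      azero = algebra_coset A I (azero A),
      aadd = (\<lambda>P Q. \<Union>x \<in> P. \<Union>y \<in> Q. algebra_coset A I (aadd A x y)),
      amult = (\<lambda>P Q. \<Union>x \<in> P. \<Union>y \<in> Q. algebra_coset A I (amult A x y)),
      ascale = (\<lambda>k P. \<Union>x \<in> P. algebra_coset A I (ascale A k x))\<rparr>"

definition semigroup_algebra ::
  "('s, 'm) star_semigroup_scheme
    \<Rightarrow> ('k::{comm_ring, comm_monoid_mult}, 's \<Rightarrow>\<^sub>0 'k) kalgebra" where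
  "semigroup_algebra S =
     \<lparr>acarrier = {f. Poly_Mapping.keys f \<subseteq> scarrier S},
      azero = 0,
      aadd = (+),
      amult = (\<lambda>f g. \<Sum>s \<in> Poly_Mapping.keys f. \<Sum>t \<in> Poly_Mapping.keys g.
        Poly_Mapping.single (smult S s t) (Poly_Mapping.lookup f s * Poly_Mapping.lookup g t)),
      ascale = (\<lambda>k. Poly_Mapping.map (\<lambda>c. k * c))\<rparr>"

definition compact_open_bisections :: "('g, 'u) top_groupoid \<Rightarrow> 'g set set" where
  "compact_open_bisections G = {U. openin (gtop G) U \<and> compactin (gtop G) U \<and>
     inj_on (gdom G) U \<and> inj_on (gran G) U}"

text \<open>The product is the convolution \<open>\<Sum>\<^bsub>\<alpha>\<beta>=\<gamma>\<^esub> f(\<alpha>) g(\<beta>)\<close>. For \<open>f\<close>, \<open>g\<close> in the span only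
  finitely many pairs satisfy \<open>f \<alpha> \<noteq> 0\<close> and \<open>g \<beta> \<noteq> 0\<close>, and the sum is taken over these, as a sum
  over an infinite set would be \<open>0\<close> by convention.\<close>

definition groupoid_algebra ::
  "('g, 'u) top_groupoid \<Rightarrow> ('k::{comm_ring, comm_monoid_mult}, 'g \<Rightarrow> 'k) kalgebra" where
  "groupoid_algebra G =
     \<lparr>acarrier = {(\<lambda>\<gamma>. \<Sum>U \<in> F. c U * (if \<gamma> \<in> U then 1 else 0)) | F c.
        finite F \<and> F \<subseteq> compact_open_bisections G},
      azero = (\<lambda>\<gamma>. 0),
      aadd = (\<lambda>f g \<gamma>. f \<gamma> + g \<gamma>),
      amult = (\<lambda>f g \<gamma>. \<Sum>(\<alpha>, \<beta>) \<in> {(\<alpha>, \<beta>). \<alpha> \<in> arrows G \<and> \<beta> \<in> arrows G \<and>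
        gdom G \<alpha> = gran G \<beta> \<and> gmult G \<alpha> \<beta> = \<gamma> \<and> f \<alpha> \<noteq> 0 \<and> g \<beta> \<noteq> 0}. f \<alpha> * g \<beta>),
      ascale = (\<lambda>k f \<gamma>. k * f \<gamma>)\<rparr>"


section \<open>Graph inverse semigroups\<close>

definition regular_vertex :: "('v, 'e) pre_digraph \<Rightarrow> 'v \<Rightarrow> bool" where
  "regular_vertex E v \<longleftrightarrow> v \<in> verts E \<and> out_arcs E v \<noteq> {} \<and> finite (out_arcs E v)"

text \<open>The graph inverse semigroup is given by its presentation: terms over the generators modulo
  the least congruence containing the laws of \<open>*\<close>-semigroups with zero and the defining relations.\<close>

datatype ('v, 'e) gterm =
    Zero
  | Vertex 'v
  | Edge 'e
  | Mult "('v, 'e) gterm" "('v, 'e) gterm"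
  | Star "('v, 'e) gterm"

inductive_set gterms :: "('v, 'e) pre_digraph \<Rightarrow> ('v, 'e) gterm set"
  for E :: "('v, 'e) pre_digraph" where
  "Zero \<in> gterms E"
| "v \<in> verts E \<Longrightarrow> Vertex v \<in> gterms E"
| "e \<in> arcs E \<Longrightarrow> Edge e \<in> gterms E"
| "s \<in> gterms E \<Longrightarrow> t \<in> gterms E \<Longrightarrow> Mult s t \<in> gterms E"
| "s \<in> gterms E \<Longrightarrow> Star s \<in> gterms E"

inductive gcong :: "('v, 'e) pre_digraph \<Rightarrow> ('v, 'e) gterm \<Rightarrow> ('v, 'e) gterm \<Rightarrow> bool"
  for E :: "('v, 'e) pre_digraph" where
  refl: "s \<in> gterms E \<Longrightarrow> gcong E s s"
| sym: "gcong E s t \<Longrightarrow> gcong E t s"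
| trans: "gcong E s t \<Longrightarrow> gcong E t u \<Longrightarrow> gcong E s u"
| mult: "gcong E s s' \<Longrightarrow> gcong E t t' \<Longrightarrow> gcong E (Mult s t) (Mult s' t')"
| star: "gcong E s t \<Longrightarrow> gcong E (Star s) (Star t)"
| assoc: "s \<in> gterms E \<Longrightarrow> t \<in> gterms E \<Longrightarrow> u \<in> gterms E \<Longrightarrow>
    gcong E (Mult (Mult s t) u) (Mult s (Mult t u))"
| star_star: "s \<in> gterms E \<Longrightarrow> gcong E (Star (Star s)) s"
| star_mult: "s \<in> gterms E \<Longrightarrow> t \<in> gterms E \<Longrightarrow>
    gcong E (Star (Mult s t)) (Mult (Star t) (Star s))"
| zero_left: "s \<in> gterms E \<Longrightarrow> gcong E (Mult Zero s) Zero"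
| zero_right: "s \<in> gterms E \<Longrightarrow> gcong E (Mult s Zero) Zero"
| vertex_idem: "v \<in> verts E \<Longrightarrow> gcong E (Mult (Vertex v) (Vertex v)) (Vertex v)"
| vertex_star: "v \<in> verts E \<Longrightarrow> gcong E (Star (Vertex v)) (Vertex v)"
| vertex_orth: "v \<in> verts E \<Longrightarrow> w \<in> verts E \<Longrightarrow> v \<noteq> w \<Longrightarrow>
    gcong E (Mult (Vertex v) (Vertex w)) Zero"
| edge_tail: "e \<in> arcs E \<Longrightarrow> gcong E (Mult (Vertex (tail E e)) (Edge e)) (Edge e)"
| edge_head: "e \<in> arcs E \<Longrightarrow> gcong E (Mult (Edge e) (Vertex (head E e))) (Edge e)"
| edge_star: "e \<in> arcs E \<Longrightarrow> gcong E (Mult (Star (Edge e)) (Edge e)) (Vertex (head E e))"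
| edge_orth: "e \<in> arcs E \<Longrightarrow> f \<in> arcs E \<Longrightarrow> e \<noteq> f \<Longrightarrow>
    gcong E (Mult (Star (Edge f)) (Edge e)) Zero"

definition gclass :: "('v, 'e) pre_digraph \<Rightarrow> ('v, 'e) gterm \<Rightarrow> ('v, 'e) gterm set" where
  "gclass E t = {s. gcong E t s}"

definition graph_semigroup ::
  "('v, 'e) pre_digraph \<Rightarrow> ('v, 'e) gterm set star_semigroup" where
  "graph_semigroup E =
     \<lparr>scarrier = gclass E ` gterms E,
      smult = (\<lambda>P Q. \<Union>s \<in> P. \<Union>t \<in> Q. gclass E (Mult s t)),
      sstar = (\<lambda>P. \<Union>s \<in> P. gclass E (Star s))\<rparr>"

text \<open>A finite path is a pair of its initial vertex and its list of arcs, see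
  \<^const>\<open>pre_digraph.awalk\<close>. The trailing vertex of the term is absorbed by the relation
  \<open>e r(e) = e\<close>.\<close>

fun path_term :: "('v, 'e) pre_digraph \<Rightarrow> 'v \<Rightarrow> 'e list \<Rightarrow> ('v, 'e) gterm" where
  "path_term E v [] = Vertex v"
| "path_term E v (e # es) = Mult (Edge e) (path_term E (head E e) es)"

definition path_char ::
  "('v, 'e) pre_digraph \<Rightarrow> 'v \<Rightarrow> 'e list \<Rightarrow> ('v, 'e) gterm set \<Rightarrow> nat" where
  "path_char E v p = principal_char (graph_semigroup E)
     (gclass E (Mult (path_term E v p) (Star (path_term E v p))))"


section \<open>Relative Cohn path algebras and their groupoids\<close>

definition cohn_ideal ::
  "('v, 'e) pre_digraph \<Rightarrow> 'v set
    \<Rightarrow> (('v, 'e) gterm set \<Rightarrow>\<^sub>0 'k::{comm_ring, comm_monoid_mult}) set" where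
  "cohn_ideal E X = ideal_generated (semigroup_algebra (graph_semigroup E))
     (insert (Poly_Mapping.single (gclass E Zero) 1)
       {Poly_Mapping.single (gclass E (Vertex v)) 1
          - (\<Sum>e \<in> out_arcs E v. Poly_Mapping.single (gclass E (Mult (Edge e) (Star (Edge e)))) 1)
        | v. v \<in> X})"

definition cohn_algebra ::
  "('v, 'e) pre_digraph \<Rightarrow> 'v set
    \<Rightarrow> ('k::{comm_ring, comm_monoid_mult}, (('v, 'e) gterm set \<Rightarrow>\<^sub>0 'k) set) kalgebra" where
  "cohn_algebra E X = quotient_algebra (semigroup_algebra (graph_semigroup E)) (cohn_ideal E X)"

definition cohn_groupoid ::
  "('v, 'e) pre_digraph \<Rightarrow> 'v set
    \<Rightarrow> (('v, 'e) gterm set germ, ('v, 'e) gterm set \<Rightarrow> nat) top_groupoid" where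
  "cohn_groupoid E X = restrict_groupoid (universal_groupoid (graph_semigroup E))
     (characters (graph_semigroup E)
       - ({path_char E v p | v p w. pre_digraph.awalk E v p w \<and> w \<in> X}
          \<union> {principal_char (graph_semigroup E) (gclass E Zero)}))"

end

theory Submission
  imports Defs
begin

text \<open>An element \<open>s\<close> of \<open>P\<^sub>E\<close> is sent to the indicator function of its slice
  \<open>{[s, \<theta>] | \<theta> \<in> Y}\<close>, a compact open bisection. This is multiplicative, and it kills
  \<open>v - \<Sum> ee\<^sup>*\<close> for \<open>v \<in> X\<close>: a character in \<open>Y\<close> corresponds to a prefix-closed chain of paths, and
  the chain continues beyond every path that ends in \<open>X\<close>.

  Two slices are disjoint or nested. Hence the span of their indicators is closed under pointwise
  products, the sets with indicator in the span form a ring of sets, and this ring contains a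
  basis of the topology, so it contains all compact open sets. This gives surjectivity.

  For injectivity, modulo \<open>I\<^sub>X\<close> an element \<open>pq\<^sup>*\<close> with \<open>r(p) \<in> X\<close> equals the sum of the
  \<open>pe(qe)\<^sup>*\<close>. So all lengths can be pushed up to a common bound unless \<open>r(p) \<notin> X\<close>, and the
  coefficients of such a reduced combination are read off at suitable germs.\<close>

section \<open>Algebras and ideals\<close>

text \<open>The semigroup is known only through its presentation, so equality of elements is itself
  a problem. Closure of the forms pq* under the operations yields existence of normal forms, but
  uniqueness needs a model, here relations on paths. It underlies the description of the
  idempotents, the dichotomy for slices and the reading off of coefficients.

  Pointwise products are not convolutions, so the algebra structure does not provide them; they come
  from the prefix order on paths being a tree. They matter because differences and unions of sets
  turn into products of indicators.

  Regularity at \<open>X\<close> acts through two halves. Finitely many outgoing arcs make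
  continuation beyond a path a closed condition, hence slices compact; at least one outgoing arc
  puts a character of \<open>Y\<close> on every path.

  The coefficient of pq* must not be disturbed by elements with longer paths. If q ends outside
  \<open>X\<close>, there is a character in \<open>Y\<close> whose chain stops at q; if q ends in
  \<open>X\<close>, a reduced combination has p at the maximal length already.\<close>

lemma algebra_iso_quotient:
  fixes A :: "('k, 'a::ab_group_add) kalgebra" and B :: "('k, 'b) kalgebra"
  assumes add: "aadd A = (+)"
    and I: "algebra_ideal I A"
    and closed: "\<And>x y. x \<in> acarrier A \<Longrightarrow> y \<in> acarrier A \<Longrightarrow> x + y \<in> acarrier A \<and> x - y \<in> acarrier A"
      "\<And>x y. x \<in> acarrier A \<Longrightarrow> y \<in> acarrier A \<Longrightarrow> amult A x y \<in> acarrier A"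
      "\<And>k x. x \<in> acarrier A \<Longrightarrow> ascale A k x \<in> acarrier A"
    and onto: "f ` acarrier A = acarrier B"
    and ker: "\<And>x y. x \<in> acarrier A \<Longrightarrow> y \<in> acarrier A \<Longrightarrow> f x = f y \<longleftrightarrow> x - y \<in> I"
    and hom: "\<And>x y. x \<in> acarrier A \<Longrightarrow> y \<in> acarrier A \<Longrightarrow> f (x + y) = aadd B (f x) (f y)"
      "\<And>x y. x \<in> acarrier A \<Longrightarrow> y \<in> acarrier A \<Longrightarrow> f (amult A x y) = amult B (f x) (f y)"
      "\<And>k x. x \<in> acarrier A \<Longrightarrow> f (ascale A k x) = ascale B k (f x)"
  shows "\<exists>\<phi>. \<phi> \<in> algebra_iso (quotient_algebra A I) B"
proof -
  define \<phi> where "\<phi> P = f (SOME x. x \<in> P)" for P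
  \<comment> \<open>Cosets are the fibres of \<open>f\<close> inside the carrier, so the choice of a
    representative in \<phi> is invisible.\<close>
  have coset: "algebra_coset A I x = {y \<in> acarrier A. f y = f x}" if x: "x \<in> acarrier A" for x
  proof (rule set_eqI)
    fix y
    have "y \<in> algebra_coset A I x \<longleftrightarrow> y - x \<in> I"
      unfolding algebra_coset_def add by (auto simp: image_iff) (metis add.commute diff_add_cancel)
    also have "\<dots> \<longleftrightarrow> y \<in> acarrier A \<and> f y = f x"
      using I closed(1)[of x "y - x"] ker[of y x] x by (auto simp: algebra_ideal_def)
    finally show "y \<in> algebra_coset A I x \<longleftrightarrow> y \<in> {y \<in> acarrier A. f y = f x}" by simp
  qed
  have \<phi>: "\<phi> (algebra_coset A I x) = f x" if "x \<in> acarrier A" for x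
    using someI[of "\<lambda>y. y \<in> algebra_coset A I x" x] that by (auto simp: \<phi>_def coset)
  \<comment> \<open>The quotient operations are unions over all representatives. All members of such
    a union are the same coset, so only nonemptiness of the index set has to be supplied; double
    unions are first rewritten over pairs.\<close>
  have Un: "(\<Union>x\<in>C. algebra_coset A I (g x)) = algebra_coset A I z"
    if "C \<noteq> {}" "z \<in> acarrier A" "\<And>x. x \<in> C \<Longrightarrow> g x \<in> acarrier A \<and> f (g x) = f z"
    for C :: "'c set" and g z
    using that by (auto simp: coset)
  have ne: "algebra_coset A I x \<noteq> {}" if "x \<in> acarrier A" for x
    using that by (auto simp: coset)
  have 1: "aadd (quotient_algebra A I) (algebra_coset A I x) (algebra_coset A I y)
      = algebra_coset A I (x + y)" if "x \<in> acarrier A" "y \<in> acarrier A" for x y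
  proof -
    have "aadd (quotient_algebra A I) (algebra_coset A I x) (algebra_coset A I y)
      = (\<Union>p \<in> algebra_coset A I x \<times> algebra_coset A I y. algebra_coset A I (fst p + snd p))"
      unfolding quotient_algebra_def kalgebra.simps add by (rule set_eqI) fastforce
    also have "\<dots> = algebra_coset A I (x + y)"
      by (rule Un) (use that ne closed in \<open>auto simp: coset hom\<close>)
    finally show ?thesis .
  qed
  have 2: "amult (quotient_algebra A I) (algebra_coset A I x) (algebra_coset A I y)
      = algebra_coset A I (amult A x y)" if "x \<in> acarrier A" "y \<in> acarrier A" for x y
  proof -
    have "amult (quotient_algebra A I) (algebra_coset A I x) (algebra_coset A I y)
      = (\<Union>p \<in> algebra_coset A I x \<times> algebra_coset A I y. algebra_coset A I (amult A (fst p) (snd p)))"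
      unfolding quotient_algebra_def kalgebra.simps by (rule set_eqI) fastforce
    also have "\<dots> = algebra_coset A I (amult A x y)"
      by (rule Un) (use that ne closed in \<open>auto simp: coset hom\<close>)
    finally show ?thesis .
  qed
  have 3: "ascale (quotient_algebra A I) k (algebra_coset A I x)
      = algebra_coset A I (ascale A k x)" if "x \<in> acarrier A" for k x
    unfolding quotient_algebra_def kalgebra.simps
    by (rule Un) (use that ne closed in \<open>auto simp: coset hom\<close>)
  have carr: "acarrier (quotient_algebra A I) = algebra_coset A I ` acarrier A"
    by (simp add: quotient_algebra_def)
  have "bij_betw \<phi> (acarrier (quotient_algebra A I)) (acarrier B)"
    unfolding bij_betw_def
  proof
    show "inj_on \<phi> (acarrier (quotient_algebra A I))"
      by (rule inj_onI) (clarsimp simp: carr \<phi> simp del: coset; simp add: coset)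
    show "\<phi> ` acarrier (quotient_algebra A I) = acarrier B"
      unfolding carr image_image onto[symmetric] by (rule image_cong) (auto simp: \<phi>)
  qed
  then have "\<phi> \<in> algebra_iso (quotient_algebra A I) B"
    unfolding algebra_iso_def by (auto simp: carr 1 2 3 \<phi> closed hom)
  then show ?thesis by blast
qed

text \<open>The first hypothesis puts the carrier into the family that is intersected. This keeps
  the intersection inside the carrier; over an empty family it would be the whole type.\<close>

lemma ideal_generated_ideal:
  assumes "algebra_ideal (acarrier A) A" "G \<subseteq> acarrier A"
  shows "algebra_ideal (ideal_generated A G) A" "G \<subseteq> ideal_generated A G"
proof -
  have "ideal_generated A G \<subseteq> acarrier A" unfolding ideal_generated_def using assms by blast
  then show "algebra_ideal (ideal_generated A G) A"
    unfolding algebra_ideal_def ideal_generated_def by simp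
  show "G \<subseteq> ideal_generated A G" unfolding ideal_generated_def by blast
qed

lemma ideal_generated_least: "algebra_ideal I A \<Longrightarrow> G \<subseteq> I \<Longrightarrow> ideal_generated A G \<subseteq> I"
  unfolding ideal_generated_def by blast

section \<open>Arithmetic in the semigroup algebra\<close>

lemma lookup_scale:
  "Poly_Mapping.lookup (Poly_Mapping.map ((*) (k :: 'k::comm_ring)) f) s = k * Poly_Mapping.lookup f s"
  by transfer (simp add: when_def)

lemma keys_scale: "Poly_Mapping.keys (Poly_Mapping.map ((*) (k :: 'k::comm_ring)) f) \<subseteq> Poly_Mapping.keys f"
  by (auto simp: in_keys_iff lookup_scale)

lemma sum_single_lookup: "f = (\<Sum>s \<in> Poly_Mapping.keys f. Poly_Mapping.single s (Poly_Mapping.lookup f s))"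
  by (rule poly_mapping_eqI)
    (simp add: lookup_sum lookup_single when_def in_keys_iff)

text \<open>The product is defined by sums over the supports, which change under addition and
  cancellation. Over fixed larger index sets it becomes visibly bilinear.\<close>

lemma semigroup_amult_superset:
  assumes "finite A" "finite B" "Poly_Mapping.keys f \<subseteq> A" "Poly_Mapping.keys g \<subseteq> B"
  shows "amult (semigroup_algebra S) f g =
    (\<Sum>s \<in> A. \<Sum>t \<in> B. Poly_Mapping.single (smult S s t) (Poly_Mapping.lookup f s * Poly_Mapping.lookup g t))"
proof -
  have "amult (semigroup_algebra S) f g =
    (\<Sum>s \<in> Poly_Mapping.keys f. \<Sum>t \<in> B. Poly_Mapping.single (smult S s t) (Poly_Mapping.lookup f s * Poly_Mapping.lookup g t))"
    unfolding semigroup_algebra_def kalgebra.simps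
    by (intro sum.cong HOL.refl sum.mono_neutral_left) (use assms in \<open>auto simp: in_keys_iff\<close>)
  also have "\<dots> = (\<Sum>s \<in> A. \<Sum>t \<in> B. Poly_Mapping.single (smult S s t) (Poly_Mapping.lookup f s * Poly_Mapping.lookup g t))"
    by (intro sum.mono_neutral_left) (use assms in \<open>auto simp: in_keys_iff\<close>)
  finally show ?thesis .
qed

lemma semigroup_amult_single:
  "amult (semigroup_algebra S) (Poly_Mapping.single s a) (Poly_Mapping.single t b)
    = Poly_Mapping.single (smult S s t) (a * b)"
  by (subst semigroup_amult_superset[of "{s}" "{t}"]) auto

lemma semigroup_amult_diff:
  "amult (semigroup_algebra S) f (g - h) = amult (semigroup_algebra S) f g - amult (semigroup_algebra S) f h"
  "amult (semigroup_algebra S) (g - h) f = amult (semigroup_algebra S) g f - amult (semigroup_algebra S) h f"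
proof -
  let ?A = "Poly_Mapping.keys f" and ?B = "Poly_Mapping.keys g \<union> Poly_Mapping.keys h"
  have k: "Poly_Mapping.keys (g - h) \<subseteq> ?B" by (rule keys_diff)
  show "amult (semigroup_algebra S) f (g - h) = amult (semigroup_algebra S) f g - amult (semigroup_algebra S) f h"
    using k by (simp add: semigroup_amult_superset[of ?A ?B] lookup_minus right_diff_distrib single_diff sum_subtractf)
  show "amult (semigroup_algebra S) (g - h) f = amult (semigroup_algebra S) g f - amult (semigroup_algebra S) h f"
    using k by (simp add: semigroup_amult_superset[of ?B ?A] lookup_minus left_diff_distrib single_diff sum_subtractf)
qed

lemma semigroup_amult_sum:
  "amult (semigroup_algebra S) f (\<Sum>i\<in>I. g i) = (\<Sum>i\<in>I. amult (semigroup_algebra S) f (g i))"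
  "amult (semigroup_algebra S) (\<Sum>i\<in>I. g i) f = (\<Sum>i\<in>I. amult (semigroup_algebra S) (g i) f)"
proof -
  have 0: "amult (semigroup_algebra S) f 0 = 0" "amult (semigroup_algebra S) 0 f = 0"
    by (simp_all add: semigroup_algebra_def)
  \<comment> \<open>Additivity is the rule for differences applied to (g + h) - h.\<close>
  have "amult (semigroup_algebra S) f (g + h) = amult (semigroup_algebra S) f g + amult (semigroup_algebra S) f h"
    "amult (semigroup_algebra S) (g + h) f = amult (semigroup_algebra S) g f + amult (semigroup_algebra S) h f" for g h
    using semigroup_amult_diff[where f = f and g = "g + h" and h = h and S = S] by (auto simp: algebra_simps)
  then show "amult (semigroup_algebra S) f (\<Sum>i\<in>I. g i) = (\<Sum>i\<in>I. amult (semigroup_algebra S) f (g i))"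
    "amult (semigroup_algebra S) (\<Sum>i\<in>I. g i) f = (\<Sum>i\<in>I. amult (semigroup_algebra S) (g i) f)"
    by (induction I rule: infinite_finite_induct) (simp_all add: 0)
qed

section \<open>The universal groupoid of an inverse semigroup\<close>

text \<open>Regularity and commuting idempotents force the involution to be the unique inverse;
  self-adjointness of idempotents is derived from them and not assumed.\<close>

locale inverse_semigroup =
  fixes S :: "('s, 'm) star_semigroup_scheme"
  assumes mult_closed: "s \<in> scarrier S \<Longrightarrow> t \<in> scarrier S \<Longrightarrow> smult S s t \<in> scarrier S"
    and star_closed: "s \<in> scarrier S \<Longrightarrow> sstar S s \<in> scarrier S"
    and assoc: "s \<in> scarrier S \<Longrightarrow> t \<in> scarrier S \<Longrightarrow> u \<in> scarrier S \<Longrightarrow>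
      smult S (smult S s t) u = smult S s (smult S t u)"
    and star_star: "s \<in> scarrier S \<Longrightarrow> sstar S (sstar S s) = s"
    and star_mult: "s \<in> scarrier S \<Longrightarrow> t \<in> scarrier S \<Longrightarrow>
      sstar S (smult S s t) = smult S (sstar S t) (sstar S s)"
    and regular: "s \<in> scarrier S \<Longrightarrow> smult S s (smult S (sstar S s) s) = s"
    and idem_commute: "e \<in> idempotents S \<Longrightarrow> f \<in> idempotents S \<Longrightarrow> smult S e f = smult S f e"
begin

abbreviation mul (infixl "\<odot>" 70) where "s \<odot> t \<equiv> smult S s t"
abbreviation star ("_\<^sup>\<star>" [1000] 999) where "s\<^sup>\<star> \<equiv> sstar S s"

lemmas closed = mult_closed star_closed

section \<open>Idempotents of an inverse semigroup\<close>

lemma idem_closed: "e \<in> idempotents S \<Longrightarrow> e \<in> scarrier S"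
  and idem_mult: "e \<in> idempotents S \<Longrightarrow> e \<odot> e = e"
  by (auto simp: idempotents_def)

lemma idem_idem:
  assumes "e \<in> idempotents S" "f \<in> idempotents S" shows "e \<odot> f \<in> idempotents S"
proof -
  have "(e \<odot> f) \<odot> (e \<odot> f) = e \<odot> (f \<odot> e) \<odot> f"
    using assms by (simp add: assoc closed idem_closed)
  also have "\<dots> = (e \<odot> e) \<odot> (f \<odot> f)"
    using assms by (simp only: idem_commute[OF assms(2,1)]) (simp add: assoc closed idem_closed)
  finally show ?thesis using assms by (simp add: idempotents_def closed)
qed

lemma star_regular: "s \<in> scarrier S \<Longrightarrow> s\<^sup>\<star> \<odot> (s \<odot> s\<^sup>\<star>) = s\<^sup>\<star>"
  using regular[of "s\<^sup>\<star>"] by (simp add: star_star closed)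

lemma dom_idem: "s \<in> scarrier S \<Longrightarrow> s\<^sup>\<star> \<odot> s \<in> idempotents S"
  by (simp add: idempotents_def closed assoc regular)

lemma ran_idem: "s \<in> scarrier S \<Longrightarrow> s \<odot> s\<^sup>\<star> \<in> idempotents S"
  using dom_idem[of "s\<^sup>\<star>"] by (simp add: closed star_star)

text \<open>The star of \<open>e\<close> is again idempotent and so commutes with \<open>e\<close>;
  regularity then collapses each of the two to their product.\<close>

lemma idem_star:
  assumes e: "e \<in> idempotents S" shows "e\<^sup>\<star> = e"
proof -
  have c: "e \<in> scarrier S" "e\<^sup>\<star> \<in> scarrier S" and "e\<^sup>\<star> \<odot> e\<^sup>\<star> = e\<^sup>\<star>"
    using e by (auto simp: idem_closed closed simp flip: star_mult) (simp add: idem_mult)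
  then have i: "e\<^sup>\<star> \<in> idempotents S" by (simp add: idempotents_def)
  have "e = e \<odot> (e \<odot> e\<^sup>\<star>)" using regular[OF c(1)] idem_commute[OF e i] by simp
  also have "\<dots> = e \<odot> e\<^sup>\<star>" using c idem_mult[OF e] by (simp flip: assoc)
  finally have 1: "e = e \<odot> e\<^sup>\<star>" .
  have "e\<^sup>\<star> = e\<^sup>\<star> \<odot> (e\<^sup>\<star> \<odot> e)" using star_regular[OF c(1)] idem_commute[OF e i] by simp
  also have "\<dots> = e\<^sup>\<star> \<odot> e" using c idem_mult[OF i] by (simp flip: assoc)
  finally show ?thesis using 1 idem_commute[OF e i] by simp
qed

text \<open>The conjugate is the domain idempotent of \<open>e \<odot> s\<close>.\<close>

lemma conj_idem:
  assumes s: "s \<in> scarrier S" and e: "e \<in> idempotents S"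
  shows "s\<^sup>\<star> \<odot> e \<odot> s \<in> idempotents S"
proof -
  have c: "e \<in> scarrier S" using e by (rule idem_closed)
  have "s\<^sup>\<star> \<odot> e \<odot> s = (e \<odot> s)\<^sup>\<star> \<odot> (e \<odot> s)"
    using s c by (simp add: star_mult idem_star[OF e] assoc closed)
      (simp add: idem_mult[OF e] closed flip: assoc)
  then show ?thesis using dom_idem[of "e \<odot> s"] s c by (simp add: closed)
qed

section \<open>Characters, germs and their products\<close>

lemma char_01: "\<theta> \<in> characters S \<Longrightarrow> e \<in> idempotents S \<Longrightarrow> \<theta> e = 0 \<or> \<theta> e = 1"
  unfolding characters_def by (blast dest: PiE_mem)

lemma char_mult:
  "\<theta> \<in> characters S \<Longrightarrow> e \<in> idempotents S \<Longrightarrow> f \<in> idempotents S \<Longrightarrow> \<theta> (e \<odot> f) = \<theta> e * \<theta> f"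
  unfolding characters_def by blast

lemma char_ext:
  "\<theta> \<in> characters S \<Longrightarrow> \<theta>' \<in> characters S \<Longrightarrow> (\<And>e. e \<in> idempotents S \<Longrightarrow> \<theta> e = \<theta>' e) \<Longrightarrow> \<theta> = \<theta>'"
  by (rule PiE_ext[of _ "idempotents S" "\<lambda>_. {0,1}"]) (simp_all add: characters_def)

lemma dom_mult_idem:
  assumes s: "s \<in> scarrier S" and e: "e \<in> idempotents S"
  shows "(s \<odot> e)\<^sup>\<star> \<odot> (s \<odot> e) = s\<^sup>\<star> \<odot> s \<odot> e"
proof -
  have c: "e \<in> scarrier S" using e by (rule idem_closed)
  have "(s \<odot> e)\<^sup>\<star> \<odot> (s \<odot> e) = e \<odot> (s\<^sup>\<star> \<odot> s) \<odot> e"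
    using s c by (simp add: star_mult idem_star[OF e] assoc closed)
  also have "\<dots> = (s\<^sup>\<star> \<odot> s) \<odot> (e \<odot> e)"
    using s c by (simp only: idem_commute[OF e dom_idem[OF s]]) (simp add: assoc closed)
  finally show ?thesis by (simp add: idem_mult[OF e])
qed

text \<open>A common lower bound \<open>u\<close> is the restriction of both \<open>s\<close> and
  \<open>t\<close> to the domain idempotent of \<open>u\<close>, so it may be traded for an
  idempotent that equalizes \<open>s\<close> and \<open>t\<close>. In this form transitivity amounts
  to multiplying two idempotents.\<close>

lemma germ_rel_iff:
  "((s, \<theta>), (t, \<theta>')) \<in> germ_rel S \<longleftrightarrow>
     s \<in> scarrier S \<and> t \<in> scarrier S \<and> \<theta>' = \<theta> \<and> \<theta> \<in> char_dom S (s\<^sup>\<star> \<odot> s) \<and> \<theta> \<in> char_dom S (t\<^sup>\<star> \<odot> t) \<and>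
     (\<exists>e \<in> idempotents S. \<theta> e = 1 \<and> s \<odot> e = t \<odot> e)" (is "?L \<longleftrightarrow> ?R")
proof
  assume L: ?L
  then obtain u where u: "u \<in> scarrier S" "natural_le S u s" "natural_le S u t"
    and \<theta>: "\<theta> \<in> char_dom S (u\<^sup>\<star> \<odot> u)"
    and st: "s \<in> scarrier S" "t \<in> scarrier S" "\<theta>' = \<theta>" "\<theta> \<in> char_dom S (s\<^sup>\<star> \<odot> s)" "\<theta> \<in> char_dom S (t\<^sup>\<star> \<odot> t)"
    unfolding germ_rel_def by blast
  have *: "r \<odot> (u\<^sup>\<star> \<odot> u) = u" if r: "r \<in> scarrier S" "natural_le S u r" for r
  proof -
    obtain f where f: "f \<in> idempotents S" "u = r \<odot> f" using r by (auto simp: natural_le_def)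
    have "r \<odot> (u\<^sup>\<star> \<odot> u) = r \<odot> (r\<^sup>\<star> \<odot> r \<odot> f)"
      unfolding f(2) dom_mult_idem[OF r(1) f(1)] ..
    also have "\<dots> = (r \<odot> (r\<^sup>\<star> \<odot> r)) \<odot> f" using r f by (simp add: assoc closed idem_closed)
    finally show ?thesis using f r by (simp add: regular)
  qed
  have "u\<^sup>\<star> \<odot> u \<in> idempotents S" "\<theta> (u\<^sup>\<star> \<odot> u) = 1"
    using u \<theta> by (auto simp: dom_idem char_dom_def)
  moreover have "s \<odot> (u\<^sup>\<star> \<odot> u) = t \<odot> (u\<^sup>\<star> \<odot> u)"
    using st u *[of s] *[of t] by simp
  ultimately show ?R using st by blast
next
  assume R: ?R
  then obtain e where e: "e \<in> idempotents S" "\<theta> e = 1" "s \<odot> e = t \<odot> e" by blast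
  have "\<theta> \<in> char_dom S ((s \<odot> e)\<^sup>\<star> \<odot> (s \<odot> e))"
    using R e by (simp add: dom_mult_idem char_dom_def char_mult dom_idem)
  moreover have "natural_le S (s \<odot> e) s" "natural_le S (s \<odot> e) t"
    using e unfolding natural_le_def by blast+
  moreover have "s \<odot> e \<in> scarrier S" using R e by (auto simp: closed idem_closed)
  ultimately show ?L using R unfolding germ_rel_def by blast
qed

lemma germ_rel_sym: "(x, y) \<in> germ_rel S \<Longrightarrow> (y, x) \<in> germ_rel S"
  by (cases x; cases y) (auto simp: germ_rel_iff)

lemma germ_rel_trans:
  assumes "(x, y) \<in> germ_rel S" "(y, z) \<in> germ_rel S" shows "(x, z) \<in> germ_rel S"
proof -
  obtain s \<theta> t r where [simp]: "x = (s, \<theta>)" "y = (t, \<theta>)" "z = (r, \<theta>)"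
    using assms by (cases x; cases y; cases z) (auto simp: germ_rel_iff)
  obtain e where e: "e \<in> idempotents S" "\<theta> e = 1" "s \<odot> e = t \<odot> e"
    using assms(1) by (auto simp: germ_rel_iff)
  obtain f where f: "f \<in> idempotents S" "\<theta> f = 1" "t \<odot> f = r \<odot> f"
    using assms(2) by (auto simp: germ_rel_iff)
  have st: "s \<in> scarrier S" "t \<in> scarrier S" "r \<in> scarrier S" "\<theta> \<in> characters S"
    using assms by (auto simp: germ_rel_iff char_dom_def)
  have ef: "e \<odot> f = f \<odot> e" using e f by (auto simp: idem_commute)
  have c: "e \<in> scarrier S" "f \<in> scarrier S" using e f by (auto simp: idem_closed)
  have "s \<odot> (e \<odot> f) = (t \<odot> e) \<odot> f" using st c by (simp add: e(3)[symmetric] assoc)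
  also have "\<dots> = (t \<odot> f) \<odot> e" using st c by (simp add: assoc ef)
  also have "\<dots> = r \<odot> (e \<odot> f)" using st c by (simp add: f(3) assoc ef)
  finally have "s \<odot> (e \<odot> f) = r \<odot> (e \<odot> f)" .
  moreover have "\<theta> (e \<odot> f) = 1" using st e f by (simp add: char_mult)
  ultimately show ?thesis using assms e f idem_idem[OF e(1) f(1)] by (auto simp: germ_rel_iff)
qed

text \<open>Off these pairs \<open>germ_of\<close> is the empty set, which is why the lemmas on
  germs carry membership here as a hypothesis.\<close>

definition germ_pairs :: "('s \<times> ('s \<Rightarrow> nat)) set" where
  "germ_pairs = {(s, \<theta>). s \<in> scarrier S \<and> \<theta> \<in> char_dom S (s\<^sup>\<star> \<odot> s)}"

lemma germ_pairs_idem: "(s, \<theta>) \<in> germ_pairs \<Longrightarrow> \<theta> \<in> characters S \<and> \<theta> (s\<^sup>\<star> \<odot> s) = 1 \<and> s \<in> scarrier S"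
  by (auto simp: germ_pairs_def char_dom_def)

lemma germ_refl: "(s, \<theta>) \<in> germ_pairs \<Longrightarrow> (s, \<theta>) \<in> germ_of S s \<theta>"
  unfolding germ_of_def germ_pairs_def
  by (auto simp: germ_rel_iff char_dom_def intro!: bexI[of _ "s\<^sup>\<star> \<odot> s"] dom_idem)

lemma germ_of_eq_iff:
  assumes "(s, \<theta>) \<in> germ_pairs" "(t, \<theta>') \<in> germ_pairs"
  shows "germ_of S s \<theta> = germ_of S t \<theta>' \<longleftrightarrow>
    \<theta>' = \<theta> \<and> (\<exists>e \<in> idempotents S. \<theta> e = 1 \<and> s \<odot> e = t \<odot> e)"
proof -
  have "germ_of S s \<theta> = germ_of S t \<theta>' \<longleftrightarrow> ((s, \<theta>), (t, \<theta>')) \<in> germ_rel S"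
    using germ_refl[OF assms(2)] unfolding germ_of_def
    by (auto intro: germ_rel_trans germ_rel_sym)
  then show ?thesis using assms by (auto simp: germ_rel_iff germ_pairs_def)
qed

lemma mem_germ_of_iff:
  assumes "(s, \<theta>) \<in> germ_pairs"
  shows "(t, \<theta>') \<in> germ_of S s \<theta> \<longleftrightarrow>
    (t, \<theta>') \<in> germ_pairs \<and> \<theta>' = \<theta> \<and> (\<exists>e \<in> idempotents S. \<theta> e = 1 \<and> s \<odot> e = t \<odot> e)"
  using assms by (auto simp: germ_of_def germ_rel_iff germ_pairs_def)

lemma germ_dom_germ_of: assumes "(s, \<theta>) \<in> germ_pairs" shows "germ_dom (germ_of S s \<theta>) = \<theta>"
  unfolding germ_dom_def
  by (rule the_equality) (use assms germ_refl in \<open>auto simp: mem_germ_of_iff\<close>)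

lemma char_act_apply:
  "e \<in> idempotents S \<Longrightarrow> char_act S s \<theta> e = \<theta> (s\<^sup>\<star> \<odot> e \<odot> s)"
  by (simp add: char_act_def)

text \<open>This makes the range of a germ independent of its representative: two representatives
  agree after restriction to some such \<open>e\<close>.\<close>

lemma char_act_mult_idem:
  assumes p: "(s, \<theta>) \<in> germ_pairs" and e: "e \<in> idempotents S" "\<theta> e = 1"
  shows "char_act S (s \<odot> e) \<theta> = char_act S s \<theta>"
  unfolding char_act_def
proof (rule restrict_ext)
  fix f assume f: "f \<in> idempotents S"
  have c: "s \<in> scarrier S" "e \<in> scarrier S" "f \<in> scarrier S" "\<theta> \<in> characters S"
    using p e f by (auto simp: idem_closed dest: germ_pairs_idem)
  have "(s \<odot> e)\<^sup>\<star> \<odot> f \<odot> (s \<odot> e) = e \<odot> ((s\<^sup>\<star> \<odot> f \<odot> s) \<odot> e)"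
    using c by (simp add: star_mult idem_star[OF e(1)] assoc closed)
  moreover have "\<theta> (e \<odot> ((s\<^sup>\<star> \<odot> f \<odot> s) \<odot> e)) = \<theta> (s\<^sup>\<star> \<odot> f \<odot> s)"
    using c e f by (simp add: char_mult conj_idem idem_idem)
  ultimately show "\<theta> ((s \<odot> e)\<^sup>\<star> \<odot> f \<odot> (s \<odot> e)) = \<theta> (s\<^sup>\<star> \<odot> f \<odot> s)" by simp
qed

lemma germ_ran_germ_of:
  assumes "(s, \<theta>) \<in> germ_pairs" shows "germ_ran S (germ_of S s \<theta>) = char_act S s \<theta>"
  unfolding germ_ran_def
proof (rule the_equality)
  show "\<exists>t \<theta>'. (t, \<theta>') \<in> germ_of S s \<theta> \<and> char_act S s \<theta> = char_act S t \<theta>'"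
    using germ_refl[OF assms] by blast
  show "\<eta> = char_act S s \<theta>" if H: "\<exists>t \<theta>'. (t, \<theta>') \<in> germ_of S s \<theta> \<and> \<eta> = char_act S t \<theta>'" for \<eta>
  proof -
    obtain t e where t: "(t, \<theta>) \<in> germ_pairs" "\<eta> = char_act S t \<theta>"
      and e: "e \<in> idempotents S" "\<theta> e = 1" "s \<odot> e = t \<odot> e"
      using H unfolding mem_germ_of_iff[OF assms] by blast
    then show ?thesis
      using char_act_mult_idem[OF t(1) e(1,2)] char_act_mult_idem[OF assms e(1,2)] by simp
  qed
qed

text \<open>Conjugation is multiplicative on idempotents because the range idempotent of
  \<open>s\<close>, which appears in the middle, commutes past \<open>e\<close> and is absorbed by
  the star of \<open>s\<close>. The value at that range idempotent is 1, so the result is not the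
  zero map.\<close>

lemma char_act_in_characters:
  assumes p: "(s, \<theta>) \<in> germ_pairs"
  shows "char_act S s \<theta> \<in> char_dom S (s \<odot> s\<^sup>\<star>)"
proof -
  have s: "s \<in> scarrier S" and \<theta>: "\<theta> \<in> characters S" "\<theta> (s\<^sup>\<star> \<odot> s) = 1"
    using germ_pairs_idem[OF p] by auto
  have m: "char_act S s \<theta> (e \<odot> f) = char_act S s \<theta> e * char_act S s \<theta> f"
    if e: "e \<in> idempotents S" and f: "f \<in> idempotents S" for e f
  proof -
    have c: "e \<in> scarrier S" "f \<in> scarrier S" using e f by (auto simp: idem_closed)
    have "(s\<^sup>\<star> \<odot> e \<odot> s) \<odot> (s\<^sup>\<star> \<odot> f \<odot> s) = s\<^sup>\<star> \<odot> (e \<odot> (s \<odot> s\<^sup>\<star>)) \<odot> f \<odot> s"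
      using s c by (simp add: assoc closed)
    also have "\<dots> = (s\<^sup>\<star> \<odot> (s \<odot> s\<^sup>\<star>)) \<odot> (e \<odot> f) \<odot> s"
      using s c by (simp only: idem_commute[OF e ran_idem[OF s]]) (simp add: assoc closed)
    finally have "(s\<^sup>\<star> \<odot> e \<odot> s) \<odot> (s\<^sup>\<star> \<odot> f \<odot> s) = s\<^sup>\<star> \<odot> (e \<odot> f) \<odot> s"
      by (simp add: star_regular s)
    then show ?thesis
      using e f s \<theta> by (simp add: char_act_apply idem_idem flip: char_mult[OF _ conj_idem conj_idem])
  qed
  have 1: "char_act S s \<theta> (s \<odot> s\<^sup>\<star>) = 1"
  proof -
    have "s\<^sup>\<star> \<odot> (s \<odot> s\<^sup>\<star>) \<odot> s = s\<^sup>\<star> \<odot> s" using s by (simp add: star_regular)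
    then show ?thesis using s \<theta> by (simp add: char_act_apply ran_idem)
  qed
  have "char_act S s \<theta> \<in> idempotents S \<rightarrow>\<^sub>E {0, 1}"
    using char_01[OF \<theta>(1) conj_idem[OF s]] by (auto simp: char_act_def)
  then show ?thesis using m 1 ran_idem[OF s] by (force simp: char_dom_def characters_def)
qed

text \<open>Conjugating there and back multiplies \<open>e\<close> on both sides by the domain
  idempotent of \<open>s\<close>, where \<theta> is 1. The injectivity of the range map on slices
  rests on this.\<close>

lemma char_act_star:
  assumes p: "(s, \<theta>) \<in> germ_pairs" shows "char_act S (s\<^sup>\<star>) (char_act S s \<theta>) = \<theta>"
proof -
  have s: "s \<in> scarrier S" and \<theta>: "\<theta> \<in> characters S" "\<theta> (s\<^sup>\<star> \<odot> s) = 1"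
    using germ_pairs_idem[OF p] by auto
  have "(s\<^sup>\<star>, char_act S s \<theta>) \<in> germ_pairs"
    using char_act_in_characters[OF p] s by (simp add: germ_pairs_def closed star_star)
  then have "char_act S (s\<^sup>\<star>) (char_act S s \<theta>) \<in> characters S"
    using char_act_in_characters by (auto simp: char_dom_def)
  then show ?thesis
  proof (rule char_ext[OF _ \<theta>(1)])
    fix e assume e: "e \<in> idempotents S"
    have c: "e \<in> scarrier S" using e by (rule idem_closed)
    have "s \<odot> e \<odot> s\<^sup>\<star> \<in> idempotents S" using conj_idem[of "s\<^sup>\<star>" e] s e by (simp add: star_star closed)
    then have "char_act S (s\<^sup>\<star>) (char_act S s \<theta>) e = \<theta> (s\<^sup>\<star> \<odot> (s \<odot> e \<odot> s\<^sup>\<star>) \<odot> s)"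
      using s e by (simp add: char_act_apply star_star)
    also have "s\<^sup>\<star> \<odot> (s \<odot> e \<odot> s\<^sup>\<star>) \<odot> s = (s\<^sup>\<star> \<odot> s) \<odot> (e \<odot> (s\<^sup>\<star> \<odot> s))"
      using s c by (simp add: assoc closed)
    also have "\<theta> \<dots> = \<theta> e" using \<theta> e s by (simp add: char_mult dom_idem idem_idem)
    finally show "char_act S (s\<^sup>\<star>) (char_act S s \<theta>) e = \<theta> e" .
  qed
qed

text \<open>\<open>germ_mult\<close> is a union over all representatives of both factors, so the
  content is that they all produce one and the same germ.\<close>

lemma germ_mult_pairs:
  assumes t: "(t, \<theta>) \<in> germ_pairs" and s: "(s, char_act S t \<theta>) \<in> germ_pairs"
  shows "(s \<odot> t, \<theta>) \<in> germ_pairs"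
    "germ_mult S (germ_of S s (char_act S t \<theta>)) (germ_of S t \<theta>) = germ_of S (s \<odot> t) \<theta>"
proof -
  have P: "(s' \<odot> t', \<theta>) \<in> germ_pairs" if t: "(t', \<theta>) \<in> germ_pairs" and s: "(s', char_act S t' \<theta>) \<in> germ_pairs"
    for s' t'
  proof -
    have c: "s' \<in> scarrier S" "t' \<in> scarrier S" "\<theta> \<in> characters S" "char_act S t' \<theta> (s'\<^sup>\<star> \<odot> s') = 1"
      using germ_pairs_idem[OF t] germ_pairs_idem[OF s] by auto
    have "(s' \<odot> t')\<^sup>\<star> \<odot> (s' \<odot> t') = t'\<^sup>\<star> \<odot> (s'\<^sup>\<star> \<odot> s') \<odot> t'"
      using c by (simp add: star_mult assoc closed)
    then show ?thesis using c by (simp add: germ_pairs_def char_dom_def char_act_apply dom_idem closed)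
  qed
  show "(s \<odot> t, \<theta>) \<in> germ_pairs" by (rule P[OF t s])
  have eq: "germ_of S (s' \<odot> t') \<theta> = germ_of S (s \<odot> t) \<theta>"
    if t': "(t', \<theta>) \<in> germ_of S t \<theta>" and s': "(s', char_act S t \<theta>) \<in> germ_of S s (char_act S t \<theta>)"
    for s' t'
  proof -
    obtain e where e: "e \<in> idempotents S" "\<theta> e = 1" "t \<odot> e = t' \<odot> e" and t'p: "(t', \<theta>) \<in> germ_pairs"
      using t' mem_germ_of_iff[OF t] by auto
    obtain f where f: "f \<in> idempotents S" "char_act S t \<theta> f = 1" "s \<odot> f = s' \<odot> f"
      and s'p: "(s', char_act S t \<theta>) \<in> germ_pairs"
      using s' mem_germ_of_iff[OF s] by auto
    have act: "char_act S t' \<theta> = char_act S t \<theta>"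
      using char_act_mult_idem[OF t e(1,2)] char_act_mult_idem[OF t'p e(1,2)] e(3) by simp
    have c: "s \<in> scarrier S" "t \<in> scarrier S" "s' \<in> scarrier S" "t' \<in> scarrier S" "\<theta> \<in> characters S"
      "e \<in> scarrier S" "f \<in> scarrier S"
      using germ_pairs_idem t s t'p s'p e f idem_closed by blast+
    \<comment> \<open>The idempotent \<open>f\<close> pulled back through \<open>t\<close>, so that
      \<open>t \<odot> g = f \<odot> t\<close>. The witness that equalizes the two products is then
      \<open>e \<odot> g\<close>.\<close>
    define g where "g = t\<^sup>\<star> \<odot> f \<odot> t"
    have g: "g \<in> idempotents S" "\<theta> g = 1" "g \<in> scarrier S"
      using c f by (auto simp: g_def conj_idem char_act_apply idem_closed)
    have tg: "t \<odot> g = f \<odot> t"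
    proof -
      have "t \<odot> g = (t \<odot> t\<^sup>\<star>) \<odot> f \<odot> t" using c by (simp add: g_def assoc closed)
      also have "\<dots> = f \<odot> (t \<odot> (t\<^sup>\<star> \<odot> t))"
        using c by (simp only: idem_commute[OF ran_idem[OF c(2)] f(1)]) (simp add: assoc closed)
      finally show ?thesis using c by (simp add: regular)
    qed
    have "(s \<odot> t) \<odot> (g \<odot> e) = (s \<odot> f) \<odot> (t \<odot> e)"
    proof -
      have "(s \<odot> t) \<odot> (g \<odot> e) = s \<odot> (t \<odot> g) \<odot> e" using c g by (simp add: assoc closed)
      then show ?thesis using c g by (simp add: tg assoc closed)
    qed
    also have "\<dots> = s' \<odot> (f \<odot> t) \<odot> e" using c by (simp add: f(3) assoc closed)
    also have "\<dots> = s' \<odot> (t \<odot> (g \<odot> e))" using c g by (simp flip: tg) (simp add: assoc closed)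
    also have "g \<odot> e = e \<odot> g" using g e by (simp add: idem_commute)
    also have "s' \<odot> (t \<odot> (e \<odot> g)) = s' \<odot> ((t \<odot> e) \<odot> g)" using c g by (simp add: assoc closed)
    also have "\<dots> = (s' \<odot> t') \<odot> (e \<odot> g)" using c g by (simp add: e(3) assoc closed)
    finally have "(s \<odot> t) \<odot> (e \<odot> g) = (s' \<odot> t') \<odot> (e \<odot> g)"
      using idem_commute[OF e(1) g(1)] by simp
    moreover have "e \<odot> g \<in> idempotents S" "\<theta> (e \<odot> g) = 1"
      using e g c by (auto simp: idem_idem char_mult)
    ultimately show ?thesis
      using germ_of_eq_iff[OF P[OF t'p, of s'] P[OF t s]] s'p act by metis
  qed
  have "germ_of S (fst p \<odot> fst q) (snd q) = germ_of S (s \<odot> t) \<theta>"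
    if "p \<in> germ_of S s (char_act S t \<theta>)" "q \<in> germ_of S t \<theta>" for p q
  proof -
    have "snd p = char_act S t \<theta>" "snd q = \<theta>"
      using that mem_germ_of_iff[OF s, of "fst p" "snd p"] mem_germ_of_iff[OF t, of "fst q" "snd q"]
      unfolding prod.collapse by blast+
    then show ?thesis using eq[of "fst q" "fst p"] that prod.collapse by metis
  qed
  then have "germ_mult S (germ_of S s (char_act S t \<theta>)) (germ_of S t \<theta>) =
    (\<Union>p \<in> germ_of S s (char_act S t \<theta>). \<Union>q \<in> germ_of S t \<theta>. germ_of S (s \<odot> t) \<theta>)"
    unfolding germ_mult_def split_def by (simp cong: SUP_cong)
  then show "germ_mult S (germ_of S s (char_act S t \<theta>)) (germ_of S t \<theta>) = germ_of S (s \<odot> t) \<theta>"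
    using germ_refl[OF s] germ_refl[OF t] by auto
qed

text \<open>The domain idempotent of \<open>s \<odot> t\<close> lies below that of \<open>t\<close>,
  so \<theta> is 1 on the latter as well. Hence every germ of a product factors, and a product of
  slices is a whole slice.\<close>

lemma germ_mult_pairs_conv:
  assumes st: "(s \<odot> t, \<theta>) \<in> germ_pairs" "s \<in> scarrier S" "t \<in> scarrier S"
  shows "(t, \<theta>) \<in> germ_pairs" "(s, char_act S t \<theta>) \<in> germ_pairs"
proof -
  have \<theta>: "\<theta> \<in> characters S" "\<theta> ((s \<odot> t)\<^sup>\<star> \<odot> (s \<odot> t)) = 1"
    using germ_pairs_idem[OF st(1)] by auto
  have eq: "(s \<odot> t)\<^sup>\<star> \<odot> (s \<odot> t) = t\<^sup>\<star> \<odot> (s\<^sup>\<star> \<odot> s) \<odot> t"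
    using st by (simp add: star_mult assoc closed)
  have "(t\<^sup>\<star> \<odot> (s\<^sup>\<star> \<odot> s) \<odot> t) \<odot> (t\<^sup>\<star> \<odot> t) = t\<^sup>\<star> \<odot> (s\<^sup>\<star> \<odot> s) \<odot> t"
    using st by (simp add: assoc closed regular)
  then have "\<theta> (t\<^sup>\<star> \<odot> (s\<^sup>\<star> \<odot> s) \<odot> t) * \<theta> (t\<^sup>\<star> \<odot> t) = \<theta> (t\<^sup>\<star> \<odot> (s\<^sup>\<star> \<odot> s) \<odot> t)"
    using st \<theta>(1) by (metis char_mult conj_idem dom_idem)
  then have "\<theta> (t\<^sup>\<star> \<odot> t) = 1" using \<theta>(2) eq by simp
  then show t: "(t, \<theta>) \<in> germ_pairs" using st \<theta> by (simp add: germ_pairs_def char_dom_def)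
  show "(s, char_act S t \<theta>) \<in> germ_pairs"
    using char_act_in_characters[OF t] st \<theta> eq
    by (simp add: germ_pairs_def char_dom_def char_act_apply dom_idem)
qed

lemma semigroup_algebra_closed:
  fixes f g :: "'s \<Rightarrow>\<^sub>0 'k::{comm_ring, comm_monoid_mult}"
  assumes "Poly_Mapping.keys f \<subseteq> scarrier S" "Poly_Mapping.keys g \<subseteq> scarrier S"
  shows "Poly_Mapping.keys (amult (semigroup_algebra S) f g) \<subseteq> scarrier S"
proof -
  have "Poly_Mapping.keys (amult (semigroup_algebra S) f g) \<subseteq>
    (\<Union>s \<in> Poly_Mapping.keys f. \<Union>t \<in> Poly_Mapping.keys g. {s \<odot> t})"
    unfolding semigroup_algebra_def kalgebra.simps
    by (intro order.trans[OF keys_sum] UN_mono order.refl) (auto split: if_splits)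
  then show ?thesis using assms by (auto simp: closed subset_iff)
qed

lemma semigroup_algebra_carrier_ideal:
  "algebra_ideal (acarrier (semigroup_algebra S)) (semigroup_algebra S :: ('k::{comm_ring, comm_monoid_mult}, _) kalgebra)"
proof -
  let ?A = "semigroup_algebra S :: ('k, _) kalgebra"
  have A: "acarrier ?A = {f. Poly_Mapping.keys f \<subseteq> scarrier S}" "azero ?A = 0" "aadd ?A = (+)"
    "ascale ?A = (\<lambda>k. Poly_Mapping.map ((*) k))"
    by (simp_all add: semigroup_algebra_def)
  show ?thesis
    unfolding algebra_ideal_def A
  proof (intro conjI ballI allI)
    fix x y :: "'s \<Rightarrow>\<^sub>0 'k" and k
    assume x: "x \<in> {f. Poly_Mapping.keys f \<subseteq> scarrier S}"
    show "Poly_Mapping.map ((*) k) x \<in> {f. Poly_Mapping.keys f \<subseteq> scarrier S}"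
      using x keys_scale[of k x] by simp
    assume y: "y \<in> {f. Poly_Mapping.keys f \<subseteq> scarrier S}"
    show "x + y \<in> {f. Poly_Mapping.keys f \<subseteq> scarrier S}" using x y keys_add[of x y] by auto
    show "amult ?A y x \<in> {f. Poly_Mapping.keys f \<subseteq> scarrier S}" "amult ?A x y \<in> {f. Poly_Mapping.keys f \<subseteq> scarrier S}"
      using x y by (simp_all add: semigroup_algebra_closed)
  qed simp_all
qed

section \<open>Topology of characters and germs\<close>

lemma openin_char_value:
  assumes e: "e \<in> idempotents S"
  shows "openin (character_topology S) {\<theta> \<in> characters S. \<theta> e = n}"
proof -
  let ?P = "product_topology (\<lambda>_. discrete_topology {0, 1::nat}) (idempotents S)"
  \<comment> \<open>The intersection with \<open>{0, 1}\<close> admits arbitrary \<open>n\<close>: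
    for other values the set is empty.\<close>
  have "openin ?P {\<theta> \<in> topspace ?P. \<theta> e \<in> {n} \<inter> {0, 1}}"
    by (rule openin_continuous_map_preimage[OF continuous_map_product_projection[OF e]]) simp
  moreover have "{\<theta> \<in> characters S. \<theta> e = n} = {\<theta> \<in> topspace ?P. \<theta> e \<in> {n} \<inter> {0, 1}} \<inter> characters S"
    using char_01[OF _ e] by (auto simp: characters_def)
  ultimately show ?thesis unfolding character_topology_def openin_subtopology by blast
qed

lemma openin_char_dom: "e \<in> idempotents S \<Longrightarrow> openin (character_topology S) (char_dom S e)"
  using openin_char_value unfolding char_dom_def .

lemma openin_germ_image:
  "s \<in> scarrier S \<Longrightarrow> openin (character_topology S) V \<Longrightarrow> V \<subseteq> char_dom S (s\<^sup>\<star> \<odot> s) \<Longrightarrow>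
    openin (germ_topology S) (germ_of S s ` V)"
  unfolding germ_topology_def by (rule topology_generated_by_Basis) blast

text \<open>The germs of \<open>s\<close> and \<open>t\<close> at \<theta> agree iff \<theta> is 1
  on some idempotent that equalizes \<open>s\<close> and \<open>t\<close>. So the preimage of a
  basic set is a union of sets \<open>char_dom S e\<close>, cut down to open sets. Compactness of
  slices is transported along this map.\<close>

lemma continuous_germ_of:
  assumes s: "s \<in> scarrier S"
  shows "continuous_map (subtopology (character_topology S) (char_dom S (s\<^sup>\<star> \<odot> s))) (germ_topology S) (germ_of S s)"
proof -
  let ?D = "char_dom S (s\<^sup>\<star> \<odot> s)"
  have D: "openin (character_topology S) ?D" using s by (simp add: openin_char_dom dom_idem)
  have top: "topspace (subtopology (character_topology S) ?D) = ?D"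
    using openin_subset[OF D] by auto
  have "openin (subtopology (character_topology S) ?D) (germ_of S s -` (germ_of S t ` U) \<inter> ?D)"
    if t: "t \<in> scarrier S" and U: "openin (character_topology S) U" "U \<subseteq> char_dom S (t\<^sup>\<star> \<odot> t)" for t U
  proof -
    have "germ_of S s -` (germ_of S t ` U) \<inter> ?D
      = (\<Union>e \<in> {e \<in> idempotents S. s \<odot> e = t \<odot> e}. char_dom S e \<inter> U \<inter> ?D)" (is "?L = ?R")
    proof (rule set_eqI)
      fix \<theta>
      have U': "(t, \<theta>') \<in> germ_pairs" if "\<theta>' \<in> U" for \<theta>'
        using that U t by (auto simp: germ_pairs_def)
      show "\<theta> \<in> ?L \<longleftrightarrow> \<theta> \<in> ?R"
      proof (cases "\<theta> \<in> ?D")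
        case True
        then have p: "(s, \<theta>) \<in> germ_pairs" "\<theta> \<in> characters S" using s by (auto simp: germ_pairs_def char_dom_def)
        have "\<theta> \<in> ?L \<longleftrightarrow> (\<exists>\<theta>' \<in> U. germ_of S s \<theta> = germ_of S t \<theta>')" using True by auto
        also have "\<dots> \<longleftrightarrow> \<theta> \<in> U \<and> (\<exists>e \<in> idempotents S. \<theta> e = 1 \<and> s \<odot> e = t \<odot> e)"
          using germ_of_eq_iff[OF p(1) U'] by blast
        also have "\<dots> \<longleftrightarrow> \<theta> \<in> ?R" using True p by (auto simp: char_dom_def)
        finally show ?thesis .
      qed auto
    qed
    moreover have "openin (character_topology S) ?R"
      by (intro openin_Union ballI) (use U D in \<open>auto intro!: openin_Int openin_char_dom\<close>)
    ultimately show ?thesis by (auto simp: openin_subtopology_Int2 openin_subtopology)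
  qed
  moreover have "germ_of S s ` ?D \<in> {germ_of S s ` U | s U. s \<in> scarrier S \<and> openin (character_topology S) U \<and>
        U \<subseteq> char_dom S (s\<^sup>\<star> \<odot> s)}" using s D by blast
  ultimately show ?thesis
    unfolding germ_topology_def continuous_on_generated_topo_iff top
    by (intro conjI allI impI Union_upper) auto
qed

end

section \<open>Slices over an invariant set of characters and the homomorphism into the groupoid
  algebra\<close>

definition ind :: "'a set \<Rightarrow> 'a \<Rightarrow> 'k::{comm_ring, comm_monoid_mult}" where
  "ind W x = (if x \<in> W then 1 else 0)"

lemma ind_Int: "ind (V \<inter> W) x = ind V x * ind W x"
  by (simp add: ind_def)



text \<open>\<open>Y_compact\<close> is closedness of \<open>Y\<close> in the form in which slices
  use it, and \<open>Y_invariant\<close> keeps the range of an arrow that begins in \<open>Y\<close>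
  inside \<open>Y\<close>.\<close>

locale reduced_groupoid = inverse_semigroup S for S :: "('s, 'm) star_semigroup_scheme" +
  fixes Y :: "('s \<Rightarrow> nat) set"
  assumes Y_characters: "Y \<subseteq> characters S"
    and Y_invariant: "(s, \<theta>) \<in> germ_pairs \<Longrightarrow> \<theta> \<in> Y \<Longrightarrow> char_act S s \<theta> \<in> Y"
    and Y_compact: "e \<in> idempotents S \<Longrightarrow> compactin (character_topology S) (char_dom S e \<inter> Y)"
begin

definition slice :: "'s \<Rightarrow> 's germ set" where
  "slice s = germ_of S s ` (char_dom S (s\<^sup>\<star> \<odot> s) \<inter> Y)"

abbreviation G where "G \<equiv> restrict_groupoid (universal_groupoid S) Y"

lemma mem_slice_iff:
  "s \<in> scarrier S \<Longrightarrow> \<gamma> \<in> slice s \<longleftrightarrow>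
    (s, germ_dom \<gamma>) \<in> germ_pairs \<and> germ_dom \<gamma> \<in> Y \<and> \<gamma> = germ_of S s (germ_dom \<gamma>)"
  unfolding slice_def by (auto simp: germ_dom_germ_of germ_pairs_def)

lemma germ_of_mem_slice:
  assumes p: "(s, \<theta>) \<in> germ_pairs" and "\<theta> \<in> Y" "t \<in> scarrier S"
  shows "germ_of S s \<theta> \<in> slice t \<longleftrightarrow>
    (t, \<theta>) \<in> germ_pairs \<and> (\<exists>e \<in> idempotents S. \<theta> e = 1 \<and> s \<odot> e = t \<odot> e)"
  using assms germ_of_eq_iff[OF p, of t \<theta>] by (auto simp: mem_slice_iff germ_dom_germ_of[OF p])

lemma groupoid_simps: "gdom G = germ_dom" "gran G = germ_ran S" "gmult G = germ_mult S"
  by (auto simp: restrict_groupoid_def universal_groupoid_def Let_def)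

lemma arrows_eq: "arrows G = (\<Union>s \<in> scarrier S. slice s)"
proof -
  have "arrows G = {\<gamma> \<in> germs S. germ_dom \<gamma> \<in> Y}"
    by (simp add: restrict_groupoid_def universal_groupoid_def Let_def)
  also have "\<dots> = (\<Union>s \<in> scarrier S. slice s)"
  proof (intro set_eqI iffI)
    fix \<gamma> assume "\<gamma> \<in> {\<gamma> \<in> germs S. germ_dom \<gamma> \<in> Y}"
    then obtain s \<theta> where \<gamma>: "s \<in> scarrier S" "\<theta> \<in> char_dom S (s\<^sup>\<star> \<odot> s)" "\<gamma> = germ_of S s \<theta>" "germ_dom \<gamma> \<in> Y"
      unfolding germs_def by blast
    then have "germ_dom \<gamma> = \<theta>"
      by (simp add: germ_dom_germ_of germ_pairs_def)
    then have "\<gamma> \<in> slice s"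
      unfolding slice_def using \<gamma> by (intro image_eqI[of _ _ \<theta>]) auto
    then show "\<gamma> \<in> (\<Union>s \<in> scarrier S. slice s)" using \<gamma>(1) by (rule UN_I[rotated])
  next
    fix \<gamma> assume "\<gamma> \<in> (\<Union>s \<in> scarrier S. slice s)"
    then obtain s where s: "s \<in> scarrier S" "\<gamma> \<in> slice s" by blast
    then have "(s, germ_dom \<gamma>) \<in> germ_pairs" "germ_dom \<gamma> \<in> Y" "\<gamma> = germ_of S s (germ_dom \<gamma>)"
      using mem_slice_iff by blast+
    then show "\<gamma> \<in> {\<gamma> \<in> germs S. germ_dom \<gamma> \<in> Y}"
      unfolding germs_def germ_pairs_def by blast
  qed
  finally show ?thesis .
qed

lemma gtop_eq: "gtop G = subtopology (germ_topology S) (arrows G)"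
  by (simp add: restrict_groupoid_def universal_groupoid_def Let_def)

lemma slice_subset: "s \<in> scarrier S \<Longrightarrow> slice s \<subseteq> arrows G"
  unfolding arrows_eq by blast

lemma openin_germ_image_G:
  assumes s: "s \<in> scarrier S" and V: "openin (character_topology S) V" "V \<subseteq> char_dom S (s\<^sup>\<star> \<odot> s)"
  shows "openin (gtop G) (germ_of S s ` (V \<inter> Y))"
proof -
  have "germ_of S s ` (V \<inter> Y) = germ_of S s ` V \<inter> arrows G"
  proof (intro equalityI subsetI)
    fix \<gamma> assume "\<gamma> \<in> germ_of S s ` V \<inter> arrows G"
    then obtain \<theta> t where g: "\<theta> \<in> V" "\<gamma> = germ_of S s \<theta>" "t \<in> scarrier S" "\<gamma> \<in> slice t"
      unfolding arrows_eq by blast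
    then have "germ_dom \<gamma> = \<theta>" using V s by (auto intro!: germ_dom_germ_of simp: germ_pairs_def)
    then show "\<gamma> \<in> germ_of S s ` (V \<inter> Y)" using g by (auto simp: mem_slice_iff)
  qed (use s V slice_subset[OF s] in \<open>auto simp: slice_def\<close>)
  then show ?thesis using openin_germ_image[OF s V] by (auto simp: gtop_eq openin_subtopology)
qed

text \<open>Compactness is carried over from the characters by the continuous map
  \<open>germ_of S s\<close>; on the range side the action of the star recovers the character of a
  germ.\<close>

lemma slice_bisection:
  assumes s: "s \<in> scarrier S" shows "slice s \<in> compact_open_bisections G"
proof -
  have "openin (gtop G) (slice s)"
    unfolding slice_def by (rule openin_germ_image_G[OF s]) (auto simp: openin_char_dom dom_idem s)
  moreover have "compactin (gtop G) (slice s)"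
  proof -
    have "compactin (subtopology (character_topology S) (char_dom S (s\<^sup>\<star> \<odot> s))) (char_dom S (s\<^sup>\<star> \<odot> s) \<inter> Y)"
      using Y_compact[OF dom_idem[OF s]] by (simp add: compactin_subtopology)
    from image_compactin[OF this continuous_germ_of[OF s]] slice_subset[OF s]
    show ?thesis by (simp add: gtop_eq compactin_subtopology slice_def)
  qed
  moreover have "inj_on germ_dom (slice s)"
    by (rule inj_onI) (metis mem_slice_iff s)
  moreover have "inj_on (germ_ran S) (slice s)"
  proof (rule inj_onI)
    fix \<alpha> \<beta> assume a: "\<alpha> \<in> slice s" "\<beta> \<in> slice s" "germ_ran S \<alpha> = germ_ran S \<beta>"
    define \<theta> \<eta> where d: "\<theta> = germ_dom \<alpha>" "\<eta> = germ_dom \<beta>"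
    have p: "(s, \<theta>) \<in> germ_pairs" "(s, \<eta>) \<in> germ_pairs" "\<alpha> = germ_of S s \<theta>" "\<beta> = germ_of S s \<eta>"
      using a s by (auto simp: mem_slice_iff d)
    then have "char_act S s \<theta> = char_act S s \<eta>" using a(3) by (simp add: germ_ran_germ_of)
    then have "\<theta> = \<eta>" using char_act_star p by metis
    then show "\<alpha> = \<beta>" using p by simp
  qed
  ultimately show ?thesis by (simp add: compact_open_bisections_def groupoid_simps)
qed

text \<open>Slices are bisections, so an arrow factors through two of them in at most one way, with
  factors determined by its domain. The convolution of two slice indicators is therefore again a
  slice indicator, and only finitely many pairs ever contribute to a convolution. Invariance of
  \<open>Y\<close> places the left factor in its slice.\<close>

lemma conv_pairs:
  assumes s: "s \<in> scarrier S" and t: "t \<in> scarrier S"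
  shows "{(\<alpha>, \<beta>). \<alpha> \<in> slice s \<and> \<beta> \<in> slice t \<and> germ_dom \<alpha> = germ_ran S \<beta> \<and> germ_mult S \<alpha> \<beta> = \<gamma>} =
    (if \<gamma> \<in> slice (s \<odot> t)
     then {(germ_of S s (char_act S t (germ_dom \<gamma>)), germ_of S t (germ_dom \<gamma>))} else {})" (is "?P = ?Q")
proof -
  have st: "s \<odot> t \<in> scarrier S" using s t by (rule mult_closed)
  have "\<gamma> \<in> slice (s \<odot> t) \<and> \<alpha> = germ_of S s (char_act S t (germ_dom \<gamma>)) \<and> \<beta> = germ_of S t (germ_dom \<gamma>)"
    if a: "\<alpha> \<in> slice s" and b: "\<beta> \<in> slice t" and c: "germ_dom \<alpha> = germ_ran S \<beta>" "germ_mult S \<alpha> \<beta> = \<gamma>" for \<alpha> \<beta>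
  proof -
    define \<theta> where d: "\<theta> = germ_dom \<beta>"
    have b': "(t, \<theta>) \<in> germ_pairs" "\<theta> \<in> Y" "\<beta> = germ_of S t \<theta>"
      using b t by (auto simp: mem_slice_iff d)
    then have "germ_dom \<alpha> = char_act S t \<theta>" using c by (simp add: germ_ran_germ_of)
    then have a': "(s, char_act S t \<theta>) \<in> germ_pairs" "\<alpha> = germ_of S s (char_act S t \<theta>)"
      using a s by (auto simp: mem_slice_iff)
    note m = germ_mult_pairs[OF b'(1) a'(1)]
    have "\<gamma> = germ_of S (s \<odot> t) \<theta>" using c(2) m(2) a' b' by simp
    moreover from this have "germ_dom \<gamma> = \<theta>" using m(1) by (simp add: germ_dom_germ_of)
    ultimately show ?thesis using a' b' m(1) by (simp add: mem_slice_iff st)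
  qed
  moreover have "(germ_of S s (char_act S t (germ_dom \<gamma>)), germ_of S t (germ_dom \<gamma>)) \<in> ?P"
    if g: "\<gamma> \<in> slice (s \<odot> t)"
  proof -
    define \<theta> where d: "\<theta> = germ_dom \<gamma>"
    have g': "(s \<odot> t, \<theta>) \<in> germ_pairs" "\<theta> \<in> Y" "\<gamma> = germ_of S (s \<odot> t) \<theta>"
      using g st by (auto simp: mem_slice_iff d)
    note p = germ_mult_pairs_conv[OF g'(1) s t]
    show ?thesis
      using g' p s t Y_invariant[OF p(1) g'(2)]
      by (simp add: mem_slice_iff germ_dom_germ_of germ_ran_germ_of germ_mult_pairs flip: d)
  qed
  ultimately show ?thesis by (auto split: if_splits)
qed

definition rep :: "('s \<Rightarrow>\<^sub>0 'k::{comm_ring, comm_monoid_mult}) \<Rightarrow> 's germ \<Rightarrow> 'k" where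
  "rep f \<gamma> = (\<Sum>s \<in> Poly_Mapping.keys f. Poly_Mapping.lookup f s * ind (slice s) \<gamma>)"

lemma rep_superset:
  "finite A \<Longrightarrow> Poly_Mapping.keys f \<subseteq> A \<Longrightarrow>
    rep f \<gamma> = (\<Sum>s \<in> A. Poly_Mapping.lookup f s * ind (slice s) \<gamma>)"
  unfolding rep_def by (rule sum.mono_neutral_left) (auto simp: in_keys_iff)

lemma rep_zero: "rep 0 \<gamma> = 0"
  by (simp add: rep_def)

lemma rep_add: "rep (f + g) \<gamma> = rep f \<gamma> + rep g \<gamma>"
  by (simp add: rep_superset[of "Poly_Mapping.keys f \<union> Poly_Mapping.keys g"] keys_add
      lookup_add distrib_right sum.distrib)

lemma rep_minus: "rep (f - g) \<gamma> = rep f \<gamma> - rep g \<gamma>"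
  using rep_add[of "f - g" g \<gamma>] by simp

lemma rep_sum: "rep (\<Sum>i\<in>A. f i) \<gamma> = (\<Sum>i\<in>A. rep (f i) \<gamma>)"
  by (induction A rule: infinite_finite_induct) (auto simp: rep_zero rep_add)

lemma rep_single: "rep (Poly_Mapping.single s c) \<gamma> = c * ind (slice s) \<gamma>"
  by (simp add: rep_superset[of "{s}"])

lemma rep_scale: "rep (Poly_Mapping.map ((*) k) f) \<gamma> = k * rep f \<gamma>"
  by (simp add: rep_superset[of "Poly_Mapping.keys f"] keys_scale lookup_scale sum_distrib_left mult.assoc)

lemma rep_mult:
  fixes f g :: "'s \<Rightarrow>\<^sub>0 'k::{comm_ring, comm_monoid_mult}"
  assumes f: "Poly_Mapping.keys f \<subseteq> scarrier S" and g: "Poly_Mapping.keys g \<subseteq> scarrier S"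
  shows "rep (amult (semigroup_algebra S) f g) = amult (groupoid_algebra G) (rep f) (rep g)"
proof
  fix \<gamma>
  let ?f = "Poly_Mapping.lookup f" and ?g = "Poly_Mapping.lookup g"
  let ?F = "Poly_Mapping.keys f" and ?G = "Poly_Mapping.keys g"
  define B where "B s t = {(\<alpha>, \<beta>). \<alpha> \<in> slice s \<and> \<beta> \<in> slice t \<and> germ_dom \<alpha> = germ_ran S \<beta> \<and> germ_mult S \<alpha> \<beta> = \<gamma>}" for s t
  \<comment> \<open>The convolution runs over the pairs at which neither function vanishes, a set
    that depends on cancellation. \<open>A\<close> is a finite set of composable pairs containing
    it, over which the sums may be exchanged.\<close>
  define A where "A = (\<Union>s \<in> ?F. \<Union>t \<in> ?G. B s t)"
  have B: "B s t = (if \<gamma> \<in> slice (s \<odot> t)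
     then {(germ_of S s (char_act S t (germ_dom \<gamma>)), germ_of S t (germ_dom \<gamma>))} else {})" if "s \<in> ?F" "t \<in> ?G" for s t
    unfolding B_def by (rule conv_pairs) (use that f g in auto)
  have fin: "finite A" unfolding A_def by (intro finite_UN_I finite_keys) (simp add: B)
  \<comment> \<open>On \<open>A\<close> the product of the two indicators is 1 exactly on
    \<open>B s t\<close>, which has at most one element.\<close>
  have B_sum: "(\<Sum>(\<alpha>, \<beta>) \<in> A. ind (slice s) \<alpha> * ind (slice t) \<beta>) = (ind (slice (s \<odot> t)) \<gamma> :: 'k)" if "s \<in> ?F" "t \<in> ?G" for s t
  proof -
    have "(\<Sum>(\<alpha>, \<beta>) \<in> A. ind (slice s) \<alpha> * ind (slice t) \<beta>) = (\<Sum>_ \<in> B s t. 1 :: 'k)"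
      by (rule sum.mono_neutral_cong_right[OF fin])
        (use that in \<open>auto simp: A_def B_def ind_def split: if_splits\<close>)
    also have "\<dots> = ind (slice (s \<odot> t)) \<gamma>" using B[OF that] by (simp add: ind_def)
    finally show ?thesis .
  qed
  have "amult (groupoid_algebra G) (rep f) (rep g) \<gamma> = (\<Sum>(\<alpha>, \<beta>) \<in> A. rep f \<alpha> * rep g \<beta>)"
    unfolding groupoid_algebra_def kalgebra.simps groupoid_simps
  proof (rule sum.mono_neutral_left[OF fin])
    show "{(\<alpha>, \<beta>). \<alpha> \<in> arrows G \<and> \<beta> \<in> arrows G \<and> germ_dom \<alpha> = germ_ran S \<beta> \<and> germ_mult S \<alpha> \<beta> = \<gamma> \<and>
      rep f \<alpha> \<noteq> 0 \<and> rep g \<beta> \<noteq> 0} \<subseteq> A"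
    proof clarify
      fix \<alpha> \<beta> assume a: "\<alpha> \<in> arrows G" "\<beta> \<in> arrows G" "germ_dom \<alpha> = germ_ran S \<beta>" "rep f \<alpha> \<noteq> 0" "rep g \<beta> \<noteq> 0"
        "\<gamma> = germ_mult S \<alpha> \<beta>"
      obtain s where s: "s \<in> ?F" "?f s * ind (slice s) \<alpha> \<noteq> 0"
        using a(4) unfolding rep_def by (rule sum.not_neutral_contains_not_neutral)
      obtain t where t: "t \<in> ?G" "?g t * ind (slice t) \<beta> \<noteq> 0"
        using a(5) unfolding rep_def by (rule sum.not_neutral_contains_not_neutral)
      have "\<alpha> \<in> slice s" "\<beta> \<in> slice t" using s t by (auto simp: ind_def split: if_splits)
      then show "(\<alpha>, \<beta>) \<in> A" unfolding A_def B_def using a s t by blast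
    qed
    show "\<forall>i \<in> A - {(\<alpha>, \<beta>). \<alpha> \<in> arrows G \<and> \<beta> \<in> arrows G \<and> germ_dom \<alpha> = germ_ran S \<beta> \<and> germ_mult S \<alpha> \<beta> = \<gamma> \<and>
      rep f \<alpha> \<noteq> 0 \<and> rep g \<beta> \<noteq> 0}. (case i of (\<alpha>, \<beta>) \<Rightarrow> rep f \<alpha> * rep g \<beta>) = 0"
      using f g slice_subset by (fastforce simp: A_def B_def)
  qed
  also have "\<dots> = (\<Sum>p \<in> A. \<Sum>s \<in> ?F. \<Sum>t \<in> ?G. (?f s * ?g t) * (ind (slice s) (fst p) * ind (slice t) (snd p)))"
    by (simp add: rep_def sum_product split_def mult_ac)
  also have "\<dots> = (\<Sum>s \<in> ?F. \<Sum>t \<in> ?G. \<Sum>p \<in> A. (?f s * ?g t) * (ind (slice s) (fst p) * ind (slice t) (snd p)))"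
    by (subst sum.swap) (rule sum.cong[OF HOL.refl], rule sum.swap)
  also have "\<dots> = (\<Sum>s \<in> ?F. \<Sum>t \<in> ?G. (?f s * ?g t) * ind (slice (s \<odot> t)) \<gamma>)"
    using B_sum by (intro sum.cong HOL.refl) (simp add: split_def flip: sum_distrib_left)
  also have "\<dots> = rep (amult (semigroup_algebra S) f g) \<gamma>"
    by (simp add: semigroup_algebra_def rep_sum rep_single)
  finally show "rep (amult (semigroup_algebra S) f g) \<gamma> = amult (groupoid_algebra G) (rep f) (rep g) \<gamma>" ..
qed

lemma groupoid_carrier:
  "acarrier (groupoid_algebra G :: ('k::{comm_ring, comm_monoid_mult}, 's germ \<Rightarrow> 'k) kalgebra) =
    {(\<lambda>\<gamma>. \<Sum>U \<in> F. c U * ind U \<gamma>) | F c. finite F \<and> F \<subseteq> compact_open_bisections G}"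
  by (simp add: groupoid_algebra_def ind_def)

lemma rep_in_carrier:
  assumes "Poly_Mapping.keys f \<subseteq> scarrier S"
  shows "rep f \<in> acarrier (groupoid_algebra G)"
proof -
  let ?F = "Poly_Mapping.keys f"
  \<comment> \<open>Different elements may have the same slice, whereas the span is indexed by sets;
    coefficients with a common slice are added up.\<close>
  define c where "c U = (\<Sum>s \<in> {s \<in> ?F. slice s = U}. Poly_Mapping.lookup f s)" for U
  have "rep f \<gamma> = (\<Sum>U \<in> slice ` ?F. c U * ind U \<gamma>)" for \<gamma>
    unfolding rep_def c_def sum.image_gen[OF finite_keys, of _ f slice] sum_distrib_right
    by (intro sum.cong HOL.refl) auto
  moreover have "slice ` ?F \<subseteq> compact_open_bisections G" using assms slice_bisection by blast
  ultimately show ?thesis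
    unfolding groupoid_carrier
    by (intro CollectI exI[of _ "slice ` ?F"] exI[of _ c]) (auto intro!: ext)
qed

end

section \<open>Surjectivity: the ring of sets whose indicators lie in the image\<close>

locale meet_groupoid = reduced_groupoid S Y
  for S :: "('s, 'm) star_semigroup_scheme" and Y +
  assumes slice_meet: "s \<in> scarrier S \<Longrightarrow> t \<in> scarrier S \<Longrightarrow> \<exists>r \<in> scarrier S. slice s \<inter> slice t = slice r"
begin

text \<open>The argument of type \<open>itself\<close> fixes the coefficient ring, which the sets
  themselves do not mention.\<close>

definition algebra_sets :: "'k::{comm_ring, comm_monoid_mult} itself \<Rightarrow> 's germ set set" where
  "algebra_sets _ = {W. \<exists>f :: 's \<Rightarrow>\<^sub>0 'k. Poly_Mapping.keys f \<subseteq> scarrier S \<and> rep f = ind W}"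

context
  fixes k :: "'k::{comm_ring, comm_monoid_mult} itself"
begin

lemma algebra_setsI:
  fixes f :: "'s \<Rightarrow>\<^sub>0 'k"
  assumes "Poly_Mapping.keys f \<subseteq> scarrier S" "\<And>\<gamma>. rep f \<gamma> = ind W \<gamma>"
  shows "W \<in> algebra_sets k"
  unfolding algebra_sets_def using assms by blast

lemma algebra_setsE:
  assumes "W \<in> algebra_sets k"
  obtains f :: "'s \<Rightarrow>\<^sub>0 'k" where "Poly_Mapping.keys f \<subseteq> scarrier S" "\<And>\<gamma>. rep f \<gamma> = ind W \<gamma>"
  using assms unfolding algebra_sets_def by force

lemma algebra_sets_empty: "{} \<in> algebra_sets k"
  by (rule algebra_setsI[of 0]) (auto simp: rep_zero ind_def)

lemma algebra_sets_slice: "s \<in> scarrier S \<Longrightarrow> slice s \<in> algebra_sets k"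
  by (rule algebra_setsI[of "Poly_Mapping.single s 1"]) (auto simp: rep_single split: if_splits)

lemma rep_pointwise_mult:
  fixes f g :: "'s \<Rightarrow>\<^sub>0 'k"
  assumes f: "Poly_Mapping.keys f \<subseteq> scarrier S" and g: "Poly_Mapping.keys g \<subseteq> scarrier S"
  obtains h :: "'s \<Rightarrow>\<^sub>0 'k" where "Poly_Mapping.keys h \<subseteq> scarrier S" "\<And>\<gamma>. rep h \<gamma> = rep f \<gamma> * rep g \<gamma>"
proof -
  let ?F = "Poly_Mapping.keys f" and ?G = "Poly_Mapping.keys g"
  obtain r where r: "r s t \<in> scarrier S" "slice s \<inter> slice t = slice (r s t)"
    if "s \<in> scarrier S" "t \<in> scarrier S" for s t
    using slice_meet by metis
  define h where "h = (\<Sum>s \<in> ?F. \<Sum>t \<in> ?G. Poly_Mapping.single (r s t) (Poly_Mapping.lookup f s * Poly_Mapping.lookup g t))"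
  have "Poly_Mapping.keys h \<subseteq> scarrier S"
  proof -
    have "Poly_Mapping.keys h \<subseteq> (\<Union>s \<in> ?F. \<Union>t \<in> ?G. {r s t})"
      unfolding h_def by (intro order.trans[OF keys_sum] UN_mono order.refl) (auto split: if_splits)
    then show ?thesis using f g r(1) by blast
  qed
  moreover have "rep h \<gamma> = rep f \<gamma> * rep g \<gamma>" for \<gamma>
  proof -
    have "rep f \<gamma> * rep g \<gamma> = (\<Sum>s \<in> ?F. \<Sum>t \<in> ?G. (Poly_Mapping.lookup f s * Poly_Mapping.lookup g t) * ind (slice s \<inter> slice t) \<gamma>)"
      by (simp add: rep_def sum_product ind_Int mult_ac)
    also have "\<dots> = (\<Sum>s \<in> ?F. \<Sum>t \<in> ?G. (Poly_Mapping.lookup f s * Poly_Mapping.lookup g t) * ind (slice (r s t)) \<gamma>)"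
      using f g by (intro sum.cong HOL.refl) (auto simp: r(2) subset_iff)
    finally show ?thesis by (simp add: h_def rep_sum rep_single)
  qed
  ultimately show thesis using that by blast
qed

lemma algebra_sets_Diff:
  assumes "V \<in> algebra_sets k" "W \<in> algebra_sets k" shows "V - W \<in> algebra_sets k"
proof -
  obtain f g h :: "'s \<Rightarrow>\<^sub>0 'k" where f: "Poly_Mapping.keys f \<subseteq> scarrier S" "\<And>\<gamma>. rep f \<gamma> = ind V \<gamma>"
    and g: "Poly_Mapping.keys g \<subseteq> scarrier S" "\<And>\<gamma>. rep g \<gamma> = ind W \<gamma>"
    and h: "Poly_Mapping.keys h \<subseteq> scarrier S" "\<And>\<gamma>. rep h \<gamma> = rep f \<gamma> * rep g \<gamma>"
    using algebra_setsE[OF assms(1)] algebra_setsE[OF assms(2)] rep_pointwise_mult by metis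
  show ?thesis
  proof (rule algebra_setsI)
    show "Poly_Mapping.keys (f - h) \<subseteq> scarrier S" using keys_diff[of f h] f h by blast
    show "rep (f - h) \<gamma> = ind (V - W) \<gamma>" for \<gamma> by (simp add: rep_minus f g h ind_def)
  qed
qed

lemma algebra_sets_Int:
  assumes "V \<in> algebra_sets k" "W \<in> algebra_sets k" shows "V \<inter> W \<in> algebra_sets k"
proof -
  have "V \<inter> W = V - (V - W)" by blast
  then show ?thesis using assms by (simp add: algebra_sets_Diff)
qed

lemma algebra_sets_Un:
  assumes "V \<in> algebra_sets k" "W \<in> algebra_sets k" shows "V \<union> W \<in> algebra_sets k"
proof -
  obtain f g :: "'s \<Rightarrow>\<^sub>0 'k" where f: "Poly_Mapping.keys f \<subseteq> scarrier S" "\<And>\<gamma>. rep f \<gamma> = ind (V - W) \<gamma>"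
    and g: "Poly_Mapping.keys g \<subseteq> scarrier S" "\<And>\<gamma>. rep g \<gamma> = ind W \<gamma>"
    using algebra_setsE[OF algebra_sets_Diff[OF assms]] algebra_setsE[OF assms(2)] by metis
  show ?thesis
  proof (rule algebra_setsI)
    show "Poly_Mapping.keys (f + g) \<subseteq> scarrier S" using keys_add[of f g] f g by blast
    show "rep (f + g) \<gamma> = ind (V \<union> W) \<gamma>" for \<gamma> by (simp add: rep_add f g ind_def)
  qed
qed

lemma algebra_sets_Union: "finite \<F> \<Longrightarrow> \<F> \<subseteq> algebra_sets k \<Longrightarrow> \<Union>\<F> \<in> algebra_sets k"
  by (induction \<F> rule: finite_induct) (auto simp: algebra_sets_empty algebra_sets_Un)

text \<open>Translates a condition on one coordinate of a character into membership in a slice, so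
  that conditions on finitely many coordinates become Boolean combinations of slices.\<close>

lemma germ_of_mem_slice_idem:
  assumes p: "(s, \<theta>) \<in> germ_pairs" and \<theta>: "\<theta> \<in> Y" and e: "e \<in> idempotents S"
  shows "germ_of S s \<theta> \<in> slice (s \<odot> e) \<longleftrightarrow> \<theta> e = 1"
proof -
  have s: "s \<in> scarrier S" "e \<in> scarrier S" "\<theta> \<in> characters S" "\<theta> (s\<^sup>\<star> \<odot> s) = 1"
    using germ_pairs_idem[OF p] e by (auto simp: idem_closed)
  have "(s \<odot> e, \<theta>) \<in> germ_pairs \<longleftrightarrow> \<theta> e = 1"
    using s e by (auto simp: germ_pairs_def char_dom_def dom_mult_idem char_mult dom_idem closed)
  moreover have "s \<odot> e = (s \<odot> e) \<odot> e" using s by (simp add: assoc idem_mult[OF e])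
  ultimately show ?thesis using germ_of_mem_slice[OF p \<theta>, of "s \<odot> e"] s e by (auto simp: closed)
qed

text \<open>Prescribing one more coordinate either intersects with the slice of
  \<open>s \<odot> e\<close> or removes it, according to the prescribed value.\<close>

lemma algebra_sets_cylinder:
  assumes s: "s \<in> scarrier S" and J: "finite J" "J \<subseteq> idempotents S"
  shows "germ_of S s ` {\<theta> \<in> char_dom S (s\<^sup>\<star> \<odot> s) \<inter> Y. \<forall>e \<in> J. \<theta> e = \<eta> e} \<in> algebra_sets k"
  using J
proof (induction J rule: finite_induct)
  case empty
  show ?case using algebra_sets_slice[OF s] by (simp add: slice_def Int_def)
next
  case (insert e J)
  let ?C = "\<lambda>J. germ_of S s ` {\<theta> \<in> char_dom S (s\<^sup>\<star> \<odot> s) \<inter> Y. \<forall>e \<in> J. \<theta> e = \<eta> e}"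
  have e: "e \<in> idempotents S" and IH: "?C J \<in> algebra_sets k" using insert by auto
  have sl: "slice (s \<odot> e) \<in> algebra_sets k"
    by (rule algebra_sets_slice[OF mult_closed[OF s idem_closed[OF e]]])
  have mem: "germ_of S s \<theta> \<in> slice (s \<odot> e) \<longleftrightarrow> \<theta> e = 1" "\<theta> e = 0 \<or> \<theta> e = 1"
    if "\<theta> \<in> char_dom S (s\<^sup>\<star> \<odot> s) \<inter> Y" for \<theta>
    using that s e germ_of_mem_slice_idem[of s \<theta> e] char_01[of \<theta> e] by (auto simp: germ_pairs_def char_dom_def)
  \<comment> \<open>\<eta> need not be a character here; a prescribed value other than 0 and 1
    leaves nothing.\<close>
  consider "\<eta> e = 1" | "\<eta> e = 0" | "\<eta> e \<noteq> 1" "\<eta> e \<noteq> 0" by blast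
  then show ?case
  proof cases
    case 1
    have "?C (insert e J) = ?C J \<inter> slice (s \<odot> e)" using mem 1 by auto
    then show ?thesis using IH sl by (simp add: algebra_sets_Int)
  next
    case 2
    have "?C (insert e J) = ?C J - slice (s \<odot> e)" using mem 2 by force
    then show ?thesis using IH sl by (simp add: algebra_sets_Diff)
  next
    case 3
    have "?C (insert e J) = {}" using mem(2) 3 by fastforce
    then show ?thesis using algebra_sets_empty by (simp only:)
  qed
qed

lemma openin_cylinder:
  assumes s: "s \<in> scarrier S" and J: "finite J" "J \<subseteq> idempotents S"
  shows "openin (gtop G) (germ_of S s ` {\<theta> \<in> char_dom S (s\<^sup>\<star> \<odot> s) \<inter> Y. \<forall>e \<in> J. \<theta> e = \<eta> e})"
proof -
  have "openin (character_topology S) {\<theta> \<in> char_dom S (s\<^sup>\<star> \<odot> s). \<forall>e \<in> J. \<theta> e = \<eta> e}"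
    using J
  proof (induction J rule: finite_induct)
    case empty then show ?case using openin_char_dom[OF dom_idem[OF s]] by simp
  next
    case (insert e J)
    have "{\<theta> \<in> char_dom S (s\<^sup>\<star> \<odot> s). \<forall>e \<in> insert e J. \<theta> e = \<eta> e} =
      {\<theta> \<in> char_dom S (s\<^sup>\<star> \<odot> s). \<forall>e \<in> J. \<theta> e = \<eta> e} \<inter> {\<theta> \<in> characters S. \<theta> e = \<eta> e}"
      by (auto simp: char_dom_def)
    then show ?case using insert by (simp add: openin_Int openin_char_value)
  qed
  from openin_germ_image_G[OF s this Collect_restrict] show ?thesis
    by (simp add: Int_def conj_commute conj_left_commute)
qed

text \<open>Induction on the generation of the topology; the substance is the generating case, where
  a box around a character is shrunk to a cylinder. \<open>W\<close> is required to be open so that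
  compactness can select finitely many such sets.\<close>

lemma open_nbhd:
  assumes "openin (gtop G) U" "\<gamma> \<in> U"
  obtains W where "W \<in> algebra_sets k" "openin (gtop G) W" "\<gamma> \<in> W" "W \<subseteq> U"
proof -
  have *: "\<exists>W \<in> algebra_sets k. openin (gtop G) W \<and> \<gamma> \<in> W \<and> W \<subseteq> T"
    if "generate_topology_on {germ_of S s ` U | s U. s \<in> scarrier S \<and> openin (character_topology S) U \<and>
        U \<subseteq> char_dom S (s\<^sup>\<star> \<odot> s)} T" "\<gamma> \<in> T" "\<gamma> \<in> arrows G" for T
    using that
  proof (induction T rule: generate_topology_on.induct)
    case (Int V W)
    then obtain V' W' where "V' \<in> algebra_sets k" "openin (gtop G) V'" "\<gamma> \<in> V'" "V' \<subseteq> V"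
      and "W' \<in> algebra_sets k" "openin (gtop G) W'" "\<gamma> \<in> W'" "W' \<subseteq> W" by blast
    then show ?case
      by (intro bexI[of _ "V' \<inter> W'"]) (auto intro: algebra_sets_Int openin_Int)
  next
    case (UN K)
    then obtain T where "T \<in> K" "\<gamma> \<in> T" by blast
    then obtain W where "W \<in> algebra_sets k" "openin (gtop G) W" "\<gamma> \<in> W" "W \<subseteq> T"
      using UN.IH UN.prems(2) by blast
    then show ?case using \<open>T \<in> K\<close> by blast
  next
    case (Basis T)
    then obtain s V where s: "s \<in> scarrier S" and V: "openin (character_topology S) V" "V \<subseteq> char_dom S (s\<^sup>\<star> \<odot> s)"
      and T: "T = germ_of S s ` V" by blast
    obtain \<eta> where \<eta>: "\<eta> \<in> V" "\<gamma> = germ_of S s \<eta>"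
      using Basis.prems(1) unfolding T by blast
    have p: "(s, \<eta>) \<in> germ_pairs" using \<eta> V s by (auto simp: germ_pairs_def)
    have "germ_dom \<gamma> \<in> Y" using Basis.prems(2) mem_slice_iff unfolding arrows_eq by auto
    then have Y: "\<eta> \<in> Y" using \<eta> p by (simp add: germ_dom_germ_of)
    obtain V' where V': "openin (product_topology (\<lambda>_. discrete_topology {0, 1}) (idempotents S)) V'"
      "V = V' \<inter> characters S"
      using V(1) unfolding character_topology_def openin_subtopology by blast
    then obtain B where B: "finite {e \<in> idempotents S. B e \<noteq> topspace (discrete_topology {0, 1 :: nat})}"
      "\<eta> \<in> Pi\<^sub>E (idempotents S) B" "Pi\<^sub>E (idempotents S) B \<subseteq> V'"
      using \<eta>(1) unfolding openin_product_topology_alt by blast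
    \<comment> \<open>A box restricts only finitely many coordinates. Prescribing the values of
      \<eta> at exactly these gives a cylinder inside the box.\<close>
    define J where "J = {e \<in> idempotents S. B e \<noteq> {0, 1}}"
    have J: "finite J" "J \<subseteq> idempotents S" using B by (auto simp: J_def)
    define W where "W = germ_of S s ` {\<theta> \<in> char_dom S (s\<^sup>\<star> \<odot> s) \<inter> Y. \<forall>e \<in> J. \<theta> e = \<eta> e}"
    have "\<theta> \<in> V" if \<theta>: "\<theta> \<in> characters S" "\<forall>e \<in> J. \<theta> e = \<eta> e" for \<theta>
    proof -
      have "\<theta> \<in> Pi\<^sub>E (idempotents S) B"
      proof (rule PiE_I)
        fix e assume e: "e \<in> idempotents S"
        show "\<theta> e \<in> B e"
          using \<theta> e char_01[OF \<theta>(1) e] PiE_mem[OF B(2) e] by (cases "e \<in> J") (auto simp: J_def)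
      next
        fix e assume "e \<notin> idempotents S"
        then show "\<theta> e = undefined" using \<theta>(1) by (auto simp: characters_def)
      qed
      then show ?thesis using B \<theta> V' by blast
    qed
    then have "W \<subseteq> T" unfolding W_def T by (auto simp: char_dom_def)
    moreover have "\<gamma> \<in> W" unfolding W_def using \<eta> Y V by blast
    moreover have "W \<in> algebra_sets k" "openin (gtop G) W"
      unfolding W_def by (intro algebra_sets_cylinder openin_cylinder s J)+
    ultimately show ?case by blast
  qed simp
  obtain T where T: "openin (germ_topology S) T" "U = T \<inter> arrows G"
    using assms(1) by (auto simp: gtop_eq openin_subtopology)
  then obtain W where W: "W \<in> algebra_sets k" "openin (gtop G) W" "\<gamma> \<in> W" "W \<subseteq> T"
    using * assms(2) unfolding germ_topology_def openin_topology_generated_by_iff by blast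
  moreover from this have "W \<subseteq> arrows G"
    using openin_subset[OF W(2)] by (auto simp: gtop_eq)
  ultimately show thesis using that T by blast
qed

lemma compact_open_algebra_sets:
  assumes "openin (gtop G) U" "compactin (gtop G) U" shows "U \<in> algebra_sets k"
proof -
  define \<W> where "\<W> = {W \<in> algebra_sets k. openin (gtop G) W \<and> W \<subseteq> U}"
  have "U \<subseteq> \<Union>\<W>"
  proof
    fix \<gamma> assume "\<gamma> \<in> U"
    then obtain W where "W \<in> algebra_sets k" "openin (gtop G) W" "\<gamma> \<in> W" "W \<subseteq> U"
      by (rule open_nbhd[OF assms(1)])
    then show "\<gamma> \<in> \<Union>\<W>" unfolding \<W>_def by blast
  qed
  then obtain \<F> where \<F>: "finite \<F>" "\<F> \<subseteq> \<W>" "U \<subseteq> \<Union>\<F>"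
    using compactinD[OF assms(2), of \<W>] unfolding \<W>_def by blast
  then have "U = \<Union>\<F>" "\<F> \<subseteq> algebra_sets k" unfolding \<W>_def by blast+
  then show ?thesis using algebra_sets_Union \<F>(1) by simp
qed

end

lemma rep_onto:
  "rep ` {f :: 's \<Rightarrow>\<^sub>0 'k::{comm_ring, comm_monoid_mult}. Poly_Mapping.keys f \<subseteq> scarrier S}
    = acarrier (groupoid_algebra G)"
proof (intro equalityI subsetI)
  fix g :: "'s germ \<Rightarrow> 'k" assume "g \<in> acarrier (groupoid_algebra G)"
  then obtain F c where F: "finite F" "F \<subseteq> compact_open_bisections G"
    and g: "g = (\<lambda>\<gamma>. \<Sum>U \<in> F. c U * ind U \<gamma>)"
    unfolding groupoid_carrier by blast
  have "\<exists>f :: 's \<Rightarrow>\<^sub>0 'k. Poly_Mapping.keys f \<subseteq> scarrier S \<and> rep f = ind U" if "U \<in> F" for U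
    using compact_open_algebra_sets[of U "TYPE('k)"] that F
    unfolding compact_open_bisections_def algebra_sets_def by blast
  then obtain f :: "'s germ set \<Rightarrow> 's \<Rightarrow>\<^sub>0 'k" where f: "Poly_Mapping.keys (f U) \<subseteq> scarrier S" "rep (f U) = ind U" if "U \<in> F" for U
    by metis
  define h where "h = (\<Sum>U \<in> F. Poly_Mapping.map ((*) (c U)) (f U))"
  have "Poly_Mapping.keys h \<subseteq> (\<Union>U \<in> F. Poly_Mapping.keys (f U))"
    unfolding h_def by (intro order.trans[OF keys_sum] UN_mono order.refl keys_scale)
  then have "Poly_Mapping.keys h \<subseteq> scarrier S" using f by blast
  moreover have "rep h = g"
    unfolding g h_def by (rule ext) (auto simp: rep_sum rep_scale f intro!: sum.cong)
  ultimately show "g \<in> rep ` {f. Poly_Mapping.keys f \<subseteq> scarrier S}" by blast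
qed (use rep_in_carrier in blast)

end

section \<open>Graph inverse semigroups\<close>

locale graph_inverse_semigroup = wf_digraph E for E :: "('v, 'e) pre_digraph"
begin

abbreviation S where "S \<equiv> graph_semigroup E"
abbreviation mul (infixl "\<cdot>" 70) where "s \<cdot> t \<equiv> smult S s t"
abbreviation star ("_\<^sup>\<dagger>" [1000] 999) where "s\<^sup>\<dagger> \<equiv> sstar S s"
abbreviation Z where "Z \<equiv> gclass E Zero"
abbreviation vtx where "vtx v \<equiv> gclass E (Vertex v)"
abbreviation edge where "edge e \<equiv> gclass E (Edge e)"

section \<open>Calculating with classes of terms\<close>

lemma gcong_gterms: "gcong E s t \<Longrightarrow> s \<in> gterms E \<and> t \<in> gterms E"
  by (induction rule: gcong.induct) (auto intro!: gterms.intros)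

lemma gclass_eq_iff: "s \<in> gterms E \<Longrightarrow> gclass E s = gclass E t \<longleftrightarrow> gcong E s t"
  unfolding gclass_def by (blast intro: gcong.refl gcong.sym gcong.trans)

lemma gclass_eqI: "gcong E s t \<Longrightarrow> gclass E s = gclass E t"
  using gclass_eq_iff gcong_gterms by blast

lemma gclass_self: "s \<in> gterms E \<Longrightarrow> s \<in> gclass E s"
  by (simp add: gclass_def gcong.refl)

lemma scarrier_eq: "scarrier S = gclass E ` gterms E"
  by (simp add: graph_semigroup_def)

lemma mul_gclass: "s \<in> gterms E \<Longrightarrow> t \<in> gterms E \<Longrightarrow> gclass E s \<cdot> gclass E t = gclass E (Mult s t)"
proof -
  assume st: "s \<in> gterms E" "t \<in> gterms E"
  have "gclass E (Mult s' t') = gclass E (Mult s t)" if "s' \<in> gclass E s" "t' \<in> gclass E t" for s' t'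
    using that unfolding gclass_def[of E s] gclass_def[of E t] mem_Collect_eq
    by (rule gclass_eqI[OF gcong.sym[OF gcong.mult]])
  then have "gclass E s \<cdot> gclass E t = (\<Union>s' \<in> gclass E s. \<Union>t' \<in> gclass E t. gclass E (Mult s t))"
    unfolding graph_semigroup_def star_semigroup.simps by (simp cong: SUP_cong)
  then show ?thesis using st gclass_self by auto
qed

lemma star_gclass: "s \<in> gterms E \<Longrightarrow> (gclass E s)\<^sup>\<dagger> = gclass E (Star s)"
proof -
  assume s: "s \<in> gterms E"
  have "gclass E (Star s') = gclass E (Star s)" if "s' \<in> gclass E s" for s'
    using that unfolding gclass_def[of E s] mem_Collect_eq by (rule gclass_eqI[OF gcong.sym[OF gcong.star]])
  then have "(gclass E s)\<^sup>\<dagger> = (\<Union>s' \<in> gclass E s. gclass E (Star s))"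
    unfolding graph_semigroup_def star_semigroup.simps by (simp cong: SUP_cong)
  then show ?thesis using s gclass_self by auto
qed

lemma gclass_closed: "s \<in> gterms E \<Longrightarrow> gclass E s \<in> scarrier S"
  by (simp add: scarrier_eq)

lemma Z_closed [simp]: "Z \<in> scarrier S"
  and vtx_closed [simp]: "v \<in> verts E \<Longrightarrow> vtx v \<in> scarrier S"
  and edge_closed [simp]: "e \<in> arcs E \<Longrightarrow> edge e \<in> scarrier S"
  by (auto intro: gclass_closed gterms.intros)

lemma mul_closed [simp]: "s \<in> scarrier S \<Longrightarrow> t \<in> scarrier S \<Longrightarrow> s \<cdot> t \<in> scarrier S"
  by (auto simp: scarrier_eq mul_gclass intro: gterms.intros)

lemma star_closed [simp]: "s \<in> scarrier S \<Longrightarrow> s\<^sup>\<dagger> \<in> scarrier S"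
  by (auto simp: scarrier_eq star_gclass intro: gterms.intros)

lemma mul_assoc:
  "s \<in> scarrier S \<Longrightarrow> t \<in> scarrier S \<Longrightarrow> u \<in> scarrier S \<Longrightarrow> (s \<cdot> t) \<cdot> u = s \<cdot> (t \<cdot> u)"
  by (clarsimp simp: scarrier_eq mul_gclass gterms.intros, intro gclass_eqI gcong.assoc; assumption)

lemma star_star [simp]: "s \<in> scarrier S \<Longrightarrow> (s\<^sup>\<dagger>)\<^sup>\<dagger> = s"
  by (clarsimp simp: scarrier_eq star_gclass gterms.intros, intro gclass_eqI gcong.star_star)

lemma star_mul: "s \<in> scarrier S \<Longrightarrow> t \<in> scarrier S \<Longrightarrow> (s \<cdot> t)\<^sup>\<dagger> = t\<^sup>\<dagger> \<cdot> s\<^sup>\<dagger>"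
  by (clarsimp simp: scarrier_eq mul_gclass star_gclass gterms.intros, intro gclass_eqI gcong.star_mult; assumption)

lemma Z_mul [simp]: "s \<in> scarrier S \<Longrightarrow> Z \<cdot> s = Z" "s \<in> scarrier S \<Longrightarrow> s \<cdot> Z = Z"
  by (clarsimp simp: scarrier_eq mul_gclass gterms.intros, intro gclass_eqI gcong.zero_left gcong.zero_right; assumption)+

text \<open>The presentation does not mention the star of zero. The value follows because
  \<open>Z\<close> absorbs its own star and the involution reverses products.\<close>

lemma Z_star [simp]: "Z\<^sup>\<dagger> = Z"
proof -
  have "Z\<^sup>\<dagger> = (Z \<cdot> Z\<^sup>\<dagger>)\<^sup>\<dagger>" by simp
  also have "\<dots> = Z" by (subst star_mul) simp_all
  finally show ?thesis .
qed

lemma vtx_idem: "v \<in> verts E \<Longrightarrow> vtx v \<cdot> vtx v = vtx v"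
  and vtx_star: "v \<in> verts E \<Longrightarrow> (vtx v)\<^sup>\<dagger> = vtx v"
  and vtx_orth: "v \<in> verts E \<Longrightarrow> w \<in> verts E \<Longrightarrow> v \<noteq> w \<Longrightarrow> vtx v \<cdot> vtx w = Z"
  and edge_tail: "e \<in> arcs E \<Longrightarrow> vtx (tail E e) \<cdot> edge e = edge e"
  and edge_head: "e \<in> arcs E \<Longrightarrow> edge e \<cdot> vtx (head E e) = edge e"
  and edge_star: "e \<in> arcs E \<Longrightarrow> (edge e)\<^sup>\<dagger> \<cdot> edge e = vtx (head E e)"
  and edge_orth: "e \<in> arcs E \<Longrightarrow> f \<in> arcs E \<Longrightarrow> e \<noteq> f \<Longrightarrow> (edge f)\<^sup>\<dagger> \<cdot> edge e = Z"
  by (simp_all add: mul_gclass star_gclass gterms.intros)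
    (rule gclass_eqI, rule gcong.intros; assumption)+

section \<open>Finite paths and the elements they represent\<close>

definition paths :: "('v \<times> 'e list) set" where
  "paths = {(v, p). awalk v p (awlast v p)}"

definition pend :: "'v \<times> 'e list \<Rightarrow> 'v" where
  "pend \<pi> = awlast (fst \<pi>) (snd \<pi>)"

text \<open>The prefix order on paths is expressed as
  \<open>\<exists>xs. \<rho> = ext \<pi> xs\<close>, with the difference of the two paths as an
  explicit list.\<close>

definition ext :: "'v \<times> 'e list \<Rightarrow> 'e list \<Rightarrow> 'v \<times> 'e list" where
  "ext \<pi> xs = (fst \<pi>, snd \<pi> @ xs)"

lemma ext_Nil [simp]: "ext \<pi> [] = \<pi>"
  by (simp add: ext_def)

lemma ext_ext [simp]: "ext (ext \<pi> xs) ys = ext \<pi> (xs @ ys)"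
  by (simp add: ext_def)

lemma ext_inj [simp]: "ext \<pi> xs = ext \<pi> ys \<longleftrightarrow> xs = ys"
  by (simp add: ext_def)

lemma ext_eq_self [simp]: "ext \<pi> xs = \<pi> \<longleftrightarrow> xs = []" "\<pi> = ext \<pi> xs \<longleftrightarrow> xs = []"
  by (cases \<pi>; auto simp: ext_def)+

lemma pend_Nil [simp]: "pend (v, []) = v"
  and pend_Cons [simp]: "pend (v, e # es) = pend (head E e, es)"
  by (auto simp: pend_def)

lemma ext_paths_iff: "ext \<pi> xs \<in> paths \<longleftrightarrow> \<pi> \<in> paths \<and> (pend \<pi>, xs) \<in> paths"
  by (cases \<pi>) (auto simp: paths_def pend_def ext_def awlast_append)

lemma pend_ext: "pend (ext \<pi> xs) = pend (pend \<pi>, xs)"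
  by (simp add: pend_def ext_def awlast_append)

lemma paths_Nil [simp]: "(v, []) \<in> paths \<longleftrightarrow> v \<in> verts E"
  by (simp add: paths_def awalk_Nil_iff)

lemma paths_Cons [simp]: "(v, e # es) \<in> paths \<longleftrightarrow> e \<in> arcs E \<and> v = tail E e \<and> (head E e, es) \<in> paths"
  by (auto simp: paths_def awalk_Cons_iff)

lemma paths_start: "\<pi> \<in> paths \<Longrightarrow> fst \<pi> \<in> verts E"
  and paths_end: "\<pi> \<in> paths \<Longrightarrow> pend \<pi> \<in> verts E"
  by (cases \<pi>; auto simp: paths_def pend_def dest: awalk_hd_in_verts awalk_last_in_verts)+

definition path_el :: "'v \<times> 'e list \<Rightarrow> ('v, 'e) gterm set" where
  "path_el \<pi> = gclass E (path_term E (fst \<pi>) (snd \<pi>))"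

lemma path_term_gterms: "(v, p) \<in> paths \<Longrightarrow> path_term E v p \<in> gterms E"
  by (induction p arbitrary: v) (auto intro: gterms.intros)

lemma path_el_closed [simp]: "\<pi> \<in> paths \<Longrightarrow> path_el \<pi> \<in> scarrier S"
  by (cases \<pi>) (auto simp: path_el_def gclass_closed path_term_gterms)

lemma path_el_Nil: "path_el (v, []) = vtx v"
  by (simp add: path_el_def)

lemma path_el_Cons: "(v, e # es) \<in> paths \<Longrightarrow> path_el (v, e # es) = edge e \<cdot> path_el (head E e, es)"
  by (simp add: path_el_def mul_gclass path_term_gterms gterms.intros)

lemma vtx_path_el: "\<pi> \<in> paths \<Longrightarrow> vtx (fst \<pi>) \<cdot> path_el \<pi> = path_el \<pi>"
  by (cases \<pi>; cases "snd \<pi>")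
    (auto simp: path_el_Nil path_el_Cons vtx_idem edge_tail simp flip: mul_assoc)

lemma vtx_path_el_orth: "\<pi> \<in> paths \<Longrightarrow> v \<in> verts E \<Longrightarrow> v \<noteq> fst \<pi> \<Longrightarrow> vtx v \<cdot> path_el \<pi> = Z"
  using paths_start[of \<pi>] by (subst vtx_path_el[symmetric]) (auto simp: vtx_orth simp flip: mul_assoc)

lemma path_el_ext: "ext \<pi> xs \<in> paths \<Longrightarrow> path_el (ext \<pi> xs) = path_el \<pi> \<cdot> path_el (pend \<pi>, xs)"
proof -
  have "path_el (v, p @ xs) = path_el (v, p) \<cdot> path_el (pend (v, p), xs)"
    if "(v, p) \<in> paths" "(pend (v, p), xs) \<in> paths" for v p
    using that
  proof (induction p arbitrary: v)
    case Nil
    then show ?case using vtx_path_el[of "(v, xs)"] by (simp add: path_el_Nil)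
  next
    case (Cons e p)
    then have "(v, e # p @ xs) \<in> paths" using ext_paths_iff[of "(head E e, p)" xs] by (simp add: ext_def)
    then show ?case using Cons by (simp add: path_el_Cons mul_assoc)
  qed
  then show "ext \<pi> xs \<in> paths \<Longrightarrow> ?thesis" unfolding ext_paths_iff by (cases \<pi>) (auto simp: ext_def)
qed

lemma path_el_star: "\<pi> \<in> paths \<Longrightarrow> (path_el \<pi>)\<^sup>\<dagger> \<cdot> path_el \<pi> = vtx (pend \<pi>)"
proof -
  have "(path_el (v, p))\<^sup>\<dagger> \<cdot> path_el (v, p) = vtx (pend (v, p))" if "(v, p) \<in> paths" for v p
    using that
  proof (induction p arbitrary: v)
    case Nil
    then show ?case by (simp add: path_el_Nil vtx_idem vtx_star)
  next
    case (Cons e p)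
    then have p: "(head E e, p) \<in> paths" "e \<in> arcs E" by auto
    have "(path_el (v, e # p))\<^sup>\<dagger> \<cdot> path_el (v, e # p)
      = (path_el (head E e, p))\<^sup>\<dagger> \<cdot> (((edge e)\<^sup>\<dagger> \<cdot> edge e) \<cdot> path_el (head E e, p))"
      using Cons p by (simp add: path_el_Cons star_mul mul_assoc)
    also have "\<dots> = vtx (pend (v, e # p))"
      using Cons.IH[of "head E e"] p vtx_path_el[of "(head E e, p)"] by (simp add: edge_star)
    finally show ?case .
  qed
  then show "\<pi> \<in> paths \<Longrightarrow> ?thesis" by (cases \<pi>) auto
qed

lemma path_el_star_ext:
  "ext \<pi> xs \<in> paths \<Longrightarrow> (path_el \<pi>)\<^sup>\<dagger> \<cdot> path_el (ext \<pi> xs) = path_el (pend \<pi>, xs)"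
  using vtx_path_el[of "(pend \<pi>, xs)"]
  by (simp add: path_el_ext ext_paths_iff path_el_star flip: mul_assoc)

text \<open>Common initial arcs cancel by \<open>edge_star\<close>. Incomparability ensures that the
  cancellation ends at two different arcs or two different vertices, whose product is zero.\<close>

lemma path_el_star_orth:
  assumes "\<pi> \<in> paths" "\<rho> \<in> paths" "\<nexists>xs. \<rho> = ext \<pi> xs" "\<nexists>xs. \<pi> = ext \<rho> xs"
  shows "(path_el \<pi>)\<^sup>\<dagger> \<cdot> path_el \<rho> = Z"
proof -
  have "(path_el (v, p))\<^sup>\<dagger> \<cdot> path_el (w, q) = Z"
    if "(v, p) \<in> paths" "(w, q) \<in> paths" "v = w \<Longrightarrow> \<nexists>xs. q = p @ xs" "v = w \<Longrightarrow> \<nexists>xs. p = q @ xs" for v w p q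
    using that
  proof (induction p arbitrary: v w q)
    case Nil
    then show ?case using vtx_path_el_orth[of "(w, q)" v] by (auto simp: path_el_Nil vtx_star)
  next
    case (Cons e p)
    then have p: "(head E e, p) \<in> paths" "e \<in> arcs E" by auto
    show ?case
    proof (cases q)
      case Nil
      \<comment> \<open>A path is incomparable with an empty path only if they start at different
        vertices; the claim then follows by taking stars.\<close>
      then have "vtx w \<cdot> path_el (v, e # p) = Z"
        using Cons.prems by (intro vtx_path_el_orth) auto
      then have "(vtx w \<cdot> path_el (v, e # p))\<^sup>\<dagger> = Z" by simp
      then show ?thesis using Nil Cons.prems by (simp add: star_mul vtx_star path_el_Nil del: paths_Cons)
    next
      case (Cons f q')
      then have q: "(head E f, q') \<in> paths" "f \<in> arcs E" using Cons.prems by auto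
      have "(path_el (v, e # p))\<^sup>\<dagger> \<cdot> path_el (w, q)
        = (path_el (head E e, p))\<^sup>\<dagger> \<cdot> (((edge e)\<^sup>\<dagger> \<cdot> edge f) \<cdot> path_el (head E f, q'))"
        using Cons.prems p q Cons by (simp add: path_el_Cons star_mul mul_assoc)
      also have "\<dots> = Z"
      proof (cases "e = f")
        case True
        then have "v = w" using Cons.prems Cons by auto
        then have "(path_el (head E e, p))\<^sup>\<dagger> \<cdot> path_el (head E e, q') = Z"
          using Cons.prems Cons True q by (intro Cons.IH) auto
        then show ?thesis using p q True vtx_path_el[of "(head E f, q')"] by (simp add: edge_star)
      next
        case False
        then show ?thesis using p q by (simp add: edge_orth)
      qed
      finally show ?thesis .
    qed
  qed
  then show ?thesis using assms by (cases \<pi>; cases \<rho>) (auto simp: ext_def)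
qed

section \<open>Normal forms and their products\<close>

definition el :: "'v \<times> 'e list \<Rightarrow> 'v \<times> 'e list \<Rightarrow> ('v, 'e) gterm set" where
  "el \<pi> \<rho> = path_el \<pi> \<cdot> (path_el \<rho>)\<^sup>\<dagger>"

lemma el_closed [simp]: "\<pi> \<in> paths \<Longrightarrow> \<rho> \<in> paths \<Longrightarrow> el \<pi> \<rho> \<in> scarrier S"
  by (simp add: el_def)

lemma el_gclass: "(v, p) \<in> paths \<Longrightarrow> (w, q) \<in> paths \<Longrightarrow>
    el (v, p) (w, q) = gclass E (Mult (path_term E v p) (Star (path_term E w q)))"
  by (simp add: el_def path_el_def mul_gclass star_gclass path_term_gterms gterms.intros)

lemma el_star: "\<pi> \<in> paths \<Longrightarrow> \<rho> \<in> paths \<Longrightarrow> (el \<pi> \<rho>)\<^sup>\<dagger> = el \<rho> \<pi>"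
  by (simp add: el_def star_mul)

text \<open>Together with \<open>el_ext_mul\<close> and \<open>el_mul_orth\<close> this is the
  multiplication table of the graph inverse semigroup: the result is governed by how the two inner
  paths compare.\<close>

lemma el_mul_ext:
  assumes "\<pi> \<in> paths" "ext \<rho> xs \<in> paths" "\<rho>' \<in> paths" "pend \<pi> = pend \<rho>"
  shows "el \<pi> \<rho> \<cdot> el (ext \<rho> xs) \<rho>' = el (ext \<pi> xs) \<rho>'"
proof -
  have p: "\<rho> \<in> paths" "(pend \<pi>, xs) \<in> paths" "ext \<pi> xs \<in> paths" using assms by (auto simp: ext_paths_iff)
  have "el \<pi> \<rho> \<cdot> el (ext \<rho> xs) \<rho>' = path_el \<pi> \<cdot> ((path_el \<rho>)\<^sup>\<dagger> \<cdot> path_el (ext \<rho> xs)) \<cdot> (path_el \<rho>')\<^sup>\<dagger>"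
    using assms p by (simp add: el_def mul_assoc)
  then show ?thesis
    unfolding path_el_star_ext[OF assms(2)] using assms(4) path_el_ext[OF p(3)] by (simp add: el_def)
qed

text \<open>The mirror image of \<open>el_mul_ext\<close>, obtained by taking stars.\<close>

lemma el_ext_mul:
  assumes "\<pi> \<in> paths" "ext \<pi>' xs \<in> paths" "\<rho>' \<in> paths" "pend \<pi>' = pend \<rho>'"
  shows "el \<pi> (ext \<pi>' xs) \<cdot> el \<pi>' \<rho>' = el \<pi> (ext \<rho>' xs)"
proof -
  have p: "\<pi>' \<in> paths" "ext \<rho>' xs \<in> paths" using assms by (auto simp: ext_paths_iff)
  have "(el \<pi> (ext \<pi>' xs) \<cdot> el \<pi>' \<rho>')\<^sup>\<dagger> = (el \<pi> (ext \<rho>' xs))\<^sup>\<dagger>"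
    using el_mul_ext[of \<rho>' \<pi>' xs \<pi>] assms p by (simp add: star_mul el_star)
  then show ?thesis using assms p star_star by (metis el_closed mul_closed)
qed

lemma el_mul_orth:
  assumes "\<pi> \<in> paths" "\<rho> \<in> paths" "\<pi>' \<in> paths" "\<rho>' \<in> paths" "\<nexists>xs. \<pi>' = ext \<rho> xs" "\<nexists>xs. \<rho> = ext \<pi>' xs"
  shows "el \<pi> \<rho> \<cdot> el \<pi>' \<rho>' = Z"
proof -
  have "el \<pi> \<rho> \<cdot> el \<pi>' \<rho>' = path_el \<pi> \<cdot> ((path_el \<rho>)\<^sup>\<dagger> \<cdot> path_el \<pi>') \<cdot> (path_el \<rho>')\<^sup>\<dagger>"
    using assms by (simp add: el_def mul_assoc)
  then show ?thesis using assms by (simp add: path_el_star_orth)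
qed

lemma vtx_eq_el: "v \<in> verts E \<Longrightarrow> vtx v = el (v, []) (v, [])"
  by (simp add: el_def path_el_Nil vtx_star vtx_idem)

lemma edge_eq_el: "e \<in> arcs E \<Longrightarrow> edge e = el (tail E e, [e]) (head E e, [])"
  by (simp add: el_def path_el_Nil path_el_Cons vtx_star mul_assoc edge_head)

lemma edge_star_eq_el: "e \<in> arcs E \<Longrightarrow> gclass E (Mult (Edge e) (Star (Edge e))) = el (tail E e, [e]) (tail E e, [e])"
proof -
  assume e: "e \<in> arcs E"
  then have "el (tail E e, [e]) (tail E e, [e]) = edge e \<cdot> (edge e)\<^sup>\<dagger>"
    by (simp add: el_def path_el_Nil path_el_Cons edge_head)
  then show ?thesis using e by (simp add: mul_gclass star_gclass gterms.intros)
qed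

text \<open>The normal forms, as an inductive set for the sake of its case rule; unlike in
  \<open>el\<close>, the two paths are required to end at the same vertex.\<close>

inductive_set elements :: "('v, 'e) gterm set set" where
  Z_in_elements: "Z \<in> elements"
| el_in_elements: "\<pi> \<in> paths \<Longrightarrow> \<rho> \<in> paths \<Longrightarrow> pend \<pi> = pend \<rho> \<Longrightarrow> el \<pi> \<rho> \<in> elements"

lemma elements_mul: "s \<in> elements \<Longrightarrow> t \<in> elements \<Longrightarrow> s \<cdot> t \<in> elements"
proof -
  have "el \<pi> \<rho> \<cdot> el \<pi>' \<rho>' \<in> elements" if p: "\<pi> \<in> paths" "\<rho> \<in> paths" "pend \<pi> = pend \<rho>" "\<pi>' \<in> paths" "\<rho>' \<in> paths" "pend \<pi>' = pend \<rho>'"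
    for \<pi> \<rho> \<pi>' \<rho>'
  proof -
    consider xs where "\<pi>' = ext \<rho> xs" | xs where "\<rho> = ext \<pi>' xs" | "\<nexists>xs. \<pi>' = ext \<rho> xs" "\<nexists>xs. \<rho> = ext \<pi>' xs" by blast
    then show ?thesis
    proof cases
      case (1 xs)
      then have "ext \<pi> xs \<in> paths" "pend (ext \<pi> xs) = pend \<rho>'" using p by (auto simp: ext_paths_iff pend_ext)
      then show ?thesis using p 1 by (simp add: el_in_elements el_mul_ext)
    next
      case (2 xs)
      then have "ext \<rho>' xs \<in> paths" "pend \<pi> = pend (ext \<rho>' xs)" using p by (auto simp: ext_paths_iff pend_ext)
      then show ?thesis using p 2 by (simp add: el_in_elements el_ext_mul)
    next
      case 3
      then show ?thesis using p by (simp add: Z_in_elements el_mul_orth)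
    qed
  qed
  then show "s \<in> elements \<Longrightarrow> t \<in> elements \<Longrightarrow> s \<cdot> t \<in> elements"
    by (elim elements.cases) (simp_all add: Z_in_elements)
qed

text \<open>The generators have normal forms, and normal forms are closed under product and star, so
  induction on terms reaches every element.\<close>

lemma scarrier_elements: "scarrier S = elements"
proof
  show "elements \<subseteq> scarrier S" by (auto elim: elements.cases)
  have "gclass E t \<in> elements" if "t \<in> gterms E" for t
    using that
  proof (induction t rule: gterms.induct)
    case (2 v) then show ?case by (simp add: el_in_elements vtx_eq_el)
  next
    case (3 e)
    then show ?case by (simp add: el_in_elements edge_eq_el)
  next
    case (4 s t) then show ?case using elements_mul[of "gclass E s" "gclass E t"] by (simp add: mul_gclass)
  next
    case (5 s)
    have "t\<^sup>\<dagger> \<in> elements" if "t \<in> elements" for t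
      using that by cases (simp_all add: el_star el_in_elements Z_in_elements)
    from this[OF 5(2)] show ?case using 5 by (simp add: star_gclass)
  qed (rule Z_in_elements)
  then show "scarrier S \<subseteq> elements" by (auto simp: scarrier_eq)
qed

text \<open>Distinct normal forms are distinguished by the action of \<open>P\<^sub>E\<close> on finite paths by
  partial injections, where arcs act by prepending.\<close>

primrec path_action :: "('v, 'e) gterm \<Rightarrow> (('v \<times> 'e list) \<times> ('v \<times> 'e list)) set" where
  "path_action Zero = {}"
| "path_action (Vertex v) = {(\<pi>, \<pi>) | \<pi>. \<pi> \<in> paths \<and> fst \<pi> = v}"
| "path_action (Edge e) = {((tail E e, e # p), (head E e, p)) | p. (head E e, p) \<in> paths}"
| "path_action (Mult s t) = path_action s O path_action t"
| "path_action (Star s) = (path_action s)\<inverse>"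

text \<open>Soundness of the model: each law and each defining relation turns into an identity
  between relations on paths.\<close>

lemma path_action_cong: "gcong E s t \<Longrightarrow> path_action s = path_action t"
  by (induction rule: gcong.induct)
    (auto simp: converse_relcomp O_assoc)

lemma path_action_path:
  "(v, p) \<in> paths \<Longrightarrow> path_action (path_term E v p) =
    {((v, p @ xs), (pend (v, p), xs)) | xs. (pend (v, p), xs) \<in> paths}"
proof (induction p arbitrary: v)
  case (Cons e p)
  then have "(head E e, p @ xs) \<in> paths \<longleftrightarrow> (pend (head E e, p), xs) \<in> paths" for xs
    using ext_paths_iff[of "(head E e, p)" xs] by (simp add: ext_def)
  then show ?case using Cons by (auto simp: relcomp.simps)
qed auto

lemma path_action_el:
  assumes "(v, p) \<in> paths" "(w, q) \<in> paths" "pend (v, p) = pend (w, q)"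
  shows "path_action (Mult (path_term E v p) (Star (path_term E w q))) =
    {(ext (v, p) xs, ext (w, q) xs) | xs. (pend (w, q), xs) \<in> paths}"
  using assms by (auto simp: path_action_path ext_def relcomp.simps)

text \<open>The relation of pq* consists of the common extensions of p and q and contains the pair
  (p, q) itself. So equal elements extend each other's paths, in both directions, and the difference
  must be empty.\<close>

lemma el_eq_iff:
  assumes "\<pi> \<in> paths" "\<rho> \<in> paths" "pend \<pi> = pend \<rho>" "\<pi>' \<in> paths" "\<rho>' \<in> paths" "pend \<pi>' = pend \<rho>'"
  shows "el \<pi> \<rho> = el \<pi>' \<rho>' \<longleftrightarrow> \<pi> = \<pi>' \<and> \<rho> = \<rho>'"
proof
  have *: "\<exists>xs. \<pi> = ext \<pi>' xs \<and> \<rho> = ext \<rho>' xs"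
    if p: "\<pi> \<in> paths" "\<rho> \<in> paths" "pend \<pi> = pend \<rho>" "\<pi>' \<in> paths" "\<rho>' \<in> paths" "pend \<pi>' = pend \<rho>'"
      and eq: "el \<pi> \<rho> = el \<pi>' \<rho>'" for \<pi> \<rho> \<pi>' \<rho>'
  proof -
    obtain v p w q v' p' w' q' where [simp]: "\<pi> = (v, p)" "\<rho> = (w, q)" "\<pi>' = (v', p')" "\<rho>' = (w', q')"
      by (cases \<pi>; cases \<rho>; cases \<pi>'; cases \<rho>') blast
    have "gcong E (Mult (path_term E v p) (Star (path_term E w q))) (Mult (path_term E v' p') (Star (path_term E w' q')))"
      using eq p by (subst gclass_eq_iff[symmetric]) (auto simp: el_gclass intro: gterms.intros path_term_gterms)
    then have "{(ext \<pi> xs, ext \<rho> xs) | xs. (pend \<rho>, xs) \<in> paths} = {(ext \<pi>' xs, ext \<rho>' xs) | xs. (pend \<rho>', xs) \<in> paths}"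
      using path_action_cong p path_action_el[of v p w q] path_action_el[of v' p' w' q']
      by (simp only: \<open>\<pi> = (v, p)\<close> \<open>\<rho> = (w, q)\<close> \<open>\<pi>' = (v', p')\<close> \<open>\<rho>' = (w', q')\<close>)
    moreover have "(ext \<pi> [], ext \<rho> []) \<in> {(ext \<pi> xs, ext \<rho> xs) | xs. (pend \<rho>, xs) \<in> paths}"
      using paths_end[OF p(2)] paths_Nil by blast
    ultimately show ?thesis by auto
  qed
  assume eq: "el \<pi> \<rho> = el \<pi>' \<rho>'"
  obtain xs where 1: "\<pi> = ext \<pi>' xs" "\<rho> = ext \<rho>' xs" using *[OF assms eq] by blast
  obtain ys where 2: "\<pi>' = ext \<pi> ys" "\<rho>' = ext \<rho> ys" using *[OF assms(4-6,1-3) eq[symmetric]] by blast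
  have "\<pi> = ext \<pi> (ys @ xs)" using 1 2 by (metis ext_ext)
  then have "xs = []" by simp
  then show "\<pi> = \<pi>' \<and> \<rho> = \<rho>'" using 1 by simp
qed simp

lemma el_neq_Z:
  assumes "\<pi> \<in> paths" "\<rho> \<in> paths" "pend \<pi> = pend \<rho>" shows "el \<pi> \<rho> \<noteq> Z" "Z \<noteq> el \<pi> \<rho>"
proof -
  obtain v p w q where [simp]: "\<pi> = (v, p)" "\<rho> = (w, q)" by (cases \<pi>; cases \<rho>) blast
  show "el \<pi> \<rho> \<noteq> Z"
  proof
    assume "el \<pi> \<rho> = Z"
    then have "gcong E Zero (Mult (path_term E v p) (Star (path_term E w q)))"
      using assms by (subst gclass_eq_iff[symmetric]) (auto simp: el_gclass intro: gterms.intros)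
    from path_action_cong[OF this] have "{(ext \<pi> xs, ext \<rho> xs) | xs. (pend \<rho>, xs) \<in> paths} = {}"
      using path_action_el[of v p w q] assms
      by (simp only: \<open>\<pi> = (v, p)\<close> \<open>\<rho> = (w, q)\<close> path_action.simps(1))
    then show False using paths_end[OF assms(2)] paths_Nil by blast
  qed
  then show "Z \<noteq> el \<pi> \<rho>" by simp
qed

lemma path_cases:
  obtains xs where "\<rho> = ext \<pi> xs" | xs where "\<pi> = ext \<rho> xs" | "\<nexists>xs. \<rho> = ext \<pi> xs" "\<nexists>xs. \<pi> = ext \<rho> xs"
  by blast

text \<open>Squaring pq* lengthens one of the two paths by their difference, or gives zero if they
  are incomparable. By uniqueness of normal forms the difference is empty.\<close>

lemma idempotents_eq: "idempotents S = insert Z {el \<pi> \<pi> | \<pi>. \<pi> \<in> paths}"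
proof (intro equalityI subsetI)
  fix s assume s: "s \<in> idempotents S"
  then have "s \<in> elements" "s \<cdot> s = s" by (auto simp: idempotents_def scarrier_elements)
  then show "s \<in> insert Z {el \<pi> \<pi> | \<pi>. \<pi> \<in> paths}"
  proof cases
    case (el_in_elements \<pi> \<rho>)
    note p = el_in_elements
    show ?thesis
    proof (cases rule: path_cases[of \<pi> \<rho>])
      case (1 xs)
      then have "el (ext \<pi> xs) \<rho> = el \<pi> \<rho>"
        using p \<open>s \<cdot> s = s\<close> el_mul_ext[of \<pi> \<rho> xs \<rho>] by simp
      moreover have "ext \<pi> xs \<in> paths" "pend (ext \<pi> xs) = pend \<rho>"
        using 1 p ext_paths_iff[of \<rho> xs] pend_ext[of \<rho> xs] ext_paths_iff[of \<pi> xs] pend_ext[of \<pi> xs] by metis+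
      ultimately have "xs = []" using p el_eq_iff[of "ext \<pi> xs" \<rho> \<pi> \<rho>] by simp
      then have "\<pi> = \<rho>" using 1 by simp
      then show ?thesis using p by blast
    next
      case (2 xs)
      then have "el \<pi> (ext \<rho> xs) = el \<pi> \<rho>"
        using p \<open>s \<cdot> s = s\<close> el_ext_mul[of \<pi> \<pi> xs \<rho>] by simp
      moreover have "ext \<rho> xs \<in> paths" "pend \<pi> = pend (ext \<rho> xs)"
        using 2 p ext_paths_iff[of \<rho> xs] pend_ext[of \<rho> xs] ext_paths_iff[of \<pi> xs] pend_ext[of \<pi> xs] by metis+
      ultimately have "xs = []" using p el_eq_iff[of \<pi> "ext \<rho> xs" \<pi> \<rho>] by simp
      then have "\<pi> = \<rho>" using 2 by simp
      then show ?thesis using p by blast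
    next
      case 3
      then show ?thesis using p \<open>s \<cdot> s = s\<close> el_mul_orth[of \<pi> \<rho> \<pi> \<rho>] by simp
    qed
  qed simp
next
  fix s assume "s \<in> insert Z {el \<pi> \<pi> | \<pi>. \<pi> \<in> paths}"
  then show "s \<in> idempotents S"
    using el_mul_ext[of _ _ "[]"] by (auto simp: idempotents_def)
qed

lemma el_idem: "\<pi> \<in> paths \<Longrightarrow> el \<pi> \<pi> \<in> idempotents S"
  and Z_idem: "Z \<in> idempotents S"
  unfolding idempotents_eq by blast+

lemma el_diag_eq_iff: "\<pi> \<in> paths \<Longrightarrow> \<rho> \<in> paths \<Longrightarrow> el \<pi> \<pi> = el \<rho> \<rho> \<longleftrightarrow> \<pi> = \<rho>"
  using el_eq_iff[of \<pi> \<pi> \<rho> \<rho>] by simp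

lemma idem_mul_ext:
  assumes "ext \<pi> xs \<in> paths"
  shows "el \<pi> \<pi> \<cdot> el (ext \<pi> xs) (ext \<pi> xs) = el (ext \<pi> xs) (ext \<pi> xs)"
    "el (ext \<pi> xs) (ext \<pi> xs) \<cdot> el \<pi> \<pi> = el (ext \<pi> xs) (ext \<pi> xs)"
  using assms el_mul_ext[of \<pi> \<pi> xs "ext \<pi> xs"] el_ext_mul[of "ext \<pi> xs" \<pi> xs \<pi>]
  by (auto simp: ext_paths_iff)

lemma idem_mul_commute:
  assumes "\<pi> \<in> paths" "\<rho> \<in> paths" shows "el \<pi> \<pi> \<cdot> el \<rho> \<rho> = el \<rho> \<rho> \<cdot> el \<pi> \<pi>"
  by (cases rule: path_cases[of \<rho> \<pi>]) (use assms in \<open>auto simp: idem_mul_ext el_mul_orth\<close>)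

lemma idem_mul_eq_iff:
  assumes "\<pi> \<in> paths" "\<rho> \<in> paths"
  shows "el \<pi> \<pi> \<cdot> el \<rho> \<rho> = el \<pi> \<pi> \<longleftrightarrow> (\<exists>xs. \<pi> = ext \<rho> xs)"
proof (cases rule: path_cases[of \<rho> \<pi>])
  case (1 xs)
  then show ?thesis using assms el_eq_iff[of \<rho> \<rho> \<pi> \<pi>] by (auto simp: idem_mul_ext)
next
  case (2 xs)
  then show ?thesis using assms by (auto simp: idem_mul_ext)
next
  case 3
  then show ?thesis using assms el_neq_Z by (auto simp: el_mul_orth)
qed

sublocale inv: inverse_semigroup S
proof
  show "s \<cdot> (s\<^sup>\<dagger> \<cdot> s) = s" if "s \<in> scarrier S" for s
    using that unfolding scarrier_elements
  proof cases
    case (el_in_elements \<pi> \<rho>)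
    then show ?thesis using el_mul_ext[of \<rho> \<pi> "[]" \<rho>] el_mul_ext[of \<pi> \<rho> "[]" \<rho>] by (simp add: el_star)
  qed simp
  show "e \<cdot> f = f \<cdot> e" if "e \<in> idempotents S" "f \<in> idempotents S" for e f
    using that by (auto simp: idempotents_eq idem_mul_commute)
qed (auto simp: mul_assoc star_mul)

section \<open>Characters as prefix-closed chains of paths\<close>

definition on :: "(('v, 'e) gterm set \<Rightarrow> nat) \<Rightarrow> 'v \<times> 'e list \<Rightarrow> bool" where
  "on \<theta> \<pi> \<longleftrightarrow> \<theta> (el \<pi> \<pi>) = 1"

lemma char_not_on: "\<theta> \<in> characters S \<Longrightarrow> \<pi> \<in> paths \<Longrightarrow> \<not> on \<theta> \<pi> \<Longrightarrow> \<theta> (el \<pi> \<pi>) = 0"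
  using inv.char_01[OF _ el_idem] unfolding on_def by blast

lemma char_eqI:
  assumes \<theta>: "\<theta> \<in> characters S" and \<eta>: "\<eta> \<in> characters S" and "\<theta> Z = \<eta> Z"
    and on: "\<And>\<pi>. \<pi> \<in> paths \<Longrightarrow> on \<theta> \<pi> \<longleftrightarrow> on \<eta> \<pi>"
  shows "\<theta> = \<eta>"
proof (rule inv.char_ext[OF \<theta> \<eta>])
  fix e assume "e \<in> idempotents S"
  then consider "e = Z" | \<pi> where "\<pi> \<in> paths" "e = el \<pi> \<pi>" by (auto simp: idempotents_eq)
  then show "\<theta> e = \<eta> e"
  proof cases
    case (2 \<pi>)
    show ?thesis
    proof (cases "on \<theta> \<pi>")
      case True
      then have "on \<eta> \<pi>" using on 2 by blast
      then show ?thesis using True 2 unfolding on_def by simp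
    next
      case False
      then have "\<not> on \<eta> \<pi>" using on 2 by blast
      then show ?thesis using False 2 char_not_on[OF \<theta>] char_not_on[OF \<eta>] by simp
    qed
  qed (use assms in simp)
qed

lemma on_prefix:
  assumes "\<theta> \<in> characters S" "ext \<pi> xs \<in> paths" "on \<theta> (ext \<pi> xs)" shows "on \<theta> \<pi>"
proof -
  have "\<pi> \<in> paths" using assms by (simp add: ext_paths_iff)
  then have "\<theta> (el (ext \<pi> xs) (ext \<pi> xs)) = \<theta> (el \<pi> \<pi>) * \<theta> (el (ext \<pi> xs) (ext \<pi> xs))"
    using inv.char_mult[OF assms(1), of "el \<pi> \<pi>" "el (ext \<pi> xs) (ext \<pi> xs)"] assms
    by (simp add: idem_mul_ext el_idem)
  then show ?thesis using assms by (simp add: on_def)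
qed

text \<open>The idempotents of incomparable paths multiply to \<open>Z\<close>, so a character that
  is 1 on both would be 1 at \<open>Z\<close>.\<close>

lemma on_comparable:
  assumes "\<theta> \<in> characters S" "\<theta> Z = 0" "\<pi> \<in> paths" "\<rho> \<in> paths" "on \<theta> \<pi>" "on \<theta> \<rho>"
  obtains xs where "\<rho> = ext \<pi> xs" | xs where "\<pi> = ext \<rho> xs"
proof (cases rule: path_cases[of \<rho> \<pi>])
  case 3
  then have "\<theta> Z = \<theta> (el \<pi> \<pi>) * \<theta> (el \<rho> \<rho>)"
    using inv.char_mult[OF assms(1), of "el \<pi> \<pi>" "el \<rho> \<rho>"] assms by (simp add: el_mul_orth el_idem)
  then show ?thesis using assms by (simp add: on_def)
qed (use that in blast)+

definition path_set_char :: "('v \<times> 'e list) set \<Rightarrow> ('v, 'e) gterm set \<Rightarrow> nat" where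
  "path_set_char C = (\<lambda>f \<in> idempotents S. if \<exists>\<pi> \<in> C. f = el \<pi> \<pi> then 1 else 0)"

lemma
  assumes "C \<subseteq> paths"
  shows on_path_set_char: "\<pi> \<in> paths \<Longrightarrow> on (path_set_char C) \<pi> \<longleftrightarrow> \<pi> \<in> C"
    and path_set_char_Z: "path_set_char C Z = 0"
proof -
  show "on (path_set_char C) \<pi> \<longleftrightarrow> \<pi> \<in> C" if "\<pi> \<in> paths"
  proof -
    have "(\<exists>\<rho> \<in> C. el \<pi> \<pi> = el \<rho> \<rho>) \<longleftrightarrow> \<pi> \<in> C" using el_diag_eq_iff[OF that] assms by blast
    then show ?thesis by (simp add: on_def path_set_char_def el_idem that)
  qed
  have "\<not> (\<exists>\<rho> \<in> C. Z = el \<rho> \<rho>)" using el_neq_Z(2) assms by blast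
  then show "path_set_char C Z = 0" by (simp add: path_set_char_def Z_idem)
qed

text \<open>The converse of \<open>on_prefix\<close> and \<open>on_comparable\<close>: every
  nonempty prefix-closed chain comes from a character. This is the source of points of
  \<open>Y\<close>.\<close>

lemma path_set_char_in_characters:
  assumes C: "C \<subseteq> paths" "C \<noteq> {}"
    and prefix: "\<And>\<pi> xs. ext \<pi> xs \<in> C \<Longrightarrow> \<pi> \<in> C"
    and comparable: "\<And>\<pi> \<rho>. \<pi> \<in> C \<Longrightarrow> \<rho> \<in> C \<Longrightarrow> (\<exists>xs. \<rho> = ext \<pi> xs) \<or> (\<exists>xs. \<pi> = ext \<rho> xs)"
  shows "path_set_char C \<in> characters S"
proof -
  let ?\<theta> = "path_set_char C"
  have v: "?\<theta> (el \<pi> \<pi>) = (if \<pi> \<in> C then 1 else 0)" if "\<pi> \<in> paths" for \<pi>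
    using on_path_set_char[OF C(1) that] el_idem[OF that] by (simp add: on_def path_set_char_def split: if_splits)
  have m: "?\<theta> (el \<pi> \<pi> \<cdot> el \<rho> \<rho>) = ?\<theta> (el \<pi> \<pi>) * ?\<theta> (el \<rho> \<rho>)" if p: "\<pi> \<in> paths" "\<rho> \<in> paths" for \<pi> \<rho>
  proof (cases rule: path_cases[of \<rho> \<pi>])
    case (1 xs)
    then show ?thesis using p prefix by (auto simp: idem_mul_ext v)
  next
    case (2 xs)
    then show ?thesis using p prefix by (auto simp: idem_mul_ext v)
  next
    case 3
    then show ?thesis using p comparable[of \<pi> \<rho>] by (auto simp: el_mul_orth v path_set_char_Z[OF C(1)])
  qed
  have "?\<theta> (e \<cdot> f) = ?\<theta> e * ?\<theta> f" if "e \<in> idempotents S" "f \<in> idempotents S" for e f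
    using that unfolding idempotents_eq by (auto simp: m path_set_char_Z[OF C(1)])
  moreover obtain \<pi> where \<pi>: "\<pi> \<in> C" "\<pi> \<in> paths" using C by blast
  then have "el \<pi> \<pi> \<in> idempotents S" "?\<theta> (el \<pi> \<pi>) \<noteq> 0" using v[OF \<pi>(2)] el_idem by simp_all
  moreover have "?\<theta> \<in> idempotents S \<rightarrow>\<^sub>E {0, 1}" by (auto simp: path_set_char_def)
  ultimately show ?thesis unfolding characters_def by blast
qed

text \<open>The idempotents above the one of a path are those of its prefixes; zero is not among
  them.\<close>

lemma principal_char_el: "\<pi> \<in> paths \<Longrightarrow> principal_char S (el \<pi> \<pi>) = path_set_char {\<rho>. \<exists>xs. \<pi> = ext \<rho> xs}"
  unfolding principal_char_def path_set_char_def
proof (rule restrict_ext)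
  fix f assume \<pi>: "\<pi> \<in> paths" and "f \<in> idempotents S"
  then consider "f = Z" | \<rho> where "\<rho> \<in> paths" "f = el \<rho> \<rho>" by (auto simp: idempotents_eq)
  then have "el \<pi> \<pi> \<cdot> f = el \<pi> \<pi> \<longleftrightarrow> (\<exists>\<rho> \<in> {\<rho>. \<exists>xs. \<pi> = ext \<rho> xs}. f = el \<rho> \<rho>)"
  proof cases
    case 1
    have "f \<noteq> el \<rho> \<rho>" if "\<pi> = ext \<rho> xs" for \<rho> xs using that \<pi> 1 el_neq_Z[of \<rho> \<rho>] by (auto simp: ext_paths_iff)
    then show ?thesis using \<pi> 1 el_neq_Z by auto
  next
    case (2 \<rho>)
    have "f = el \<sigma> \<sigma> \<longleftrightarrow> \<sigma> = \<rho>" if "\<pi> = ext \<sigma> xs" for \<sigma> xs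
      using that \<pi> 2 el_eq_iff[of \<rho> \<rho> \<sigma> \<sigma>] by (auto simp: ext_paths_iff)
    then have R: "(\<exists>\<sigma> \<in> {\<sigma>. \<exists>xs. \<pi> = ext \<sigma> xs}. f = el \<sigma> \<sigma>) \<longleftrightarrow> (\<exists>xs. \<pi> = ext \<rho> xs)"
      using 2 by blast
    then show ?thesis using idem_mul_eq_iff[OF \<pi> 2(1)] unfolding 2(2) by blast
  qed
  then show "(if idem_le S (el \<pi> \<pi>) f then 1 else 0) = (if \<exists>\<rho> \<in> {\<rho>. \<exists>xs. \<pi> = ext \<rho> xs}. f = el \<rho> \<rho> then 1 else 0)"
    unfolding idem_le_def by simp
qed

lemma on_principal_char:
  "\<pi> \<in> paths \<Longrightarrow> \<rho> \<in> paths \<Longrightarrow> on (principal_char S (el \<pi> \<pi>)) \<rho> \<longleftrightarrow> (\<exists>xs. \<pi> = ext \<rho> xs)"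
  "\<pi> \<in> paths \<Longrightarrow> principal_char S (el \<pi> \<pi>) Z = 0"
proof -
  assume \<pi>: "\<pi> \<in> paths"
  then have "{\<rho>. \<exists>xs. \<pi> = ext \<rho> xs} \<subseteq> paths" by (auto simp: ext_paths_iff)
  then show "\<rho> \<in> paths \<Longrightarrow> on (principal_char S (el \<pi> \<pi>)) \<rho> \<longleftrightarrow> (\<exists>xs. \<pi> = ext \<rho> xs)"
    "principal_char S (el \<pi> \<pi>) Z = 0"
    unfolding principal_char_el[OF \<pi>] by (simp_all add: on_path_set_char path_set_char_Z)
qed

lemma ext_right_cancel [simp]: "ext \<pi> xs = ext \<rho> xs \<longleftrightarrow> \<pi> = \<rho>"
  by (auto simp: ext_def prod_eq_iff)

lemma ext_eq_extD:
  "ext \<pi> xs = ext \<rho> ys \<Longrightarrow> (\<exists>zs. \<rho> = ext \<pi> zs \<and> xs = zs @ ys) \<or> (\<exists>zs. \<pi> = ext \<rho> zs \<and> ys = zs @ xs)"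
  by (cases \<pi>; cases \<rho>) (auto simp: ext_def append_eq_append_conv2)

lemma principal_char_in_characters: "\<pi> \<in> paths \<Longrightarrow> principal_char S (el \<pi> \<pi>) \<in> characters S"
  unfolding principal_char_el
proof (rule path_set_char_in_characters)
  show "{\<rho>. \<exists>xs. \<pi> = ext \<rho> xs} \<noteq> {}" using ext_Nil[of \<pi>] by (metis (mono_tags) empty_iff mem_Collect_eq)
  show "\<rho> \<in> {\<rho>. \<exists>xs. \<pi> = ext \<rho> xs}" if "ext \<rho> xs \<in> {\<rho>. \<exists>xs. \<pi> = ext \<rho> xs}" for \<rho> xs
    using that by (auto simp: ext_def)
  show "(\<exists>xs. \<sigma> = ext \<rho> xs) \<or> (\<exists>xs. \<rho> = ext \<sigma> xs)"
    if H: "\<rho> \<in> {\<rho>. \<exists>xs. \<pi> = ext \<rho> xs}" "\<sigma> \<in> {\<rho>. \<exists>xs. \<pi> = ext \<rho> xs}" for \<rho> \<sigma>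
  proof -
    obtain xs ys where "ext \<rho> xs = ext \<sigma> ys" using H by force
    from ext_eq_extD[OF this] show ?thesis by blast
  qed
qed (auto simp: ext_paths_iff)

text \<open>Zero lies below every idempotent, so the value 1 there forces the value 1
  everywhere.\<close>

lemma char_Z_eq_1_iff:
  assumes \<theta>: "\<theta> \<in> characters S" shows "\<theta> Z = 1 \<longleftrightarrow> \<theta> = principal_char S Z"
proof
  assume 1: "\<theta> Z = 1"
  show "\<theta> = principal_char S Z"
  proof
    fix f
    show "\<theta> f = principal_char S Z f"
    proof (cases "f \<in> idempotents S")
      case True
      then have "Z \<cdot> f = Z" by (auto simp: idempotents_eq)
      then have "\<theta> f = 1" using inv.char_mult[OF \<theta> Z_idem True] 1 by simp
      then show ?thesis using True \<open>Z \<cdot> f = Z\<close> by (simp add: principal_char_def idem_le_def)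
    next
      case False
      then show ?thesis using \<theta> by (auto simp: principal_char_def characters_def)
    qed
  qed
qed (simp add: principal_char_def idem_le_def Z_idem)

end

section \<open>The reduction removing the ends in \<open>X\<close>\<close>

text \<open>Only finitely many patterns on \<open>J\<close> satisfy \<open>Q\<close>, and each of
  them describes a closed box. With \<open>Q\<close> a predicate on the restricted function, the
  conditions that cut out \<open>Y\<close> become instances.\<close>

lemma closedin_finite_coordinates:
  fixes Q :: "('a \<Rightarrow> nat) \<Rightarrow> bool"
  assumes J: "finite J" "J \<subseteq> I"
  shows "closedin (product_topology (\<lambda>_. discrete_topology {0, 1}) I)
    {\<theta> \<in> I \<rightarrow>\<^sub>E {0, 1}. Q (restrict \<theta> J)}"
proof -
  let ?A = "{\<eta> \<in> J \<rightarrow>\<^sub>E {0, 1}. Q \<eta>}"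
  have "{\<theta> \<in> I \<rightarrow>\<^sub>E {0, 1}. Q (restrict \<theta> J)} = (\<Union>\<eta> \<in> ?A. Pi\<^sub>E I (\<lambda>e. if e \<in> J then {\<eta> e} else {0, 1}))"
  proof (intro equalityI subsetI)
    fix \<theta> assume "\<theta> \<in> {\<theta> \<in> I \<rightarrow>\<^sub>E {0, 1}. Q (restrict \<theta> J)}"
    then have "restrict \<theta> J \<in> ?A" "\<theta> \<in> Pi\<^sub>E I (\<lambda>e. if e \<in> J then {restrict \<theta> J e} else {0, 1})"
      using J by (auto simp: PiE_iff)
    then show "\<theta> \<in> (\<Union>\<eta> \<in> ?A. Pi\<^sub>E I (\<lambda>e. if e \<in> J then {\<eta> e} else {0, 1}))" by blast
  next
    fix \<theta> assume "\<theta> \<in> (\<Union>\<eta> \<in> ?A. Pi\<^sub>E I (\<lambda>e. if e \<in> J then {\<eta> e} else {0, 1}))"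
    then obtain \<eta> where \<eta>: "\<eta> \<in> J \<rightarrow>\<^sub>E {0, 1}" "Q \<eta>" and \<theta>: "\<theta> \<in> Pi\<^sub>E I (\<lambda>e. if e \<in> J then {\<eta> e} else {0, 1})" by blast
    have "\<theta> e = \<eta> e" if "e \<in> J" for e using PiE_mem[OF \<theta>, of e] that J by auto
    then have "restrict \<theta> J x = \<eta> x" for x
      using PiE_arb[OF \<eta>(1), of x] by (cases "x \<in> J") simp_all
    then have "restrict \<theta> J = \<eta>" ..
    moreover have "\<theta> \<in> I \<rightarrow>\<^sub>E {0, 1}"
    proof (rule PiE_I)
      fix e assume "e \<in> I"
      then show "\<theta> e \<in> {0, 1}" using PiE_mem[OF \<theta>, of e] PiE_mem[OF \<eta>(1), of e] by (cases "e \<in> J") auto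
    qed (rule PiE_arb[OF \<theta>])
    ultimately show "\<theta> \<in> {\<theta> \<in> I \<rightarrow>\<^sub>E {0, 1}. Q (restrict \<theta> J)}" using \<eta>(2) by simp
  qed
  moreover have "finite ?A" using finite_PiE[OF J(1), of "\<lambda>_. {0, 1 :: nat}"] by simp
  moreover have "closedin (product_topology (\<lambda>_. discrete_topology {0, 1}) I) (Pi\<^sub>E I (\<lambda>e. if e \<in> J then {\<eta> e} else {0, 1}))"
    if "\<eta> \<in> ?A" for \<eta>
  proof -
    have "\<eta> e \<in> {0, 1}" if "e \<in> J" for e using \<open>\<eta> \<in> ?A\<close> that by blast
    then show ?thesis by (auto simp: closedin_product_topology)
  qed
  ultimately show ?thesis by (auto intro!: closedin_Union)
qed

locale relative_graph = graph_inverse_semigroup E for E :: "('v, 'e) pre_digraph" +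
  fixes X :: "'v set"
  assumes regular: "v \<in> X \<Longrightarrow> regular_vertex E v"
begin

definition Y :: "(('v, 'e) gterm set \<Rightarrow> nat) set" where
  "Y = characters S - ({path_char E v p | v p w. awalk v p w \<and> w \<in> X} \<union> {principal_char S Z})"

lemma ext_out_arc: "\<pi> \<in> paths \<Longrightarrow> e \<in> out_arcs E (pend \<pi>) \<Longrightarrow> ext \<pi> [e] \<in> paths"
  by (auto simp: ext_paths_iff)

lemma path_char_set:
  "{path_char E v p | v p w. awalk v p w \<and> w \<in> X} = {principal_char S (el \<pi> \<pi>) | \<pi>. \<pi> \<in> paths \<and> pend \<pi> \<in> X}"
proof -
  have "awalk v p w \<longleftrightarrow> (v, p) \<in> paths \<and> w = pend (v, p)" for v p w
    by (auto simp: paths_def pend_def)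
  moreover have "path_char E v p = principal_char S (el (v, p) (v, p))" if "(v, p) \<in> paths" for v p
    using that by (simp add: path_char_def el_gclass)
  ultimately show ?thesis by (auto; metis)
qed

text \<open>A character that is 0 at \<open>Z\<close> is the principal character of \<pi> exactly
  when its chain reaches \<pi> and stops there. Removing these points for all \<pi> that end in
  \<open>X\<close> thus demands a further arc, a condition on finitely many coordinates at a
  time.\<close>

lemma Y_iff:
  "\<theta> \<in> Y \<longleftrightarrow> \<theta> \<in> characters S \<and> \<theta> Z = 0 \<and>
    (\<forall>\<pi> \<in> paths. pend \<pi> \<in> X \<longrightarrow> on \<theta> \<pi> \<longrightarrow> (\<exists>e \<in> out_arcs E (pend \<pi>). on \<theta> (ext \<pi> [e])))"
    (is "_ \<longleftrightarrow> ?R")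
proof -
  have *: "\<theta> = principal_char S (el \<pi> \<pi>) \<longleftrightarrow> on \<theta> \<pi> \<and> (\<forall>e \<in> out_arcs E (pend \<pi>). \<not> on \<theta> (ext \<pi> [e]))"
    if \<theta>: "\<theta> \<in> characters S" "\<theta> Z = 0" and \<pi>: "\<pi> \<in> paths" for \<pi>
  proof
    assume "\<theta> = principal_char S (el \<pi> \<pi>)"
    moreover have "\<not> on (principal_char S (el \<pi> \<pi>)) (ext \<pi> [e])" if "e \<in> out_arcs E (pend \<pi>)" for e
      using that \<pi> ext_out_arc[OF \<pi> that] by (simp add: on_principal_char)
    moreover have "on (principal_char S (el \<pi> \<pi>)) \<pi>"
      using \<pi> ext_Nil[of \<pi>] by (metis on_principal_char(1))
    ultimately show "on \<theta> \<pi> \<and> (\<forall>e \<in> out_arcs E (pend \<pi>). \<not> on \<theta> (ext \<pi> [e]))" by blast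
  next
    assume a: "on \<theta> \<pi> \<and> (\<forall>e \<in> out_arcs E (pend \<pi>). \<not> on \<theta> (ext \<pi> [e]))"
    show "\<theta> = principal_char S (el \<pi> \<pi>)"
    proof (rule char_eqI[OF \<theta>(1) principal_char_in_characters[OF \<pi>]])
      show "\<theta> Z = principal_char S (el \<pi> \<pi>) Z" using \<theta> \<pi> by (simp add: on_principal_char)
      fix \<rho> assume \<rho>: "\<rho> \<in> paths"
      have "(\<exists>xs. \<pi> = ext \<rho> xs)" if "on \<theta> \<rho>"
      proof (rule on_comparable[OF \<theta> \<pi> \<rho> _ that])
        \<comment> \<open>A path of the chain strictly beyond \<pi> would have a first arc after
          \<pi>, and by prefix-closure the chain would pass through it.\<close>
        fix xs assume xs: "\<rho> = ext \<pi> xs"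
        show ?thesis
        proof (cases xs)
          case (Cons e ys)
          then have "\<rho> = ext (ext \<pi> [e]) ys" using xs by simp
          then have "on \<theta> (ext \<pi> [e])" using on_prefix[OF \<theta>(1)] \<rho> that by blast
          moreover have "e \<in> out_arcs E (pend \<pi>)" using \<rho> xs Cons by (auto simp: ext_paths_iff)
          ultimately show ?thesis using a by blast
        qed (use xs ext_Nil[of \<pi>] in auto)
      qed (use a in blast)+
      then show "on \<theta> \<rho> \<longleftrightarrow> on (principal_char S (el \<pi> \<pi>)) \<rho>"
        unfolding on_principal_char(1)[OF \<pi> \<rho>] using on_prefix[OF \<theta>(1)] \<pi> a by blast
    qed
  qed
  have 01: "\<theta> Z = 0 \<or> \<theta> Z = 1" if "\<theta> \<in> characters S" using inv.char_01[OF that Z_idem] .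
  show ?thesis
  proof (cases "\<theta> \<in> characters S \<and> \<theta> Z = 0")
    case True
    then have \<theta>: "\<theta> \<in> characters S" "\<theta> Z = 0" by auto
    then have "\<theta> \<noteq> principal_char S Z" using char_Z_eq_1_iff[of \<theta>] by auto
    then have "\<theta> \<in> Y \<longleftrightarrow> (\<forall>\<pi> \<in> paths. pend \<pi> \<in> X \<longrightarrow> \<theta> \<noteq> principal_char S (el \<pi> \<pi>))"
      unfolding Y_def path_char_set using \<theta> by blast
    then show ?thesis using *[OF \<theta>] \<theta> by blast
  next
    case False
    moreover have "\<theta> \<notin> Y"
    proof
      assume "\<theta> \<in> Y"
      then have "\<theta> \<in> characters S" "\<theta> \<noteq> principal_char S Z" unfolding Y_def by blast+
      then show False using False 01 char_Z_eq_1_iff[of \<theta>] by blast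
    qed
    ultimately show ?thesis by blast
  qed
qed

lemma Y_characters: "Y \<subseteq> characters S"
  by (auto simp: Y_def)

text \<open>Follow the path from \<open>\<rho>\<close> as long as it ends in \<open>X\<close>, possibly forever.\<close>

lemma Y_point:
  assumes \<rho>: "\<rho> \<in> paths"
  obtains \<theta> where "\<theta> \<in> Y" "on \<theta> \<rho>"
    "\<And>\<sigma>. pend \<rho> \<notin> X \<Longrightarrow> \<sigma> \<in> paths \<Longrightarrow> on \<theta> \<sigma> \<Longrightarrow> \<exists>xs. \<rho> = ext \<sigma> xs"
proof -
  \<comment> \<open>The walk stands still as soon as its path ends outside \<open>X\<close>;
    regularity supplies the chosen arc before that. The prefixes of all \<open>q n\<close> make up
    the chain.\<close>
  define q where "q = rec_nat \<rho> (\<lambda>_ \<pi>. if pend \<pi> \<in> X then ext \<pi> [SOME e. e \<in> out_arcs E (pend \<pi>)] else \<pi>)"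
  have q0: "q 0 = \<rho>" and qS: "q (Suc n) = (if pend (q n) \<in> X then ext (q n) [SOME e. e \<in> out_arcs E (pend (q n))] else q n)" for n
    by (simp_all add: q_def)
  have out: "(SOME e. e \<in> out_arcs E v) \<in> out_arcs E v" if "v \<in> X" for v
    using regular[OF that] unfolding regular_vertex_def some_in_eq by blast
  have q: "q n \<in> paths" for n
    by (induction n) (use \<rho> out ext_out_arc in \<open>auto simp: q0 qS\<close>)
  have mono: "\<exists>xs. q (n + m) = ext (q n) xs" for n m
  proof (induction m)
    case 0 show ?case using ext_Nil[of "q n"] by (metis add_0_right)
  next
    case (Suc m) then show ?case by (auto simp: qS)
  qed
  define C where "C = {\<sigma>. \<exists>n xs. q n = ext \<sigma> xs}"
  have qC: "q n \<in> C" for n unfolding C_def using ext_Nil[of "q n"] by (metis (mono_tags, lifting) mem_Collect_eq)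
  have C: "C \<subseteq> paths" using q by (auto simp: C_def) (metis ext_paths_iff)
  have prefix: "\<pi> \<in> C" if "ext \<pi> xs \<in> C" for \<pi> xs using that by (auto simp: C_def)
  have comp: "(\<exists>xs. \<rho> = ext \<pi> xs) \<or> (\<exists>xs. \<pi> = ext \<rho> xs)" if H: "\<pi> \<in> C" "\<rho> \<in> C" for \<pi> \<rho>
  proof -
    obtain n xs m ys where "q n = ext \<pi> xs" "q m = ext \<rho> ys" using H by (auto simp: C_def)
    moreover obtain us ws where "q (n + m) = ext (q n) us" "q (n + m) = ext (q m) ws"
      using mono[of n m] mono[of m n] unfolding add.commute[of m n] by blast
    ultimately have "ext \<pi> (xs @ us) = ext \<rho> (ys @ ws)" by (metis ext_ext)
    then show ?thesis using ext_eq_extD by blast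
  qed
  let ?\<theta> = "path_set_char C"
  have \<theta>: "?\<theta> \<in> characters S" by (rule path_set_char_in_characters[OF C]) (use qC prefix comp in blast)+
  have on: "on ?\<theta> \<sigma> \<longleftrightarrow> \<sigma> \<in> C" if "\<sigma> \<in> paths" for \<sigma> using on_path_set_char[OF C that] .
  show thesis
  proof
    show "on ?\<theta> \<rho>" using on[OF \<rho>] qC[of 0] by (simp add: q0)
    show "\<exists>xs. \<rho> = ext \<sigma> xs" if "pend \<rho> \<notin> X" "\<sigma> \<in> paths" "on ?\<theta> \<sigma>" for \<sigma>
    proof -
      have "q n = \<rho>" for n by (induction n) (use that in \<open>auto simp: q0 qS\<close>)
      then show ?thesis using on that by (auto simp: C_def)
    qed
    have "\<exists>e \<in> out_arcs E (pend \<pi>). on ?\<theta> (ext \<pi> [e])" if \<pi>: "\<pi> \<in> paths" "pend \<pi> \<in> X" "on ?\<theta> \<pi>" for \<pi>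
    proof -
      obtain n xs where n: "q n = ext \<pi> xs" using on \<pi> by (auto simp: C_def)
      \<comment> \<open>If \<open>q n\<close> goes beyond \<pi>, it is itself the longer path.
        Otherwise it equals \<pi>, which ends in \<open>X\<close>, and the walk takes another
        step.\<close>
      obtain ys where ys: "ext \<pi> ys \<in> C" "ys \<noteq> []"
      proof (cases "xs = []")
        case True
        then have "q (Suc n) = ext \<pi> [SOME e. e \<in> out_arcs E (pend \<pi>)]" using n \<pi> by (simp add: qS)
        then show ?thesis using qC[of "Suc n"] that by simp
      next
        case False
        then show ?thesis using n qC[of n] that by simp
      qed
      obtain e zs where "ys = e # zs" using ys by (cases ys) auto
      then have eC: "ext \<pi> [e] \<in> C" using ys prefix[of "ext \<pi> [e]" zs] by simp
      then have "ext \<pi> [e] \<in> paths" using C by blast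
      moreover from this have "e \<in> out_arcs E (pend \<pi>)" by (auto simp: ext_paths_iff)
      ultimately show ?thesis using on eC by blast
    qed
    then show "?\<theta> \<in> Y" using \<theta> path_set_char_Z[OF C] by (auto simp: Y_iff)
  qed
qed

section \<open>Invariance and compactness of \<open>Y\<close>\<close>

lemma germ_pairs_el:
  assumes p: "(s, \<theta>) \<in> inv.germ_pairs" and "\<theta> Z = 0"
  obtains \<pi> \<rho> where "\<pi> \<in> paths" "\<rho> \<in> paths" "pend \<pi> = pend \<rho>" "s = el \<pi> \<rho>" "on \<theta> \<rho>"
proof -
  have "s \<in> elements" "\<theta> (s\<^sup>\<dagger> \<cdot> s) = 1" using inv.germ_pairs_idem[OF p] by (auto simp: scarrier_elements)
  then show thesis
  proof cases
    case (el_in_elements \<pi> \<rho>)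
    then have "s\<^sup>\<dagger> \<cdot> s = el \<rho> \<rho>" using el_mul_ext[of \<rho> \<pi> "[]" \<rho>] by (simp add: el_star)
    then show thesis using el_in_elements that[of \<pi> \<rho>] \<open>\<theta> (s\<^sup>\<dagger> \<cdot> s) = 1\<close> by (simp add: on_def)
  qed (use assms in simp)
qed

lemma germ_pairs_el_iff:
  assumes "\<pi> \<in> paths" "\<rho> \<in> paths" "pend \<pi> = pend \<rho>"
  shows "(el \<pi> \<rho>, \<theta>) \<in> inv.germ_pairs \<longleftrightarrow> \<theta> \<in> characters S \<and> on \<theta> \<rho>"
proof -
  have "(el \<pi> \<rho>)\<^sup>\<dagger> \<cdot> el \<pi> \<rho> = el \<rho> \<rho>" using assms el_mul_ext[of \<rho> \<pi> "[]" \<rho>] by (simp add: el_star)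
  then show ?thesis using assms by (simp add: inv.germ_pairs_def char_dom_def on_def)
qed

lemma conj_el:
  assumes "\<pi> \<in> paths" "\<rho> \<in> paths" "pend \<pi> = pend \<rho>"
  shows "ext \<pi> xs \<in> paths \<Longrightarrow> el \<rho> \<pi> \<cdot> el (ext \<pi> xs) (ext \<pi> xs) \<cdot> el \<pi> \<rho> = el (ext \<rho> xs) (ext \<rho> xs)"
    and "\<pi> = ext \<sigma> xs \<Longrightarrow> el \<rho> \<pi> \<cdot> el \<sigma> \<sigma> \<cdot> el \<pi> \<rho> = el \<rho> \<rho>"
    and "\<sigma> \<in> paths \<Longrightarrow> \<nexists>xs. \<sigma> = ext \<pi> xs \<Longrightarrow> \<nexists>xs. \<pi> = ext \<sigma> xs \<Longrightarrow> el \<rho> \<pi> \<cdot> el \<sigma> \<sigma> \<cdot> el \<pi> \<rho> = Z"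
proof -
  show "el \<rho> \<pi> \<cdot> el (ext \<pi> xs) (ext \<pi> xs) \<cdot> el \<pi> \<rho> = el (ext \<rho> xs) (ext \<rho> xs)" if "ext \<pi> xs \<in> paths"
  proof -
    have "ext \<rho> xs \<in> paths" using that assms by (simp add: ext_paths_iff)
    then show ?thesis using that assms by (simp add: el_mul_ext el_ext_mul)
  qed
  show "el \<rho> \<pi> \<cdot> el \<sigma> \<sigma> \<cdot> el \<pi> \<rho> = el \<rho> \<rho>" if "\<pi> = ext \<sigma> xs"
    using that assms el_ext_mul[of \<rho> \<sigma> xs \<sigma>] el_mul_ext[of \<rho> \<pi> "[]" \<rho>] by (auto simp: ext_paths_iff)
  show "\<sigma> \<in> paths \<Longrightarrow> \<nexists>xs. \<sigma> = ext \<pi> xs \<Longrightarrow> \<nexists>xs. \<pi> = ext \<sigma> xs \<Longrightarrow> el \<rho> \<pi> \<cdot> el \<sigma> \<sigma> \<cdot> el \<pi> \<rho> = Z"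
    using assms by (simp add: el_mul_orth)
qed

text \<open>For an element with paths \<pi> and \<rho>, the action replaces the initial segment
  \<rho> of the chain by \<pi>: prefixes of \<pi> are on the new chain, extensions of \<pi>
  correspond to extensions of \<rho>, and paths incomparable to \<pi> are excluded. Corresponding
  extensions end at the same vertex, so continuation beyond \<open>X\<close> is inherited.\<close>

lemma Y_invariant:
  assumes p: "(s, \<theta>) \<in> inv.germ_pairs" and \<theta>: "\<theta> \<in> Y"
  shows "char_act S s \<theta> \<in> Y"
proof -
  have Z0: "\<theta> Z = 0" and ch: "\<theta> \<in> characters S" using \<theta> by (auto simp: Y_iff)
  obtain \<pi> \<rho> where el: "\<pi> \<in> paths" "\<rho> \<in> paths" "pend \<pi> = pend \<rho>" "s = el \<pi> \<rho>" "on \<theta> \<rho>"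
    using germ_pairs_el[OF p Z0] .
  let ?\<eta> = "char_act S s \<theta>"
  have ch': "?\<eta> \<in> characters S" using inv.char_act_in_characters[OF p] by (simp add: char_dom_def)
  have on: "on ?\<eta> \<sigma> \<longleftrightarrow> \<theta> (el \<rho> \<pi> \<cdot> el \<sigma> \<sigma> \<cdot> el \<pi> \<rho>) = 1" if "\<sigma> \<in> paths" for \<sigma>
    using that el by (simp add: on_def inv.char_act_apply el_idem el_star)
  have on_ext: "on ?\<eta> (ext \<pi> xs) \<longleftrightarrow> on \<theta> (ext \<rho> xs)" if "ext \<pi> xs \<in> paths" for xs
    unfolding on[OF that] conj_el(1)[OF el(1-3) that] by (simp only: on_def)
  have "?\<eta> Z = 0" using Z0 el by (simp add: inv.char_act_apply Z_idem el_star)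
  moreover have "\<exists>e \<in> out_arcs E (pend \<sigma>). on ?\<eta> (ext \<sigma> [e])"
    if \<sigma>: "\<sigma> \<in> paths" "pend \<sigma> \<in> X" "on ?\<eta> \<sigma>" for \<sigma>
  proof (cases rule: path_cases[of \<sigma> \<pi>])
    case (1 xs)
    have \<rho>: "ext \<rho> xs \<in> paths" "pend (ext \<rho> xs) = pend \<sigma>" using 1 \<sigma> el by (auto simp: ext_paths_iff pend_ext)
    have "on \<theta> (ext \<rho> xs)" using \<sigma> 1 on_ext by blast
    then obtain e where e: "e \<in> out_arcs E (pend \<sigma>)" "on \<theta> (ext (ext \<rho> xs) [e])"
      using \<theta> \<rho> \<sigma> by (auto simp: Y_iff)
    have "ext \<sigma> [e] \<in> paths" using ext_out_arc \<sigma> e by blast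
    then have "on ?\<eta> (ext \<sigma> [e])"
      using 1 e on_ext[of "xs @ [e]"] by simp
    then show ?thesis using e by blast
  next
    case (2 xs)
    show ?thesis
    proof (cases xs)
      case Nil
      then have "\<sigma> = \<pi>" using 2 by simp
      then have "pend \<rho> \<in> X" using \<sigma> el by simp
      then obtain e where e: "e \<in> out_arcs E (pend \<rho>)" "on \<theta> (ext \<rho> [e])"
        using \<theta> el by (auto simp: Y_iff)
      have "ext \<pi> [e] \<in> paths" using ext_out_arc el e by metis
      then have "on ?\<eta> (ext \<sigma> [e])"
        using \<open>\<sigma> = \<pi>\<close> e on_ext by blast
      then show ?thesis using e \<open>\<sigma> = \<pi>\<close> el by auto
    next
      case (Cons e ys)
      then have \<pi>: "\<pi> = ext (ext \<sigma> [e]) ys" using 2 by simp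
      then have p': "ext \<sigma> [e] \<in> paths" using el ext_paths_iff by blast
      then have "on ?\<eta> (ext \<sigma> [e])"
        unfolding on[OF p'] conj_el(2)[OF el(1-3) \<pi>] using el(5) by (simp add: on_def)
      moreover have "e \<in> out_arcs E (pend \<sigma>)" using p' by (auto simp: ext_paths_iff)
      ultimately show ?thesis by blast
    qed
  next
    case 3
    then show ?thesis using \<sigma>(3) Z0 unfolding on[OF \<sigma>(1)] by (simp add: conj_el(3)[OF el(1-3) \<sigma>(1)])
  qed
  ultimately show ?thesis using ch' by (auto simp: Y_iff)
qed

text \<open>The set is closed in the full product of two-point spaces, hence compact. The
  continuation condition at \<pi> is closed because a vertex of \<open>X\<close> emits finitely many
  arcs, so it involves finitely many coordinates.\<close>

lemma Y_compact:
  assumes e: "e \<in> idempotents S" shows "compactin (character_topology S) (char_dom S e \<inter> Y)"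
proof -
  let ?I = "idempotents S"
  let ?P = "product_topology (\<lambda>_. discrete_topology {0, 1::nat}) ?I"
  let ?T = "?I \<rightarrow>\<^sub>E {0, 1::nat}"
  define A where "A f g = {\<theta> \<in> ?T. \<theta> (f \<cdot> g) = \<theta> f * \<theta> g}" for f g
  \<comment> \<open>The value 1 at \<open>e\<close> also guarantees that a character is nonzero,
    which need not be a closed condition by itself.\<close>
  define B where "B = {\<theta> \<in> ?T. \<theta> e = 1 \<and> \<theta> Z = 0}"
  define C where "C \<pi> = {\<theta> \<in> ?T. on \<theta> \<pi> \<longrightarrow> (\<exists>a \<in> out_arcs E (pend \<pi>). on \<theta> (ext \<pi> [a]))}" for \<pi>
  have A: "closedin ?P (A f g)" if "f \<in> ?I" "g \<in> ?I" for f g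
    using closedin_finite_coordinates[of "{f, g, f \<cdot> g}" ?I "\<lambda>\<theta>. \<theta> (f \<cdot> g) = \<theta> f * \<theta> g"]
      that inv.idem_idem[OF that] unfolding A_def by simp
  have B: "closedin ?P B"
    using closedin_finite_coordinates[of "{e, Z}" ?I "\<lambda>\<theta>. \<theta> e = 1 \<and> \<theta> Z = 0"] e Z_idem
    unfolding B_def by simp
  have C: "closedin ?P (C \<pi>)" if "\<pi> \<in> paths" "pend \<pi> \<in> X" for \<pi>
  proof -
    have fin: "finite (out_arcs E (pend \<pi>))" using regular[OF that(2)] by (simp add: regular_vertex_def)
    let ?J = "insert (el \<pi> \<pi>) ((\<lambda>a. el (ext \<pi> [a]) (ext \<pi> [a])) ` out_arcs E (pend \<pi>))"
    let ?Q = "\<lambda>\<theta>. on \<theta> \<pi> \<longrightarrow> (\<exists>a \<in> out_arcs E (pend \<pi>). on \<theta> (ext \<pi> [a]))"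
    have "?J \<subseteq> ?I" using el_idem ext_out_arc that by blast
    moreover have "on (restrict \<theta> ?J) \<pi> = on \<theta> \<pi>" for \<theta> by (simp add: on_def)
    moreover have "on (restrict \<theta> ?J) (ext \<pi> [a]) = on \<theta> (ext \<pi> [a])" if "a \<in> out_arcs E (pend \<pi>)" for \<theta> a
    proof -
      have "el (ext \<pi> [a]) (ext \<pi> [a]) \<in> ?J" using that by blast
      then show ?thesis by (simp only: on_def restrict_apply if_True)
    qed
    ultimately show ?thesis
      using closedin_finite_coordinates[of ?J ?I ?Q] fin unfolding C_def by (simp cong: bex_cong del: in_out_arcs_conv)
  qed
  let ?F = "insert B ({A f g | f g. f \<in> ?I \<and> g \<in> ?I} \<union> {C \<pi> | \<pi>. \<pi> \<in> paths \<and> pend \<pi> \<in> X})"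
  have eq: "char_dom S e \<inter> Y = \<Inter>?F"
  proof (intro equalityI subsetI)
    fix \<theta> assume "\<theta> \<in> char_dom S e \<inter> Y"
    then show "\<theta> \<in> \<Inter>?F" by (auto simp: Y_iff char_dom_def characters_def A_def B_def C_def)
  next
    fix \<theta> assume \<theta>: "\<theta> \<in> \<Inter>?F"
    then have "\<theta> \<in> B" "\<And>f g. f \<in> ?I \<Longrightarrow> g \<in> ?I \<Longrightarrow> \<theta> \<in> A f g"
      "\<And>\<pi>. \<pi> \<in> paths \<Longrightarrow> pend \<pi> \<in> X \<Longrightarrow> \<theta> \<in> C \<pi>" by blast+
    moreover from this e have "\<theta> \<in> characters S"
      unfolding characters_def A_def B_def by force
    ultimately show "\<theta> \<in> char_dom S e \<inter> Y" by (auto simp: Y_iff char_dom_def B_def C_def)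
  qed
  have "closedin ?P (\<Inter>?F)" by (rule closedin_Inter) (use A B C in auto)
  moreover have "compact_space ?P" by (simp add: compact_space_product_topology compact_space_discrete_topology)
  ultimately have "compactin ?P (char_dom S e \<inter> Y)" unfolding eq by (rule closedin_compact_space[rotated])
  then show ?thesis by (simp add: character_topology_def compactin_subtopology char_dom_def) blast
qed

section \<open>Slices of normal forms\<close>

sublocale red: reduced_groupoid S Y
  by unfold_locales (use Y_characters Y_invariant Y_compact in auto)

text \<open>The one character that is 1 at \<open>Z\<close> has been removed from \<open>Y\<close>.
  Hence the zero of the semigroup is sent to 0, and an empty intersection of slices is again a
  slice.\<close>

lemma slice_Z: "red.slice Z = {}"
proof -
  have "\<theta> \<notin> Y" if "\<theta> \<in> char_dom S (Z\<^sup>\<dagger> \<cdot> Z)" for \<theta> using that by (auto simp: char_dom_def Y_iff)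
  then show ?thesis unfolding red.slice_def by blast
qed

text \<open>The two elements agree after multiplication by the idempotent of
  \<open>ext \<rho> xs\<close>, so they have the same germ at any character that is 1 there.\<close>

lemma slice_ext:
  assumes p: "ext \<pi> xs \<in> paths" "ext \<rho> xs \<in> paths" "pend \<pi> = pend \<rho>"
  shows "red.slice (el (ext \<pi> xs) (ext \<rho> xs)) \<subseteq> red.slice (el \<pi> \<rho>)"
proof
  have q: "\<pi> \<in> paths" "\<rho> \<in> paths" "pend (ext \<pi> xs) = pend (ext \<rho> xs)"
    using p by (auto simp: ext_paths_iff pend_ext)
  fix \<gamma> assume "\<gamma> \<in> red.slice (el (ext \<pi> xs) (ext \<rho> xs))"
  then obtain \<theta> where \<theta>: "(el (ext \<pi> xs) (ext \<rho> xs), \<theta>) \<in> inv.germ_pairs" "\<theta> \<in> Y"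
    "\<gamma> = germ_of S (el (ext \<pi> xs) (ext \<rho> xs)) \<theta>"
    using red.mem_slice_iff p by auto
  have on: "\<theta> \<in> characters S" "on \<theta> (ext \<rho> xs)" using \<theta>(1) p q germ_pairs_el_iff by auto
  have "el (ext \<pi> xs) (ext \<rho> xs) \<cdot> el (ext \<rho> xs) (ext \<rho> xs) = el \<pi> \<rho> \<cdot> el (ext \<rho> xs) (ext \<rho> xs)"
    using p q el_mul_ext[of "ext \<pi> xs" "ext \<rho> xs" "[]" "ext \<rho> xs"] by (simp add: el_mul_ext)
  moreover have "(el \<pi> \<rho>, \<theta>) \<in> inv.germ_pairs"
    unfolding germ_pairs_el_iff[OF q(1,2) p(3)] using on(1) on_prefix[OF on(1) p(2) on(2)] by blast
  ultimately show "\<gamma> \<in> red.slice (el \<pi> \<rho>)"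
    unfolding \<theta>(3) red.germ_of_mem_slice[OF \<theta>(1,2) el_closed[OF q(1,2)]]
    using on(2)[unfolded on_def] el_idem[OF p(2)] by blast
qed

text \<open>A common germ yields a path \<sigma> extending \<rho> and \<rho>' on whose idempotent
  both elements agree. Uniqueness of normal forms turns this into one equation for the first paths
  and one for the second, with the same lists appended; cancelling the shorter list leaves the same
  difference in both.\<close>

lemma slice_overlap:
  assumes p: "\<pi> \<in> paths" "\<rho> \<in> paths" "pend \<pi> = pend \<rho>" and p': "\<pi>' \<in> paths" "\<rho>' \<in> paths" "pend \<pi>' = pend \<rho>'"
    and \<gamma>: "\<gamma> \<in> red.slice (el \<pi> \<rho>)" "\<gamma> \<in> red.slice (el \<pi>' \<rho>')"
  shows "(\<exists>xs. \<pi> = ext \<pi>' xs \<and> \<rho> = ext \<rho>' xs) \<or> (\<exists>xs. \<pi>' = ext \<pi> xs \<and> \<rho>' = ext \<rho> xs)"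
proof -
  obtain \<theta> where \<theta>: "(el \<pi> \<rho>, \<theta>) \<in> inv.germ_pairs" "\<theta> \<in> Y" "\<gamma> = germ_of S (el \<pi> \<rho>) \<theta>"
    using red.mem_slice_iff[of "el \<pi> \<rho>"] \<gamma>(1) p by auto
  then obtain e where e: "e \<in> idempotents S" "\<theta> e = 1" "el \<pi> \<rho> \<cdot> e = el \<pi>' \<rho>' \<cdot> e"
    and "(el \<pi>' \<rho>', \<theta>) \<in> inv.germ_pairs"
    using \<gamma>(2) red.germ_of_mem_slice[OF \<theta>(1,2), of "el \<pi>' \<rho>'"] p' by auto
  then have on: "on \<theta> \<rho>" "on \<theta> \<rho>'" "\<theta> \<in> characters S" "\<theta> Z = 0" using \<theta> p p' by (auto simp: germ_pairs_el_iff Y_iff)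
  \<comment> \<open>Shrinks the witness below the domain idempotents of both elements, where it
    becomes the idempotent of a path extending \<rho> and \<rho>'.\<close>
  define f where "f = e \<cdot> el \<rho> \<rho> \<cdot> el \<rho>' \<rho>'"
  note idem = e(1) el_idem[OF p(2)] el_idem[OF p'(2)]
  note cl = idem[THEN inv.idem_closed]
  have f: "f \<in> idempotents S" "\<theta> f = 1"
    using idem on e by (simp_all add: f_def inv.idem_idem inv.char_mult on_def)
  then obtain \<sigma> where \<sigma>: "\<sigma> \<in> paths" "f = el \<sigma> \<sigma>" using on by (auto simp: idempotents_eq)
  have "f \<cdot> el \<rho>' \<rho>' = f"
    using idem cl by (simp add: f_def mul_assoc inv.idem_mult)
  moreover have "f \<cdot> el \<rho> \<rho> = f"
  proof -
    have "f \<cdot> el \<rho> \<rho> = e \<cdot> el \<rho> \<rho> \<cdot> (el \<rho>' \<rho>' \<cdot> el \<rho> \<rho>)" using cl by (simp add: f_def mul_assoc)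
    also have "\<dots> = e \<cdot> (el \<rho> \<rho> \<cdot> el \<rho> \<rho>) \<cdot> el \<rho>' \<rho>'"
      unfolding inv.idem_commute[OF idem(3,2)] using cl by (simp add: mul_assoc)
    finally show ?thesis using idem by (simp add: f_def inv.idem_mult)
  qed
  ultimately obtain xs ys where xy: "\<sigma> = ext \<rho> xs" "\<sigma> = ext \<rho>' ys"
    using idem_mul_eq_iff[OF \<sigma>(1)] p p' \<sigma>(2) by metis
  have "el \<pi> \<rho> \<cdot> f = el \<pi>' \<rho>' \<cdot> f"
    using p p' cl e(3) by (simp add: f_def) (simp flip: mul_assoc)
  moreover have "el \<pi> \<rho> \<cdot> f = el (ext \<pi> xs) \<sigma>" "el \<pi>' \<rho>' \<cdot> f = el (ext \<pi>' ys) \<sigma>"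
    using el_mul_ext[of \<pi> \<rho> xs \<sigma>] el_mul_ext[of \<pi>' \<rho>' ys \<sigma>] p p' \<sigma> xy by auto
  moreover have "ext \<pi> xs \<in> paths" "pend (ext \<pi> xs) = pend \<sigma>" "ext \<pi>' ys \<in> paths" "pend (ext \<pi>' ys) = pend \<sigma>"
    using p p' \<sigma>(1) xy ext_paths_iff pend_ext by metis+
  ultimately have \<pi>: "ext \<pi> xs = ext \<pi>' ys" using el_eq_iff \<sigma>(1) by metis
  have "ext \<rho> xs = ext \<rho>' ys" using xy by simp
  then consider zs where "\<rho>' = ext \<rho> zs" "xs = zs @ ys" | zs where "\<rho> = ext \<rho>' zs" "ys = zs @ xs"
    using ext_eq_extD by metis
  then show ?thesis
  proof cases
    case (1 zs)
    then have "ext (ext \<pi> zs) ys = ext \<pi>' ys" using \<pi> by simp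
    then have "ext \<pi> zs = \<pi>'" by (simp only: ext_right_cancel)
    then show ?thesis using 1 by blast
  next
    case (2 zs)
    then have "ext \<pi> xs = ext (ext \<pi>' zs) xs" using \<pi> by simp
    then have "\<pi> = ext \<pi>' zs" by (simp only: ext_right_cancel)
    then show ?thesis using 2 by blast
  qed
qed

lemma slice_meet:
  assumes "s \<in> scarrier S" "t \<in> scarrier S"
  shows "\<exists>r \<in> scarrier S. red.slice s \<inter> red.slice t = red.slice r"
proof (cases "red.slice s \<inter> red.slice t = {}")
  case True
  then show ?thesis using slice_Z Z_closed by metis
next
  case False
  then obtain \<gamma> where \<gamma>: "\<gamma> \<in> red.slice s" "\<gamma> \<in> red.slice t" by blast
  have "s \<noteq> Z" "t \<noteq> Z" using \<gamma> slice_Z by auto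
  then obtain \<pi> \<rho> \<pi>' \<rho>' where p: "\<pi> \<in> paths" "\<rho> \<in> paths" "pend \<pi> = pend \<rho>" "\<pi>' \<in> paths" "\<rho>' \<in> paths" "pend \<pi>' = pend \<rho>'"
    and st: "s = el \<pi> \<rho>" "t = el \<pi>' \<rho>'"
    using assms unfolding scarrier_elements by (elim elements.cases) auto
  have "red.slice s \<subseteq> red.slice t \<or> red.slice t \<subseteq> red.slice s"
    using slice_overlap[OF p \<gamma>[unfolded st]] slice_ext p unfolding st by metis
  then show ?thesis using assms by (metis inf.absorb1 inf.absorb2)
qed

sublocale meet: meet_groupoid S Y
  by unfold_locales (rule slice_meet)

section \<open>The kernel\<close>

abbreviation A :: "('k::{comm_ring, comm_monoid_mult}, ('v, 'e) gterm set \<Rightarrow>\<^sub>0 'k) kalgebra" where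
  "A \<equiv> semigroup_algebra S"

text \<open>The generators of the Cohn ideal with their terms replaced by normal forms.\<close>

definition relations :: "(('v, 'e) gterm set \<Rightarrow>\<^sub>0 'k::{comm_ring, comm_monoid_mult}) set" where
  "relations = insert (Poly_Mapping.single Z 1)
     {Poly_Mapping.single (el (v, []) (v, [])) 1
        - (\<Sum>e \<in> out_arcs E v. Poly_Mapping.single (el (v, [e]) (v, [e])) 1) | v. v \<in> X}"

lemma X_verts: "v \<in> X \<Longrightarrow> v \<in> verts E"
  using regular by (auto simp: regular_vertex_def)

lemma cohn_ideal_eq:
  "(cohn_ideal E X :: (('v, 'e) gterm set \<Rightarrow>\<^sub>0 'k::{comm_ring, comm_monoid_mult}) set) = ideal_generated A relations"
proof -
  have "Poly_Mapping.single (vtx v) 1 - (\<Sum>e \<in> out_arcs E v. Poly_Mapping.single (gclass E (Mult (Edge e) (Star (Edge e)))) 1)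
    = Poly_Mapping.single (el (v, []) (v, [])) 1 - (\<Sum>e \<in> out_arcs E v. Poly_Mapping.single (el (v, [e]) (v, [e])) (1::'k))"
    if "v \<in> X" for v
    using X_verts[OF that] by (intro arg_cong2[of _ _ _ _ minus] sum.cong) (auto simp: vtx_eq_el edge_star_eq_el)
  then show ?thesis unfolding cohn_ideal_def relations_def setcompr_eq_image by (simp cong: image_cong)
qed

lemma A_simps [simp]:
  "acarrier A = {f. Poly_Mapping.keys f \<subseteq> scarrier S}" "azero A = 0" "aadd A = (+)"
  "ascale A k = Poly_Mapping.map ((*) k)"
  by (simp_all add: semigroup_algebra_def)

lemma arc_path: "v \<in> verts E \<Longrightarrow> e \<in> out_arcs E v \<Longrightarrow> (v, [e]) \<in> paths"
  by auto

lemma relations_subset: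
  "(relations :: (('v, 'e) gterm set \<Rightarrow>\<^sub>0 'k::{comm_ring, comm_monoid_mult}) set) \<subseteq> acarrier A"
proof -
  have "Poly_Mapping.keys (Poly_Mapping.single (el (v, []) (v, [])) 1
      - (\<Sum>e \<in> out_arcs E v. Poly_Mapping.single (el (v, [e]) (v, [e])) (1::'k))) \<subseteq> scarrier S" if "v \<in> X" for v
  proof (rule order.trans[OF keys_diff], rule Un_least)
    show "Poly_Mapping.keys (Poly_Mapping.single (el (v, []) (v, [])) (1::'k)) \<subseteq> scarrier S"
      using X_verts[OF that] by simp
    show "Poly_Mapping.keys (\<Sum>e \<in> out_arcs E v. Poly_Mapping.single (el (v, [e]) (v, [e])) (1::'k)) \<subseteq> scarrier S"
      using arc_path[OF X_verts[OF that]] by (intro order.trans[OF keys_sum] UN_least) (simp del: in_out_arcs_conv)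
  qed
  then show ?thesis unfolding relations_def by auto
qed

text \<open>At a germ over \<theta> in the slice of \<open>v\<close> exactly one summand is 1. Some
  arc continues the chain since \<open>v\<close> lies in \<open>X\<close>, and two different arcs
  would give incomparable paths on one chain. Outside that slice all terms vanish.\<close>

lemma rep_relation:
  assumes v: "v \<in> X"
  shows "red.rep (Poly_Mapping.single (el (v, []) (v, [])) 1
      - (\<Sum>e \<in> out_arcs E v. Poly_Mapping.single (el (v, [e]) (v, [e])) (1::'k::{comm_ring, comm_monoid_mult}))) \<gamma> = 0"
proof -
  let ?v = "(v, []) :: 'v \<times> 'e list"
  have V: "v \<in> verts E" "finite (out_arcs E v)" using regular[OF v] by (auto simp: regular_vertex_def)
  have ve: "(v, [e]) = ext ?v [e]" for e by (simp add: ext_def)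
  have e: "ext ?v [e] \<in> paths" if "e \<in> out_arcs E v" for e using arc_path[OF V(1) that] by (simp add: ve)
  have "(\<Sum>e \<in> out_arcs E v. ind (red.slice (el (ext ?v [e]) (ext ?v [e]))) \<gamma>) = (ind (red.slice (el ?v ?v)) \<gamma> :: 'k)"
  proof (cases "\<gamma> \<in> red.slice (el ?v ?v)")
    case False
    then have "\<gamma> \<notin> red.slice (el (ext ?v [e]) (ext ?v [e]))" if "e \<in> out_arcs E v" for e
      using slice_ext[OF e[OF that] e[OF that]] by blast
    then show ?thesis using False by (simp add: ind_def del: in_out_arcs_conv)
  next
    case True
    have vc: "el ?v ?v \<in> scarrier S" using V by simp
    obtain \<theta> where \<theta>: "(el ?v ?v, \<theta>) \<in> inv.germ_pairs" "\<theta> \<in> Y" "\<gamma> = germ_of S (el ?v ?v) \<theta>"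
      using True unfolding red.mem_slice_iff[OF vc] by blast
    have ch: "\<theta> \<in> characters S" "\<theta> Z = 0" "on \<theta> ?v"
      using \<theta> germ_pairs_el_iff[of ?v ?v \<theta>] V by (auto simp: Y_iff)
    have mem: "\<gamma> \<in> red.slice (el (ext ?v [e]) (ext ?v [e])) \<longleftrightarrow> on \<theta> (ext ?v [e])" if "e \<in> out_arcs E v" for e
      using meet.germ_of_mem_slice_idem[OF \<theta>(1,2) el_idem[OF e[OF that]]]
      unfolding \<theta>(3) idem_mul_ext(1)[OF e[OF that]] on_def .
    obtain e0 where e0: "e0 \<in> out_arcs E v" "on \<theta> (ext ?v [e0])"
      using \<theta>(2) ch(3) V(1) v unfolding Y_iff by (metis paths_Nil pend_Nil)
    have uniq: "e = e0" if "e \<in> out_arcs E v" "on \<theta> (ext ?v [e])" for e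
      by (rule on_comparable[OF ch(1,2) e[OF that(1)] e[OF e0(1)] that(2) e0(2)]) (auto simp: ext_def)
    have "(\<Sum>e \<in> out_arcs E v. ind (red.slice (el (ext ?v [e]) (ext ?v [e]))) \<gamma>)
      = (\<Sum>e \<in> {e0}. ind (red.slice (el (ext ?v [e]) (ext ?v [e]))) \<gamma> :: 'k)"
    proof (rule sum.mono_neutral_right[OF V(2)])
      show "\<forall>e \<in> out_arcs E v - {e0}. ind (red.slice (el (ext ?v [e]) (ext ?v [e]))) \<gamma> = (0 :: 'k)"
        using uniq mem unfolding ind_def by (metis Diff_iff singletonI)
    qed (use e0 in blast)
    also have "\<dots> = 1" using mem e0 by (simp add: ind_def del: in_out_arcs_conv)
    finally show ?thesis using True by (simp add: ind_def)
  qed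
  then show ?thesis by (simp add: red.rep_minus red.rep_sum red.rep_single ve)
qed

section \<open>Elements that vanish as functions on the groupoid\<close>

definition ker :: "(('v, 'e) gterm set \<Rightarrow>\<^sub>0 'k::{comm_ring, comm_monoid_mult}) set" where
  "ker = {f. Poly_Mapping.keys f \<subseteq> scarrier S \<and> (\<forall>\<gamma>. red.rep f \<gamma> = 0)}"

lemma ker_ideal: "algebra_ideal (ker :: (_ \<Rightarrow>\<^sub>0 'k::{comm_ring, comm_monoid_mult}) set) A"
proof -
  have "f + g \<in> ker" if "f \<in> ker" "g \<in> ker" for f g :: "('v, 'e) gterm set \<Rightarrow>\<^sub>0 'k"
    using that keys_add[of f g] by (auto simp: ker_def red.rep_add)
  moreover have "Poly_Mapping.map ((*) k) f \<in> ker" if "f \<in> ker" for k and f :: "('v, 'e) gterm set \<Rightarrow>\<^sub>0 'k"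
    using that keys_scale[of k f] by (auto simp: ker_def red.rep_scale)
  moreover have "amult A f g \<in> ker \<and> amult A g f \<in> ker"
    if "f \<in> ker" "Poly_Mapping.keys g \<subseteq> scarrier S" for f g :: "('v, 'e) gterm set \<Rightarrow>\<^sub>0 'k"
    using that inv.semigroup_algebra_closed[of f g] inv.semigroup_algebra_closed[of g f]
    by (simp add: ker_def red.rep_mult) (simp add: groupoid_algebra_def)
  ultimately show ?thesis unfolding algebra_ideal_def by (simp add: ker_def[THEN equalityD1, THEN subsetD]) (auto simp: ker_def red.rep_zero)
qed

lemma cohn_ideal_ker: "cohn_ideal E X \<subseteq> ker"
  unfolding cohn_ideal_eq
proof (rule ideal_generated_least[OF ker_ideal])
  show "relations \<subseteq> ker"
  proof
    fix r assume r: "r \<in> relations"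
    then have "Poly_Mapping.keys r \<subseteq> scarrier S" using relations_subset by auto
    moreover have "red.rep r \<gamma> = 0" for \<gamma>
      using r rep_relation red.rep_single[of Z 1 \<gamma>] unfolding relations_def slice_Z by (auto simp: ind_def)
    ultimately show "r \<in> ker" by (simp add: ker_def)
  qed
qed

section \<open>Reduction of elements modulo the Cohn ideal\<close>

context
  fixes I :: "(('v, 'e) gterm set \<Rightarrow>\<^sub>0 'k::{comm_ring, comm_monoid_mult}) set"
  assumes I_eq: "I = cohn_ideal E X"
begin

lemma I_ideal: "algebra_ideal I A" and relations_I: "relations \<subseteq> I"
  unfolding I_eq cohn_ideal_eq
  using ideal_generated_ideal[OF inv.semigroup_algebra_carrier_ideal relations_subset] by auto

lemma I_zero: "0 \<in> I"
  and I_add: "f \<in> I \<Longrightarrow> g \<in> I \<Longrightarrow> f + g \<in> I"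
  and I_scale: "f \<in> I \<Longrightarrow> Poly_Mapping.map ((*) k) f \<in> I"
  and I_mult: "f \<in> I \<Longrightarrow> Poly_Mapping.keys g \<subseteq> scarrier S \<Longrightarrow> amult A g f \<in> I"
    "f \<in> I \<Longrightarrow> Poly_Mapping.keys g \<subseteq> scarrier S \<Longrightarrow> amult A f g \<in> I"
  using I_ideal unfolding algebra_ideal_def by auto

lemma I_sum: "(\<And>i. i \<in> B \<Longrightarrow> f i \<in> I) \<Longrightarrow> (\<Sum>i\<in>B. f i) \<in> I"
  by (induction B rule: infinite_finite_induct) (auto simp: I_zero I_add)

text \<open>The relation at the common end of the two paths is multiplied on the left by the element
  of \<pi> and on the right by the star of that of \<rho>, written as the normal forms in
  \<open>?a\<close> and \<open>?b\<close>.\<close>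

lemma I_el:
  assumes p: "\<pi> \<in> paths" "\<rho> \<in> paths" "pend \<pi> = pend \<rho>" "pend \<pi> \<in> X"
  shows "Poly_Mapping.single (el \<pi> \<rho>) 1
    - (\<Sum>e \<in> out_arcs E (pend \<pi>). Poly_Mapping.single (el (ext \<pi> [e]) (ext \<rho> [e])) 1) \<in> I"
proof -
  define v where "v = pend \<pi>"
  let ?v = "(v, []) :: 'v \<times> 'e list"
  let ?a = "Poly_Mapping.single (el \<pi> ?v) (1::'k)" and ?b = "Poly_Mapping.single (el ?v \<rho>) (1::'k)"
  have V: "?v \<in> paths" "pend \<pi> = v" "pend \<rho> = v" using p X_verts by (auto simp: v_def)
  have ve: "(v, [e]) = ext ?v [e]" for e by (simp add: ext_def)
  have e: "ext ?v [e] \<in> paths" "ext \<rho> [e] \<in> paths" if "e \<in> out_arcs E v" for e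
    using arc_path[of v e] that V p X_verts ext_out_arc[of \<rho> e] by (auto simp: ve)
  have "Poly_Mapping.single (el ?v ?v) 1 - (\<Sum>e \<in> out_arcs E v. Poly_Mapping.single (el (v, [e]) (v, [e])) 1) \<in> I"
    using relations_I p unfolding relations_def v_def by blast
  then have "amult A ?a (amult A (Poly_Mapping.single (el ?v ?v) 1
      - (\<Sum>e \<in> out_arcs E v. Poly_Mapping.single (el (v, [e]) (v, [e])) 1)) ?b) \<in> I"
    using p V by (intro I_mult) auto
  moreover have "el \<pi> ?v \<cdot> (el ?v ?v \<cdot> el ?v \<rho>) = el \<pi> \<rho>"
    using p V el_mul_ext[of ?v ?v "[]" \<rho>] el_mul_ext[of \<pi> ?v "[]" \<rho>] by simp
  moreover have "el \<pi> ?v \<cdot> (el (v, [e]) (v, [e]) \<cdot> el ?v \<rho>) = el (ext \<pi> [e]) (ext \<rho> [e])" if "e \<in> out_arcs E v" for e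
    using p V e[OF that] el_ext_mul[of "ext ?v [e]" ?v "[e]" \<rho>] el_mul_ext[of \<pi> ?v "[e]" "ext \<rho> [e]"] by (simp add: ve)
  ultimately show ?thesis
    by (simp add: semigroup_amult_diff semigroup_amult_sum semigroup_amult_single V(2) cong: sum.cong del: in_out_arcs_conv)
qed

text \<open>Only the length of the first path is bounded. Reduction appends the same arc to both
  paths, so the difference of their lengths stays fixed and the second path needs no bound of its
  own.\<close>

definition reduced :: "nat \<Rightarrow> ('v, 'e) gterm set set" where
  "reduced N = insert Z {el \<pi> \<rho> | \<pi> \<rho>. \<pi> \<in> paths \<and> \<rho> \<in> paths \<and> pend \<pi> = pend \<rho> \<and>
     length (snd \<pi>) \<le> N \<and> (length (snd \<pi>) < N \<longrightarrow> pend \<pi> \<notin> X)}"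

lemma reduce_el:
  assumes "\<pi> \<in> paths" "\<rho> \<in> paths" "pend \<pi> = pend \<rho>" "length (snd \<pi>) \<le> N"
  shows "\<exists>f. Poly_Mapping.keys f \<subseteq> reduced N \<and> Poly_Mapping.single (el \<pi> \<rho>) 1 - f \<in> I"
  using assms
proof (induction "N - length (snd \<pi>)" arbitrary: \<pi> \<rho> rule: less_induct)
  case less
  show ?case
  proof (cases "length (snd \<pi>) < N \<and> pend \<pi> \<in> X")
    case False
    then have "el \<pi> \<rho> \<in> reduced N" unfolding reduced_def using less.prems by blast
    then show ?thesis using I_zero by (intro exI[of _ "Poly_Mapping.single (el \<pi> \<rho>) 1"]) simp
  next
    case True
    have "\<exists>f. Poly_Mapping.keys f \<subseteq> reduced N \<and> Poly_Mapping.single (el (ext \<pi> [e]) (ext \<rho> [e])) 1 - f \<in> I"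
      if e: "e \<in> out_arcs E (pend \<pi>)" for e
    proof (rule less.hyps)
      show "ext \<pi> [e] \<in> paths" "ext \<rho> [e] \<in> paths" using less.prems e ext_out_arc by metis+
      show "pend (ext \<pi> [e]) = pend (ext \<rho> [e])" using less.prems by (simp add: pend_ext)
    qed (use True in \<open>auto simp: ext_def\<close>)
    then obtain f where f: "Poly_Mapping.keys (f e) \<subseteq> reduced N" "Poly_Mapping.single (el (ext \<pi> [e]) (ext \<rho> [e])) 1 - f e \<in> I"
      if "e \<in> out_arcs E (pend \<pi>)" for e by metis
    let ?s = "\<lambda>e. Poly_Mapping.single (el (ext \<pi> [e]) (ext \<rho> [e])) (1::'k)"
    have "Poly_Mapping.keys (\<Sum>e \<in> out_arcs E (pend \<pi>). f e) \<subseteq> reduced N"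
      using f by (intro order.trans[OF keys_sum] UN_least) blast
    \<comment> \<open>One use of the relation at the end of \<pi>, followed by the reductions of the
      lengthened elements.\<close>
    moreover have "Poly_Mapping.single (el \<pi> \<rho>) 1 - (\<Sum>e \<in> out_arcs E (pend \<pi>). f e) =
      (Poly_Mapping.single (el \<pi> \<rho>) 1 - (\<Sum>e \<in> out_arcs E (pend \<pi>). ?s e)) + (\<Sum>e \<in> out_arcs E (pend \<pi>). ?s e - f e)"
      by (simp add: sum_subtractf)
    moreover have "\<dots> \<in> I"
      using less.prems True f by (intro I_add I_el I_sum) auto
    ultimately show ?thesis by metis
  qed
qed

text \<open>A nonzero element has a single normal form, so each member of \<open>F\<close>
  contributes at most one length.\<close>

lemma length_bound:
  "finite F \<Longrightarrow> \<exists>N. \<forall>\<pi> \<rho>. \<pi> \<in> paths \<longrightarrow> \<rho> \<in> paths \<longrightarrow> pend \<pi> = pend \<rho> \<longrightarrow> el \<pi> \<rho> \<in> F \<longrightarrow> length (snd \<pi>) \<le> N"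
proof (induction F rule: finite_induct)
  case (insert s F)
  then obtain N where N: "\<And>\<pi> \<rho>. \<pi> \<in> paths \<Longrightarrow> \<rho> \<in> paths \<Longrightarrow> pend \<pi> = pend \<rho> \<Longrightarrow> el \<pi> \<rho> \<in> F \<Longrightarrow> length (snd \<pi>) \<le> N"
    by blast
  show ?case
  proof (cases "\<exists>\<pi> \<rho>. \<pi> \<in> paths \<and> \<rho> \<in> paths \<and> pend \<pi> = pend \<rho> \<and> s = el \<pi> \<rho>")
    case True
    then obtain \<pi>0 \<rho>0 where 0: "\<pi>0 \<in> paths" "\<rho>0 \<in> paths" "pend \<pi>0 = pend \<rho>0" "s = el \<pi>0 \<rho>0" by blast
    show ?thesis
    proof (intro exI[of _ "max N (length (snd \<pi>0))"] allI impI)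
      fix \<pi> \<rho> assume p: "\<pi> \<in> paths" "\<rho> \<in> paths" "pend \<pi> = pend \<rho>" "el \<pi> \<rho> \<in> insert s F"
      show "length (snd \<pi>) \<le> max N (length (snd \<pi>0))"
      proof (cases "el \<pi> \<rho> = s")
        case True
        then have "\<pi> = \<pi>0" using el_eq_iff[OF p(1-3) 0(1-3)] 0(4) by simp
        then show ?thesis by simp
      next
        case False
        then show ?thesis using N[OF p(1-3)] p(4) by (simp add: le_max_iff_disj)
      qed
    qed
  next
    case False
    then show ?thesis using N by (intro exI[of _ N] allI impI) blast
  qed
qed simp

lemma reduce:
  assumes f: "Poly_Mapping.keys f \<subseteq> scarrier S"
  obtains N g where "Poly_Mapping.keys g \<subseteq> reduced N" "f - g \<in> I"
proof -
  obtain N where N: "length (snd \<pi>) \<le> N" if "\<pi> \<in> paths" "\<rho> \<in> paths" "pend \<pi> = pend \<rho>" "el \<pi> \<rho> \<in> Poly_Mapping.keys f" for \<pi> \<rho>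
    using length_bound[OF finite_keys] by metis
  have "\<exists>g. Poly_Mapping.keys g \<subseteq> reduced N \<and> Poly_Mapping.single s 1 - g \<in> I" if s: "s \<in> Poly_Mapping.keys f" for s
  proof -
    have "s \<in> elements" using s f scarrier_elements by blast
    then show ?thesis
    proof cases
      case Z_in_elements
      then show ?thesis using I_zero by (intro exI[of _ "Poly_Mapping.single s 1"]) (simp add: reduced_def)
    next
      case (el_in_elements \<pi> \<rho>)
      then show ?thesis using reduce_el[of \<pi> \<rho> N] N[of \<pi> \<rho>] s by simp
    qed
  qed
  then obtain g where g: "Poly_Mapping.keys (g s) \<subseteq> reduced N" "Poly_Mapping.single s 1 - g s \<in> I" if "s \<in> Poly_Mapping.keys f" for s
    by metis
  let ?c = "\<lambda>s. Poly_Mapping.map ((*) (Poly_Mapping.lookup f s))"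
  have "Poly_Mapping.keys (\<Sum>s \<in> Poly_Mapping.keys f. ?c s (g s)) \<subseteq> reduced N"
    by (intro order.trans[OF keys_sum] UN_least order.trans[OF keys_scale g(1)])
  moreover have "f - (\<Sum>s \<in> Poly_Mapping.keys f. ?c s (g s)) = (\<Sum>s \<in> Poly_Mapping.keys f. ?c s (Poly_Mapping.single s 1 - g s))"
  proof -
    have "?c s (Poly_Mapping.single s 1 - g s) = Poly_Mapping.single s (Poly_Mapping.lookup f s) - ?c s (g s)" for s
      by (rule poly_mapping_eqI) (simp add: lookup_scale lookup_minus lookup_single when_def right_diff_distrib)
    then show ?thesis using sum_single_lookup[of f] by (simp add: sum_subtractf)
  qed
  moreover have "\<dots> \<in> I" using g by (intro I_sum I_scale)
  ultimately show thesis using that by metis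
qed

text \<open>A germ in the slice of \<open>\<pi>\<rho>\<^sup>*\<close> lies only in the slices of elements above it, if it is chosen at
  the end of \<open>\<rho>\<close> whenever \<open>\<rho>\<close> does not end in \<open>X\<close>. So the coefficients vanish by induction on the
  length of \<open>\<pi>\<close>.\<close>

lemma reduced_rep_zero:
  assumes g: "Poly_Mapping.keys g \<subseteq> reduced N" and 0: "\<And>\<gamma>. red.rep g \<gamma> = (0::'k)"
    and p: "\<pi> \<in> paths" "\<rho> \<in> paths" "pend \<pi> = pend \<rho>"
  shows "el \<pi> \<rho> \<notin> Poly_Mapping.keys g"
  using p
proof (induction "length (snd \<pi>)" arbitrary: \<pi> \<rho> rule: less_induct)
  case less
  note p = less.prems
  show ?case
  proof
    assume k: "el \<pi> \<rho> \<in> Poly_Mapping.keys g"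
    obtain \<theta> where \<theta>: "\<theta> \<in> Y" "on \<theta> \<rho>" "\<And>\<sigma>. pend \<rho> \<notin> X \<Longrightarrow> \<sigma> \<in> paths \<Longrightarrow> on \<theta> \<sigma> \<Longrightarrow> \<exists>xs. \<rho> = ext \<sigma> xs"
      using Y_point[OF p(2)] by blast
    have gp: "(el \<pi> \<rho>, \<theta>) \<in> inv.germ_pairs" using \<theta> Y_characters unfolding germ_pairs_el_iff[OF p] by blast
    define \<gamma> where "\<gamma> = germ_of S (el \<pi> \<rho>) \<theta>"
    have dom: "germ_dom \<gamma> = \<theta>" unfolding \<gamma>_def by (rule inv.germ_dom_germ_of[OF gp])
    have mem: "\<gamma> \<in> red.slice (el \<pi> \<rho>)"
      using gp \<theta>(1) p by (simp add: red.mem_slice_iff dom) (simp add: \<gamma>_def)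
    have other: "\<gamma> \<notin> red.slice t" if t: "t \<in> Poly_Mapping.keys g" "t \<noteq> el \<pi> \<rho>" for t
    proof
      assume \<gamma>t: "\<gamma> \<in> red.slice t"
      then have "t \<noteq> Z" using slice_Z by auto
      then obtain \<pi>' \<rho>' where p': "\<pi>' \<in> paths" "\<rho>' \<in> paths" "pend \<pi>' = pend \<rho>'" and t': "t = el \<pi>' \<rho>'"
        and len: "length (snd \<pi>') \<le> N" using t g unfolding reduced_def by blast
      have on': "on \<theta> \<rho>'"
        using \<gamma>t p' red.mem_slice_iff[of t \<gamma>] germ_pairs_el_iff[OF p', of \<theta>] unfolding t' dom by simp
      from slice_overlap[OF p p' mem \<gamma>t[unfolded t']] show False
      proof (elim disjE exE conjE)
        \<comment> \<open>The slice of \<open>t\<close> is the larger one, so the first path of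
          \<open>t\<close> is shorter and \<open>t\<close> is excluded by induction.\<close>
        fix xs assume x: "\<pi> = ext \<pi>' xs" "\<rho> = ext \<rho>' xs"
        then have "xs \<noteq> []" using t t' by auto
        then have "length (snd \<pi>') < length (snd \<pi>)" using x by (simp add: ext_def)
        then show False using less.hyps[OF _ p'] t(1) t' by blast
      next
        \<comment> \<open>Here \<open>t\<close> has the longer paths, so \<pi> is shorter than
          \<open>N\<close> and, being part of a reduced element, does not end in \<open>X\<close>.
          The chosen character then stops at \<rho>, although it is on the longer path
          \<rho>'.\<close>
        fix xs assume x: "\<pi>' = ext \<pi> xs" "\<rho>' = ext \<rho> xs"
        then have "xs \<noteq> []" using t t' by auto
        then have "length (snd \<pi>) < N" using x len by (cases xs) (simp_all add: ext_def)
        moreover have "el \<pi> \<rho> \<in> reduced N" using k g by blast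
        then obtain \<pi>0 \<rho>0 where "\<pi>0 \<in> paths" "\<rho>0 \<in> paths" "pend \<pi>0 = pend \<rho>0" "el \<pi> \<rho> = el \<pi>0 \<rho>0" "length (snd \<pi>0) < N \<longrightarrow> pend \<pi>0 \<notin> X"
          using el_neq_Z[OF p] unfolding reduced_def by blast
        ultimately have "pend \<rho> \<notin> X" using el_eq_iff[OF p] p by metis
        then obtain ys where "\<rho> = ext \<rho>' ys" using \<theta>(3) p'(2) on' by blast
        then have "\<rho> = ext \<rho> (xs @ ys)" using x by simp
        then show False using \<open>xs \<noteq> []\<close> by simp
      qed
    qed
    have "red.rep g \<gamma> = (\<Sum>t \<in> {el \<pi> \<rho>}. Poly_Mapping.lookup g t * ind (red.slice t) \<gamma>)"
      unfolding red.rep_def by (rule sum.mono_neutral_right) (use k other in \<open>auto simp: ind_def\<close>)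
    then have "Poly_Mapping.lookup g (el \<pi> \<rho>) = 0" using 0 mem by (simp add: ind_def)
    then show False using k by (simp add: in_keys_iff)
  qed
qed

text \<open>The ideal is contained in the kernel, so a reduced representative of a kernel element is
  again in the kernel. Its coefficients at nonzero elements vanish, and what remains is a multiple
  of the generator at \<open>Z\<close>.\<close>

lemma ker_subset: "ker \<subseteq> I"
proof
  fix f :: "('v, 'e) gterm set \<Rightarrow>\<^sub>0 'k" assume f: "f \<in> ker"
  then have "Poly_Mapping.keys f \<subseteq> scarrier S" by (simp add: ker_def)
  then obtain N g where g: "Poly_Mapping.keys g \<subseteq> reduced N" "f - g \<in> I" by (rule reduce)
  have "f - g \<in> ker" using g(2) cohn_ideal_ker unfolding I_eq by blast
  then have "red.rep g \<gamma> = 0" for \<gamma> using f by (simp add: ker_def red.rep_minus)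
  note nz = reduced_rep_zero[OF g(1) this]
  have "s = Z" if s: "s \<in> Poly_Mapping.keys g" for s
  proof (rule ccontr)
    assume "s \<noteq> Z"
    moreover have "s \<in> reduced N" using s g(1) by blast
    ultimately obtain \<pi> \<rho> where "\<pi> \<in> paths" "\<rho> \<in> paths" "pend \<pi> = pend \<rho>" "s = el \<pi> \<rho>"
      unfolding reduced_def by blast
    then show False using nz s by simp
  qed
  then have "Poly_Mapping.lookup g s = 0" if "s \<noteq> Z" for s using that by (metis in_keys_iff)
  then have "g = Poly_Mapping.map ((*) (Poly_Mapping.lookup g Z)) (Poly_Mapping.single Z 1)"
    by (intro poly_mapping_eqI) (simp add: lookup_scale lookup_single when_def)
  moreover have "Poly_Mapping.single Z 1 \<in> I" using relations_I unfolding relations_def by blast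
  ultimately have "g \<in> I" using I_scale by metis
  from I_add[OF g(2) this] show "f \<in> I" by simp
qed

end

lemma cohn_groupoid_eq: "cohn_groupoid E X = red.G"
  unfolding cohn_groupoid_def Y_def ..

lemma cohn_algebra_iso:
  "\<exists>\<phi>. \<phi> \<in> algebra_iso (cohn_algebra E X :: ('k::{comm_ring, comm_monoid_mult}, _) kalgebra)
    (groupoid_algebra (cohn_groupoid E X))"
  unfolding cohn_algebra_def cohn_groupoid_eq
proof (rule algebra_iso_quotient[where f = red.rep])
  let ?I = "cohn_ideal E X :: (('v, 'e) gterm set \<Rightarrow>\<^sub>0 'k) set"
  show "algebra_ideal ?I A" by (rule I_ideal[OF HOL.refl])
  show "red.rep ` acarrier (A :: ('k, _) kalgebra) = acarrier (groupoid_algebra red.G)"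
    using meet.rep_onto by simp
  have ker: "?I = ker" using cohn_ideal_ker ker_subset[OF HOL.refl] by blast
  fix x y :: "('v, 'e) gterm set \<Rightarrow>\<^sub>0 'k" assume x: "x \<in> acarrier A" and y: "y \<in> acarrier A"
  show xy: "x + y \<in> acarrier A \<and> x - y \<in> acarrier A"
    using x y keys_add[of x y] keys_diff[of x y] by auto
  show "red.rep x = red.rep y \<longleftrightarrow> x - y \<in> ?I"
    unfolding ker using xy by (auto simp: ker_def red.rep_minus fun_eq_iff)
  show "amult A x y \<in> acarrier A" using x y inv.semigroup_algebra_closed by simp
  show "red.rep (amult A x y) = amult (groupoid_algebra red.G) (red.rep x) (red.rep y)"
    using x y by (simp add: red.rep_mult)
  show "red.rep (x + y) = aadd (groupoid_algebra red.G) (red.rep x) (red.rep y)"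
    by (rule ext) (simp add: red.rep_add groupoid_algebra_def)
next
  fix k and x :: "('v, 'e) gterm set \<Rightarrow>\<^sub>0 'k" assume x: "x \<in> acarrier A"
  show "ascale A k x \<in> acarrier A" using x keys_scale[of k x] by auto
  show "red.rep (ascale A k x) = ascale (groupoid_algebra red.G) k (red.rep x)"
    by (rule ext) (simp add: red.rep_scale groupoid_algebra_def)
qed simp

end

theorem proposition4p11:
  fixes E :: "('v, 'e) pre_digraph" and X :: "'v set"
  assumes "wf_digraph E"
    and "\<forall>v \<in> X. regular_vertex E v"
  shows "\<exists>\<phi>. \<phi> \<in> algebra_iso
    (cohn_algebra E X :: ('k::{comm_ring, comm_monoid_mult},
      (('v, 'e) gterm set \<Rightarrow>\<^sub>0 'k) set) kalgebra)
    (groupoid_algebra (cohn_groupoid E X))"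
proof -
  interpret relative_graph E X
    using assms by (simp add: relative_graph_def graph_inverse_semigroup_def relative_graph_axioms_def)
  show ?thesis by (rule cohn_algebra_iso)
qed

end
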